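(* Let $w\in F(x_0,x_1)$ be a non-empty cyclically reduced word such that the cyclic presentation $P_2(w)=\langle x_0,x_1\mid w,\theta(w)\rangle$ is non-orientable, and let $G_2(w)$ be the group it defines. Then either $G_2(w)$ contains a non-abelian free subgroup, or $G_2(w)\cong BS(1,m)$ for some $m\in\mathbb{Z}$. Moreover, every $m\in\mathbb{Z}$ is realised: for every $m\in\mathbb{Z}$ there exists a non-orientable cyclic presentation $P_2(w)$ with $G_2(w)\cong BS(1,m)$.
   Context: $F(x_0,x_1)$ is the free group with basis $\{x_0,x_1\}$, and $\theta: F(x_0,x_1)\to F(x_0,x_1)$ is the shift automorphism defined by $\theta(x_0)=x_1$, $\theta(x_1)=x_0$. For a non-empty cyclically reduced word $w\in F(x_0,x_1)$, the cyclic presentation is $P_2(w)=\langle x_0,x_1\mid w,\theta(w)\rangle$, and $G_2(w)$ is the group it defines. $P_2(w)$ is called orientable if $w$ is not a cyclic permutation of the inverse of any of its shifts $w,\theta(w)$, and non-orientable otherwise (that is, if $w$ is a cyclic permutation of $w^{-1}$ or of $\theta(w)^{-1}$). For $m\in\mathbb{Z}$ (including $m=0$ and negative $m$), $BS(1,m)=\langle a,t\mid tat^{-1}=a^m\rangle$; in particular $BS(1,0)\cong\mathbb{Z}$ and $BS(1,1)\cong\mathbb{Z}^2$. *)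

theory Defs
  imports "HOL-Algebra.Generated_Groups"
begin

text \<open>The letter \<open>(x, True)\<close> stands for \<open>x\<close> and \<open>(x, False)\<close> for the formal inverse of \<open>x\<close>.\<close>

type_synonym 'a letter = "'a \<times> bool"

definition inv_letter :: "'a letter \<Rightarrow> 'a letter" where
  "inv_letter l = (fst l, \<not> snd l)"

definition inv_word :: "'a letter list \<Rightarrow> 'a letter list" where
  "inv_word w = rev (map inv_letter w)"

definition reduced :: "'a letter list \<Rightarrow> bool" where
  "reduced w \<longleftrightarrow> successively (\<lambda>x y. y \<noteq> inv_letter x) w"

definition cyclically_reduced :: "'a letter list \<Rightarrow> bool" where
  "cyclically_reduced w \<longleftrightarrow> reduced w \<and> (w \<noteq> [] \<longrightarrow> hd w \<noteq> inv_letter (last w))"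

definition push :: "'a letter \<Rightarrow> 'a letter list \<Rightarrow> 'a letter list" where
  "push l w = (if w \<noteq> [] \<and> hd w = inv_letter l then tl w else l # w)"

text \<open>The elements of the free group on \<open>X\<close> are the reduced words over \<open>X\<close>. Since the right
  factor is reduced, pushing the letters of the left factor onto it one after the other computes
  the reduced form of the concatenation.\<close>

definition free_group :: "'a set \<Rightarrow> 'a letter list monoid" where
  "free_group X =
     \<lparr>carrier = {w. reduced w \<and> fst ` set w \<subseteq> X}, mult = foldr push, one = []\<rparr>"

definition free_gen :: "'a \<Rightarrow> 'a letter list" where
  "free_gen x = [(x, True)]"

lemma inv_letter_inv_letter [simp]: "inv_letter (inv_letter l) = l"
  by (simp add: inv_letter_def)

lemma fst_inv_letter [simp]: "fst (inv_letter l) = fst l"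
  by (simp add: inv_letter_def)

lemma inv_letter_eq_iff: "inv_letter k = l \<longleftrightarrow> k = inv_letter l"
  by (auto simp: inv_letter_def)

lemma reduced_Nil [simp]: "reduced []"
  by (simp add: reduced_def)

lemma reduced_Cons:
  "reduced (l # w) \<longleftrightarrow> reduced w \<and> (w \<noteq> [] \<longrightarrow> hd w \<noteq> inv_letter l)"
  by (cases w) (auto simp: reduced_def)

lemma reduced_push: "reduced w \<Longrightarrow> reduced (push l w)"
  by (cases w) (auto simp: push_def reduced_Cons)

lemma set_push: "fst ` set (push l w) \<subseteq> insert (fst l) (fst ` set w)"
  by (cases w) (auto simp: push_def)

lemma push_inv: "reduced w \<Longrightarrow> push l (push (inv_letter l) w) = w"
  by (cases w) (auto simp: push_def reduced_Cons)

lemma reduced_foldr_push: "reduced v \<Longrightarrow> reduced (foldr push u v)"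
  by (induction u) (auto intro: reduced_push)

lemma set_foldr_push: "fst ` set (foldr push u v) \<subseteq> fst ` set u \<union> fst ` set v"
proof (induction u)
  case (Cons l u)
  have "fst ` set (push l (foldr push u v)) \<subseteq> insert (fst l) (fst ` set (foldr push u v))"
    by (rule set_push)
  also have "\<dots> \<subseteq> insert (fst l) (fst ` set u \<union> fst ` set v)"
    using Cons by (rule insert_mono)
  finally show ?case by simp
qed simp

lemma foldr_push_push:
  assumes "reduced w"
  shows "foldr push (push l u) w = push l (foldr push u w)"
proof (cases "u \<noteq> [] \<and> hd u = inv_letter l")
  case True
  then obtain v where "u = inv_letter l # v" by (cases u) auto
  then show ?thesis
    using assms by (simp add: push_def[of l "inv_letter l # v"] push_inv reduced_foldr_push)
qed (auto simp: push_def[of l u])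

lemma foldr_push_assoc:
  "reduced w \<Longrightarrow> foldr push (foldr push u v) w = foldr push u (foldr push v w)"
  by (induction u) (auto simp: foldr_push_push)

lemma foldr_push_Nil: "reduced u \<Longrightarrow> foldr push u [] = u"
  by (induction u) (auto simp: push_def reduced_Cons)

lemma foldr_push_inv_word: "reduced v \<Longrightarrow> foldr push (inv_word u) (foldr push u v) = v"
proof (induction u)
  case (Cons l u)
  then have "push (inv_letter l) (push l (foldr push u v)) = foldr push u v"
    using push_inv[of "foldr push u v" "inv_letter l"] by (simp add: reduced_foldr_push)
  then show ?case using Cons by (simp add: inv_word_def)
qed (simp add: inv_word_def)

lemma reduced_inv_word: "reduced u \<Longrightarrow> reduced (inv_word u)"
  unfolding reduced_def inv_word_def successively_rev successively_map
  by (erule successively_mono) (auto simp: inv_letter_eq_iff)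

lemma set_inv_word: "fst ` set (inv_word u) = fst ` set u"
  by (simp add: inv_word_def image_image)

lemma inv_word_closed: "u \<in> carrier (free_group X) \<Longrightarrow> inv_word u \<in> carrier (free_group X)"
  by (simp add: free_group_def reduced_inv_word set_inv_word)

lemma l_inv_free_group:
  "u \<in> carrier (free_group X) \<Longrightarrow> inv_word u \<otimes>\<^bsub>free_group X\<^esub> u = \<one>\<^bsub>free_group X\<^esub>"
  using foldr_push_inv_word[of "[]" u] by (simp add: free_group_def foldr_push_Nil)

lemma group_free_group: "group (free_group X)"
proof (rule groupI)
  fix u v assume "u \<in> carrier (free_group X)" "v \<in> carrier (free_group X)"
  then show "u \<otimes>\<^bsub>free_group X\<^esub> v \<in> carrier (free_group X)"
    using set_foldr_push[of u v]
    by (simp add: free_group_def reduced_foldr_push) (meson le_supI subset_trans)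
next
  fix u assume "u \<in> carrier (free_group X)"
  then show "\<exists>v\<in>carrier (free_group X). v \<otimes>\<^bsub>free_group X\<^esub> u = \<one>\<^bsub>free_group X\<^esub>"
    using inv_word_closed l_inv_free_group by blast
qed (auto simp: free_group_def foldr_push_assoc)

lemma inv_free_group:
  "u \<in> carrier (free_group X) \<Longrightarrow> inv\<^bsub>free_group X\<^esub> u = inv_word u"
  using group.inv_equality[OF group_free_group l_inv_free_group] inv_word_closed by blast

text \<open>A basis of \<open>G\<close> is a subset of \<open>G\<close>, so letting \<open>X\<close> range over the type of the
  elements of \<open>G\<close> is no restriction.\<close>

definition is_free :: "('g, 'b) monoid_scheme \<Rightarrow> bool" where
  "is_free G \<longleftrightarrow> (\<exists>X :: 'g set. free_group X \<cong> G)"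

definition has_nonabelian_free_subgroup :: "('g, 'b) monoid_scheme \<Rightarrow> bool" where
  "has_nonabelian_free_subgroup G \<longleftrightarrow>
     (\<exists>H. subgroup H G \<and> is_free (G\<lparr>carrier := H\<rparr>) \<and> \<not> comm_group (G\<lparr>carrier := H\<rparr>))"

definition normal_closure :: "('g, 'b) monoid_scheme \<Rightarrow> 'g set \<Rightarrow> 'g set" where
  "normal_closure G R = \<Inter> {N. N \<lhd> G \<and> R \<subseteq> N}"

definition presented_group :: "'a set \<Rightarrow> 'a letter list set \<Rightarrow> 'a letter list set monoid" where
  "presented_group X R = free_group X Mod normal_closure (free_group X) R"

lemma normal_closure_normal:
  assumes "group G" "R \<subseteq> carrier G"
  shows "normal_closure G R \<lhd> G"
proof -
  interpret group G by fact
  have ne: "carrier G \<in> {N. N \<lhd> G \<and> R \<subseteq> N}"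
    using assms(2) normal_self by simp
  have "subgroup (\<Inter> {N. N \<lhd> G \<and> R \<subseteq> N}) G"
    by (rule subgroups_Inter) (use ne in \<open>auto intro: normal_imp_subgroup\<close>)
  then show ?thesis
    unfolding normal_closure_def normal_inv_iff by (auto simp: normal_inv_iff)
qed

lemma group_presented_group:
  "R \<subseteq> carrier (free_group X) \<Longrightarrow> group (presented_group X R)"
  unfolding presented_group_def
  by (intro normal.factorgroup_is_group normal_closure_normal group_free_group)

datatype gen2 = X0 | X1

fun swap_gen :: "gen2 \<Rightarrow> gen2" where
  "swap_gen X0 = X1"
| "swap_gen X1 = X0"

definition shift :: "gen2 letter list \<Rightarrow> gen2 letter list" where
  "shift w = map (map_prod swap_gen id) w"

definition cyclic_perm :: "'a list \<Rightarrow> 'a list \<Rightarrow> bool" where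
  "cyclic_perm u v \<longleftrightarrow> (\<exists>k. u = rotate k v)"

definition orientable :: "gen2 letter list \<Rightarrow> bool" where
  "orientable w \<longleftrightarrow> \<not> (\<exists>v \<in> {w, shift w}. cyclic_perm w (inv_word v))"

definition cyclic_group2 :: "gen2 letter list \<Rightarrow> gen2 letter list set monoid" where
  "cyclic_group2 w = presented_group UNIV {w, shift w}"

lemma swap_gen_swap_gen [simp]: "swap_gen (swap_gen x) = x"
  by (cases x) auto

lemma shift_shift [simp]: "shift (shift w) = w"
  by (simp add: shift_def map_prod.compositionality map_prod.id o_def prod.map_ident_strong)

lemma swap_inv_letter:
  "map_prod swap_gen id l = inv_letter (map_prod swap_gen id k) \<longleftrightarrow> l = inv_letter k"
  by (cases l; cases k) (auto simp: inv_letter_def dest: arg_cong[where f = swap_gen])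

lemma reduced_shift [simp]: "reduced (shift w) \<longleftrightarrow> reduced w"
  by (simp add: reduced_def shift_def successively_map swap_inv_letter)

lemma shift_push: "shift (push l w) = push (map_prod swap_gen id l) (shift w)"
  by (cases w) (auto simp: push_def shift_def swap_inv_letter)

lemma shift_iso: "shift \<in> iso (free_group UNIV) (free_group UNIV)"
proof -
  have "shift (foldr push u v) = foldr push (shift u) (shift v)" for u v
    by (induction u) (simp_all add: shift_push, simp_all add: shift_def)
  moreover have "bij_betw shift {w. reduced w} {w. reduced w}"
    by (rule bij_betw_byWitness[where f' = shift]) auto
  ultimately show ?thesis
    by (auto simp: iso_def hom_def free_group_def)
qed

lemma shift_free_gen [simp]:
  "shift (free_gen X0) = free_gen X1" "shift (free_gen X1) = free_gen X0"
  by (simp_all add: shift_def free_gen_def)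

lemma group_cyclic_group2: "reduced w \<Longrightarrow> group (cyclic_group2 w)"
  unfolding cyclic_group2_def by (rule group_presented_group) (simp add: free_group_def)

datatype bs_gen = A | T

definition bs_relator :: "int \<Rightarrow> bs_gen letter list" where
  "bs_relator m =
     (let F = free_group UNIV; a = free_gen A; t = free_gen T
      in (t \<otimes>\<^bsub>F\<^esub> a \<otimes>\<^bsub>F\<^esub> inv\<^bsub>F\<^esub> t) \<otimes>\<^bsub>F\<^esub> inv\<^bsub>F\<^esub> (a [^]\<^bsub>F\<^esub> m))"

definition BS1 :: "int \<Rightarrow> bs_gen letter list set monoid" where
  "BS1 m = presented_group UNIV {bs_relator m}"

lemma group_BS1: "group (BS1 m)"
proof -
  interpret F: group "free_group (UNIV :: bs_gen set)" by (rule group_free_group)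
  have "free_gen x \<in> carrier (free_group UNIV)" for x :: bs_gen
    by (simp add: free_gen_def free_group_def reduced_def)
  then show ?thesis
    unfolding BS1_def bs_relator_def Let_def by (intro group_presented_group) simp
qed

end

theory Submission
  imports Defs "HOL-Algebra.Elementary_Groups" "HOL-Library.Countable_Set"
begin

text \<open>
  If \<open>P\<^sub>2(w)\<close> is non-orientable, then \<open>w\<close> is a cyclic permutation of \<open>\<theta>(w)\<inverse>\<close>, because a
  non-empty cyclically reduced word is never a cyclic permutation of its own inverse. The two
  relators are therefore conjugate up to inversion, \<open>G\<^sub>2(w)\<close> is the one-relator group
  \<open>\<langle>x\<^sub>0, x\<^sub>1 | w\<rangle>\<close>, and the exponent sums of \<open>x\<^sub>0\<close> and \<open>x\<^sub>1\<close> in \<open>w\<close> add up to zero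
  (\<open>non_orientable\<close>). In the basis \<open>t = x\<^sub>0\<close>, \<open>a = x\<^sub>1x\<^sub>0\<inverse>\<close> the relator has exponent sum zero
  in \<open>t\<close>, so it is a word \<open>r\<close> in the conjugates \<open>a\<^sub>i = t\<^sup>i a t\<^sup>-\<^sup>i\<close>. Let \<open>\<mu>\<close> and \<open>\<nu>\<close>
  be the least and the greatest index that occur in the cyclically reduced form of \<open>r\<close>. Then
  \<open>G\<^sub>2(w)\<close> is an HNN extension of \<open>\<langle>a\<^sub>\<mu>, \<dots>, a\<^sub>\<nu> | r\<rangle>\<close> with stable letter \<open>t\<close>, which
  carries \<open>C = \<langle>a\<^sub>\<mu>, \<dots>, a\<^bsub>\<nu>-1\<^esub>\<rangle>\<close> onto \<open>D = \<langle>a\<^bsub>\<mu>+1\<^esub>, \<dots>, a\<^sub>\<nu>\<rangle>\<close>.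

  Everything rests on Magnus' Freiheitssatz (\<open>freiheitssatz\<close>): the generators of a one-relator
  group other than one that occurs in the cyclically reduced relator generate a free group on
  themselves. If \<open>\<nu> \<ge> \<mu> + 2\<close>, it makes \<open>a\<^sub>\<mu>\<close> and \<open>a\<^bsub>\<mu>+1\<^esub>\<close> a basis of a free subgroup. If
  \<open>\<nu> \<le> \<mu> + 1\<close> and \<open>a\<^sub>\<mu> \<notin> D\<close>, \<open>a\<^sub>\<nu> \<notin> C\<close>, then \<open>t\<close> and \<open>a\<^sub>\<mu>ta\<^sub>\<nu>\<close> form such a basis
  by ping-pong. Otherwise \<open>a\<^sub>\<nu>\<close> is a power of \<open>a\<^sub>\<mu>\<close> or conversely (with \<open>a\<^sub>\<mu> = 1\<close> if
  \<open>\<mu> = \<nu>\<close>), and the relator is equivalent to \<open>t\<^sup>\<plusminus>\<^sup>1at\<^sup>\<minusplus>\<^sup>1 = a\<^sup>m\<close>, the relation of \<open>BS(1, m)\<close>.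
  These cases are put together in \<open>cyclic_group2_alternative\<close>.

  Nothing requires HNN extensions in full: they only serve to show that some word is \<^emph>\<open>not\<close> trivial,
  and for this any group that satisfies the relations is good enough. The groups used here act on
  \<open>H \<times> \<nat>\<close> for a countable group \<open>H\<close>. All subgroups of \<open>H\<close> act freely on this set with infinitely
  many orbits, so an isomorphism between two subgroups is induced by conjugation with a
  permutation, and there is enough room to choose the permutation such that it plays ping-pong
  (\<open>ex_stable_letter\<close>, \<open>hnn_model\<close>).

  The Freiheitssatz is proved by induction on the length of the relator. If some generator has
  exponent sum zero, the rewritten relator in the letters \<open>b\<^sub>i = t\<^sup>ibt\<^sup>-\<^sup>i\<close> is shorter, its group is
  the base of an HNN model of the group in question, and the induction hypothesis is just what
  makes the two associated subgroups free on corresponding bases. If no generator has exponent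
  sum zero, a substitution enforces it. The combinatorics of cyclic reduction is replaced by one
  counting argument, \<open>count_letters_cyclically_reduced\<close>.
\<close>

section \<open>Values of words and substitutions\<close>

abbreviation gens :: "'a letter list \<Rightarrow> 'a set" where
  "gens w \<equiv> fst ` set w"

definition letter_val :: "('g, 'b) monoid_scheme \<Rightarrow> ('a \<Rightarrow> 'g) \<Rightarrow> 'a letter \<Rightarrow> 'g" where
  "letter_val G \<rho> l = (if snd l then \<rho> (fst l) else inv\<^bsub>G\<^esub> \<rho> (fst l))"

primrec word_val :: "('g, 'b) monoid_scheme \<Rightarrow> ('a \<Rightarrow> 'g) \<Rightarrow> 'a letter list \<Rightarrow> 'g" where
  "word_val G \<rho> [] = \<one>\<^bsub>G\<^esub>"
| "word_val G \<rho> (l # w) = letter_val G \<rho> l \<otimes>\<^bsub>G\<^esub> word_val G \<rho> w"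

lemma word_val_cong:
  "(\<And>x. x \<in> gens w \<Longrightarrow> \<rho> x = \<rho>' x) \<Longrightarrow> word_val G \<rho> w = word_val G \<rho>' w"
  by (induction w) (auto simp: letter_val_def)

lemma word_val_map: "word_val G \<rho> (map (map_prod f id) w) = word_val G (\<rho> \<circ> f) w"
  by (induction w) (auto simp: letter_val_def)

lemma inv_word_simps [simp]:
  "inv_word [] = []" "inv_word (l # w) = inv_word w @ [inv_letter l]"
  "inv_word (u @ v) = inv_word v @ inv_word u" "inv_word (inv_word w) = w"
  by (simp_all add: inv_word_def rev_map o_def)

lemma length_inv_word [simp]: "length (inv_word w) = length w"
  by (simp add: inv_word_def)

context group
begin

lemma letter_val_closed [simp]: "(\<And>x. \<rho> x \<in> carrier G) \<Longrightarrow> letter_val G \<rho> l \<in> carrier G"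
  by (simp add: letter_val_def)

lemma word_val_closed [simp]: "(\<And>x. \<rho> x \<in> carrier G) \<Longrightarrow> word_val G \<rho> w \<in> carrier G"
  by (induction w) auto

lemma letter_val_inv_letter:
  "(\<And>x. \<rho> x \<in> carrier G) \<Longrightarrow> letter_val G \<rho> (inv_letter l) = inv (letter_val G \<rho> l)"
  by (auto simp: letter_val_def inv_letter_def)

lemma word_val_append:
  "(\<And>x. \<rho> x \<in> carrier G) \<Longrightarrow> word_val G \<rho> (u @ v) = word_val G \<rho> u \<otimes> word_val G \<rho> v"
  by (induction u) (auto simp: m_assoc)

lemma word_val_inv_word:
  "(\<And>x. \<rho> x \<in> carrier G) \<Longrightarrow> word_val G \<rho> (inv_word u) = inv (word_val G \<rho> u)"
  by (induction u) (auto simp: word_val_append letter_val_inv_letter inv_mult_group)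

lemma word_val_push:
  assumes \<rho>: "\<And>x. \<rho> x \<in> carrier G"
  shows "word_val G \<rho> (push l w) = letter_val G \<rho> l \<otimes> word_val G \<rho> w"
proof (cases "w \<noteq> [] \<and> hd w = inv_letter l")
  case True
  then obtain v where "w = inv_letter l # v" by (cases w) auto
  then show ?thesis
    using \<rho> by (simp add: push_def letter_val_inv_letter m_assoc[symmetric])
qed (auto simp: push_def)

lemma word_val_foldr_push:
  "(\<And>x. \<rho> x \<in> carrier G) \<Longrightarrow>
    word_val G \<rho> (foldr push u v) = word_val G \<rho> u \<otimes> word_val G \<rho> v"
  by (induction u) (auto simp: word_val_push m_assoc)

end

lemma word_val_hom:
  assumes "group G" "group K" "h \<in> hom G K" and \<rho>: "\<And>x. \<rho> x \<in> carrier G"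
  shows "h (word_val G \<rho> w) = word_val K (h \<circ> \<rho>) w"
proof -
  interpret group_hom G K h
    using assms by (simp add: group_hom_def group_hom_axioms_def)
  show ?thesis
    using \<rho> by (induction w) (auto simp: letter_val_def)
qed

definition red :: "'a letter list \<Rightarrow> 'a letter list" where
  "red w = foldr push w []"

lemma reduced_red [simp]: "reduced (red w)"
  by (simp add: red_def reduced_foldr_push)

lemma red_reduced: "reduced w \<Longrightarrow> red w = w"
  by (simp add: red_def foldr_push_Nil)

lemma red_Nil [simp]: "red [] = []"
  by (simp add: red_def)

lemma red_append: "red (u @ v) = foldr push (red u) (red v)"
  using foldr_push_assoc[OF reduced_red, of u "[]" v] by (simp add: red_def)

lemma gens_red: "gens (red w) \<subseteq> gens w"
  using set_foldr_push[of w "[]"] by (simp add: red_def)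

lemma carrier_free_UNIV: "carrier (free_group (UNIV :: 'a set)) = {w. reduced w}"
  by (simp add: free_group_def)

lemma red_closed [simp]: "red w \<in> carrier (free_group UNIV)"
  by (simp add: carrier_free_UNIV)

lemma free_gen_closed [simp]: "free_gen x \<in> carrier (free_group UNIV)"
  by (simp add: carrier_free_UNIV free_gen_def reduced_Cons)

lemma red_append_mult: "red (u @ v) = red u \<otimes>\<^bsub>free_group UNIV\<^esub> red v"
  by (simp add: red_append free_group_def)

lemma word_val_free_gen: "word_val (free_group UNIV) free_gen w = red w"
proof (induction w)
  case Nil
  then show ?case by (simp add: free_group_def)
next
  case (Cons l w)
  have "letter_val (free_group UNIV) free_gen l = [l]"
    by (cases l) (auto simp: letter_val_def inv_free_group free_gen_def inv_word_def inv_letter_def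
        carrier_free_UNIV reduced_Cons)
  then show ?case
    using Cons by (simp add: red_def) (simp add: free_group_def)
qed

lemma (in group) word_val_red:
  "(\<And>x. \<rho> x \<in> carrier G) \<Longrightarrow> word_val G \<rho> (red w) = word_val G \<rho> w"
  by (simp add: red_def word_val_foldr_push)

lemma (in group) word_val_red_eq:
  "(\<And>x. \<rho> x \<in> carrier G) \<Longrightarrow> red u = red v \<Longrightarrow> word_val G \<rho> u = word_val G \<rho> v"
  by (metis word_val_red)

lemma (in group) word_val_free_hom:
  "(\<And>x. \<rho> x \<in> carrier G) \<Longrightarrow> word_val G \<rho> \<in> hom (free_group X) G"
  by (auto simp: hom_def free_group_def word_val_foldr_push)

lemma red_inv_word: "red (inv_word w) = inv\<^bsub>free_group UNIV\<^esub> red w"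
  using group.word_val_inv_word[OF group_free_group[of UNIV], of free_gen w]
  by (simp add: word_val_free_gen)

lemma red_map_eq_Nil_iff:
  assumes "inj f"
  shows "red (map (map_prod f id) w) = [] \<longleftrightarrow> red w = []"
proof -
  have eq: "map_prod f id l = inv_letter (map_prod f id k) \<longleftrightarrow> l = inv_letter k" for l k
    using assms by (cases l; cases k) (auto simp: inv_letter_def inj_eq)
  have "map (map_prod f id) (push l w) = push (map_prod f id l) (map (map_prod f id) w)" for l w
    by (cases w) (auto simp: push_def eq)
  then have "map (map_prod f id) (red w) = red (map (map_prod f id) w)"
    by (induction w) (simp_all add: red_def)
  then show ?thesis by (metis map_is_Nil_conv)
qed

definition subst :: "('a \<Rightarrow> 'b letter list) \<Rightarrow> 'a letter list \<Rightarrow> 'b letter list" where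
  "subst f w = concat (map (\<lambda>(x, e). if e then f x else inv_word (f x)) w)"

lemma subst_simps [simp]:
  "subst f [] = []"
  "subst f (l # w) = (if snd l then f (fst l) else inv_word (f (fst l))) @ subst f w"
  by (auto simp: subst_def split: prod.splits)

lemma (in group) word_val_subst:
  assumes "\<And>x. \<rho> x \<in> carrier G"
  shows "word_val G \<rho> (subst f w) = word_val G (\<lambda>x. word_val G \<rho> (f x)) w"
  using assms by (induction w) (auto simp: word_val_append word_val_inv_word letter_val_def)

lemma gens_inv_word [simp]: "gens (inv_word w) = gens w"
  by (rule set_inv_word)

lemma gens_subst: "gens (subst f w) = (\<Union>x \<in> gens w. gens (f x))"
proof (induction w)
  case (Cons l w)
  have "gens (if snd l then f (fst l) else inv_word (f (fst l))) = gens (f (fst l))"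
    by (simp only: if_distrib[of gens] gens_inv_word if_cancel)
  then show ?case
    using Cons by (simp only: subst_simps set_append image_Un) simp
qed simp

section \<open>Consequences of relators\<close>

text \<open>Words need not be reduced, so that concatenation, substitution and rewriting can be used
  freely; the definition passes to the reduced form.\<close>

definition consequence :: "'a letter list set \<Rightarrow> 'a letter list \<Rightarrow> bool" where
  "consequence R w \<longleftrightarrow> red w \<in> normal_closure (free_group UNIV) R"

lemma normal_closure_incl: "R \<subseteq> normal_closure G R"
  by (auto simp: normal_closure_def)

lemma normal_closure_least: "N \<lhd> G \<Longrightarrow> R \<subseteq> N \<Longrightarrow> normal_closure G R \<subseteq> N"
  by (auto simp: normal_closure_def)

text \<open>The only way in which a word is ever shown not to be a consequence of relators: the normal
  closure of the relators lies in the kernel of every homomorphism that kills them.\<close>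

lemma (in group) consequence_word_val:
  assumes \<rho>: "\<And>x. \<rho> x \<in> carrier G" and R: "\<And>r. r \<in> R \<Longrightarrow> reduced r"
    and kill: "\<And>r. r \<in> R \<Longrightarrow> word_val G \<rho> r = \<one>" and w: "consequence R w"
  shows "word_val G \<rho> w = \<one>"
proof -
  interpret F: group_hom "free_group UNIV" G "word_val G \<rho>"
    using \<rho> by (auto simp: group_hom_def group_hom_axioms_def group_free_group is_group
        intro: word_val_free_hom)
  have "normal_closure (free_group UNIV) R \<subseteq> kernel (free_group UNIV) G (word_val G \<rho>)"
    by (rule normal_closure_least[OF F.normal_kernel])
      (use R kill in \<open>auto simp: kernel_def carrier_free_UNIV\<close>)
  then show ?thesis
    using w \<rho> by (auto simp: consequence_def kernel_def word_val_red)
qed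

definition pres_gen :: "'a letter list set \<Rightarrow> 'a \<Rightarrow> 'a letter list set" where
  "pres_gen R x = normal_closure (free_group UNIV) R #>\<^bsub>free_group UNIV\<^esub> free_gen x"

context
  fixes R :: "'a letter list set"
  assumes R: "\<And>r. r \<in> R \<Longrightarrow> reduced r"
begin

interpretation F: group "free_group (UNIV :: 'a set)" by (rule group_free_group)

interpretation N: normal "normal_closure (free_group (UNIV :: 'a set)) R" "free_group (UNIV :: 'a set)"
  by (rule normal_closure_normal) (use R in \<open>auto simp: group_free_group carrier_free_UNIV\<close>)

lemma group_presented: "group (presented_group UNIV R)"
  by (rule group_presented_group) (use R in \<open>auto simp: carrier_free_UNIV\<close>)

lemma pres_gen_closed: "pres_gen R x \<in> carrier (presented_group UNIV R)"
  by (simp add: pres_gen_def presented_group_def carrier_FactGroup)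

lemma word_val_pres_gen:
  "word_val (presented_group UNIV R) (pres_gen R) w
    = normal_closure (free_group UNIV) R #>\<^bsub>free_group UNIV\<^esub> red w"
proof -
  let ?h = "\<lambda>u. normal_closure (free_group UNIV) R #>\<^bsub>free_group UNIV\<^esub> u"
  have "?h \<in> hom (free_group UNIV) (presented_group UNIV R)"
    unfolding presented_group_def by (rule N.r_coset_hom_Mod)
  then have "?h (word_val (free_group UNIV) free_gen w)
      = word_val (presented_group UNIV R) (?h \<circ> free_gen) w"
    by (intro word_val_hom group_free_group group_presented) auto
  moreover have "?h \<circ> free_gen = pres_gen R"
    by (auto simp: pres_gen_def)
  ultimately show ?thesis by (simp add: word_val_free_gen)
qed

lemma word_val_pres_gen_one:
  "word_val (presented_group UNIV R) (pres_gen R) w = \<one>\<^bsub>presented_group UNIV R\<^esub>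
    \<longleftrightarrow> consequence R w"
proof -
  have "\<one>\<^bsub>presented_group UNIV R\<^esub> = normal_closure (free_group UNIV) R"
    by (simp add: presented_group_def FactGroup_def)
  moreover have "normal_closure (free_group UNIV) R #>\<^bsub>free_group UNIV\<^esub> red w
      = normal_closure (free_group UNIV) R
      \<longleftrightarrow> red w \<in> normal_closure (free_group UNIV) R"
    using F.coset_join1 F.coset_join2 N.subgroup_axioms N.subset red_closed
    by metis
  ultimately show ?thesis
    by (simp add: word_val_pres_gen consequence_def)
qed

lemma presented_elem:
  assumes "g \<in> carrier (presented_group UNIV R)"
  obtains w where "g = word_val (presented_group UNIV R) (pres_gen R) w"
proof -
  obtain w where "reduced w" "g = normal_closure (free_group UNIV) R #>\<^bsub>free_group UNIV\<^esub> w"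
    using assms by (auto simp: presented_group_def carrier_FactGroup carrier_free_UNIV)
  then show ?thesis
    by (intro that[of w]) (simp add: word_val_pres_gen red_reduced)
qed

end

lemma consequenceI:
  assumes "\<And>r. r \<in> R \<Longrightarrow> reduced r"
    and "word_val (presented_group UNIV R) (pres_gen R) w = \<one>\<^bsub>presented_group UNIV R\<^esub>"
  shows "consequence R w"
  using assms word_val_pres_gen_one by blast

lemma consequence_relator:
  assumes "r \<in> R" "reduced r"
  shows "consequence R r"
  unfolding consequence_def red_reduced[OF assms(2)]
  by (rule subsetD[OF normal_closure_incl assms(1)])

section \<open>Conjugate words and cyclic reduction\<close>

text \<open>Words need not be reduced here. The relation is conjugacy in the free group of the elements
  that they represent.\<close>

definition conj_words :: "'a letter list \<Rightarrow> 'a letter list \<Rightarrow> bool" where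
  "conj_words u v \<longleftrightarrow> (\<exists>g. red u = red (g @ v @ inv_word g))"

lemma red_cong_append: "red u = red u' \<Longrightarrow> red v = red v' \<Longrightarrow> red (u @ v) = red (u' @ v')"
  by (simp add: red_append)

lemma red_cancel: "red (u @ inv_word u @ v) = red v" "red (inv_word u @ u @ v) = red v"
proof -
  interpret F: group "free_group (UNIV :: 'a set)" by (rule group_free_group)
  show "red (u @ inv_word u @ v) = red v" "red (inv_word u @ u @ v) = red v"
    by (simp_all only: red_append_mult red_inv_word F.inv_closed red_closed F.m_assoc[symmetric]
        F.r_inv F.l_inv F.l_one)
qed

lemma red_red_eq [simp]: "red (red w) = red w"
  by (simp add: red_reduced)

lemma red_eq_Nil_self: "red (u @ inv_word u) = []" "red (inv_word u @ u) = []"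
  using red_cancel[of u "[]"] by simp_all

lemma conj_words_trans:
  assumes "conj_words u v" "conj_words v w"
  shows "conj_words u w"
proof -
  obtain g h where "red u = red (g @ v @ inv_word g)" "red v = red (h @ w @ inv_word h)"
    using assms by (auto simp: conj_words_def)
  then have "red u = red (g @ (h @ w @ inv_word h) @ inv_word g)"
    using red_cong_append[OF refl red_cong_append[OF _ refl], of v "h @ w @ inv_word h" g]
    by simp
  then show ?thesis
    unfolding conj_words_def by (intro exI[of _ "g @ h"]) simp
qed

lemma conj_words_sym:
  assumes "conj_words u v"
  shows "conj_words v u"
proof -
  obtain g where g: "red u = red (g @ v @ inv_word g)"
    using assms by (auto simp: conj_words_def)
  have "red (inv_word g @ u @ g) = red (inv_word g @ (g @ v @ inv_word g) @ g)"
    by (intro red_cong_append g refl)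
  also have "\<dots> = red (v @ inv_word g @ g)"
    by (simp add: red_cancel)
  also have "\<dots> = red (v @ [])"
    by (rule red_cong_append) (simp_all add: red_eq_Nil_self)
  finally show ?thesis
    unfolding conj_words_def by (intro exI[of _ "inv_word g"]) simp
qed

lemma conj_words_red_eq: "red u = red v \<Longrightarrow> conj_words u v"
  unfolding conj_words_def by (intro exI[of _ "[]"]) simp

lemma (in group) conj_words_word_val:
  assumes \<rho>: "\<And>x. \<rho> x \<in> carrier G" and "conj_words u v"
  shows "word_val G \<rho> u = \<one> \<longleftrightarrow> word_val G \<rho> v = \<one>"
proof -
  obtain g where "red u = red (g @ v @ inv_word g)"
    using assms by (auto simp: conj_words_def)
  then have "word_val G \<rho> u
      = word_val G \<rho> g \<otimes> (word_val G \<rho> v \<otimes> inv (word_val G \<rho> g))"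
    using word_val_red_eq[OF \<rho>, of u "g @ v @ inv_word g"] \<rho>
    by (simp add: word_val_append word_val_inv_word)
  moreover have "a \<otimes> (b \<otimes> inv a) = \<one> \<longleftrightarrow> b = \<one>"
    if "a \<in> carrier G" "b \<in> carrier G" for a b
  proof
    assume "a \<otimes> (b \<otimes> inv a) = \<one>"
    then have "inv (b \<otimes> inv a) = a"
      using that by (intro inv_equality) auto
    then show "b = \<one>"
      using that by (simp add: inv_mult_group)
  qed (use that in simp)
  ultimately show ?thesis
    using \<rho> by simp
qed

text \<open>Cancelling inverse letters at the two ends of a reduced word is a conjugation.\<close>

lemma ex_cyclic_reduction: "\<exists>c. cyclically_reduced c \<and> conj_words c w"
proof -
  have "\<exists>c. cyclically_reduced c \<and> conj_words c w" if "reduced w" for w :: "'a letter list"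
    using that
  proof (induction w rule: length_induct)
    case (1 w)
    show ?case
    proof (cases "cyclically_reduced w")
      case True
      then show ?thesis using conj_words_red_eq by blast
    next
      case False
      then have ne: "w \<noteq> []" and hd: "hd w = inv_letter (last w)"
        using 1(2) by (auto simp: cyclically_reduced_def)
      define l where "l = last w"
      obtain v where v: "w = inv_letter l # v @ [l]"
      proof (cases w)
        case (Cons k u)
        moreover have "u \<noteq> []"
          using hd Cons by (auto simp: inv_letter_def prod_eq_iff)
        ultimately show ?thesis
          using hd that[of "butlast u"] by (auto simp: l_def)
      qed (use ne in simp)
      have "reduced v"
        using 1(2) unfolding v reduced_def successively_Cons successively_append_iff by auto
      then obtain c where "cyclically_reduced c" "conj_words c v"
        using 1(1)[rule_format, of v] v by auto
      moreover have "conj_words v w"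
      proof -
        have "red ([l] @ w @ inv_word [l])
            = red (inv_word [inv_letter l] @ [inv_letter l] @ v @ [l] @ inv_word [l])"
          by (simp add: v)
        also have "\<dots> = red (v @ [l] @ inv_word [l])"
          by (rule red_cancel)
        also have "\<dots> = red (v @ [])"
          by (intro red_cong_append) (simp_all only: red_eq_Nil_self red_Nil)
        finally show ?thesis
          unfolding conj_words_def by (intro exI[of _ "[l]"]) simp
      qed
      ultimately show ?thesis using conj_words_trans by blast
    qed
  qed
  from this[of "red w"] show ?thesis
    using conj_words_red_eq[of "red w" w] conj_words_trans by fastforce
qed

definition word_power :: "nat \<Rightarrow> 'a letter list \<Rightarrow> 'a letter list" where
  "word_power n w = concat (replicate n w)"

lemma word_power_simps [simp]: "word_power 0 w = []" "word_power (Suc n) w = w @ word_power n w"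
  by (simp_all add: word_power_def)

lemma reduced_append:
  "reduced (u @ v) \<longleftrightarrow> reduced u \<and> reduced v \<and>
    (u \<noteq> [] \<longrightarrow> v \<noteq> [] \<longrightarrow> hd v \<noteq> inv_letter (last u))"
  by (auto simp: reduced_def successively_append_iff)

lemma reduced_word_power:
  assumes "cyclically_reduced c"
  shows "reduced (word_power n c)"
proof (cases "c = []")
  case False
  show ?thesis
  proof (induction n)
    case (Suc n)
    have "word_power n c = [] \<or> hd (word_power n c) = hd c"
      using False by (cases n) auto
    then show ?case
      using assms False Suc by (auto simp: reduced_append cyclically_reduced_def)
  qed simp
qed (simp add: word_power_def)

lemma red_word_power_conj:
  assumes "red u = red (g @ v @ inv_word g)"
  shows "red (word_power n u) = red (g @ word_power n v @ inv_word g)"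
proof (induction n)
  case 0
  show ?case using red_eq_Nil_self[of g] by simp
next
  case (Suc n)
  have "red (word_power (Suc n) u) = red ((g @ v @ inv_word g) @ g @ word_power n v @ inv_word g)"
    unfolding word_power_simps by (intro red_cong_append assms Suc.IH)
  also have "\<dots> = red ((g @ v) @ inv_word g @ g @ word_power n v @ inv_word g)"
    by simp
  also have "\<dots> = red ((g @ v) @ word_power n v @ inv_word g)"
    by (intro red_cong_append refl red_cancel)
  finally show ?case by simp
qed

definition count_letters :: "('a letter \<Rightarrow> bool) \<Rightarrow> 'a letter list \<Rightarrow> nat" where
  "count_letters P w = length (filter P w)"

lemma count_letters_simps [simp]:
  "count_letters P [] = 0"
  "count_letters P (l # w) = (if P l then Suc (count_letters P w) else count_letters P w)"
  "count_letters P (u @ v) = count_letters P u + count_letters P v"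
  "count_letters P (word_power n w) = n * count_letters P w"
  by (simp_all add: count_letters_def word_power_def filter_concat length_concat sum_list_replicate)

lemma count_letters_red: "count_letters P (red w) \<le> count_letters P w"
proof (induction w)
  case (Cons l w)
  have "count_letters P (push l v) \<le> count_letters P (l # v)" for v
    by (cases v) (auto simp: push_def)
  also have "count_letters P (l # red w) \<le> count_letters P (l # w)"
    using Cons by simp
  finally show ?case by (simp add: red_def)
qed simp

text \<open>A cyclically reduced word is the shortest in its conjugacy class, and this holds for every
  kind of letters separately. In \<open>c\<^sup>n = gv\<^sup>ng\<inverse>\<close> the left-hand side is reduced, so the letters
  in question occur in it \<open>n\<close> times as often as in \<open>c\<close>; on the right there are at most \<open>n\<close>
  times as many as in \<open>v\<close>, up to a constant that stems from \<open>g\<close>. This one statement provides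
  whatever is needed about conjugate words and their cyclically reduced forms.\<close>

lemma count_letters_cyclically_reduced:
  assumes c: "cyclically_reduced c" and "conj_words c v"
  shows "count_letters P c \<le> count_letters P v"
proof (rule ccontr)
  assume less: "\<not> ?thesis"
  obtain g where g: "red c = red (g @ v @ inv_word g)"
    using assms by (auto simp: conj_words_def)
  define k where "k = count_letters P g + count_letters P (inv_word g)"
  \<comment> \<open>one more than the contribution of the conjugating word\<close>
  define n where "n = Suc k"
  have e: "word_power n c = red (g @ word_power n v @ inv_word g)"
    using red_word_power_conj[OF g, of n] reduced_word_power[OF c] by (simp add: red_reduced)
  have "n * count_letters P c = count_letters P (word_power n c)"
    by simp
  also have "\<dots> \<le> count_letters P (g @ word_power n v @ inv_word g)"
    unfolding e by (rule count_letters_red)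
  also have "\<dots> = n * count_letters P v + k"
    by (simp add: k_def)
  finally have "n * count_letters P c \<le> n * count_letters P v + k" .
  moreover have "n * Suc (count_letters P v) \<le> n * count_letters P c"
    using less by (intro mult_le_mono2) simp
  ultimately show False
    by (simp add: n_def)
qed

lemma count_letters_eq_0: "count_letters P w = 0 \<longleftrightarrow> (\<forall>l \<in> set w. \<not> P l)"
  by (auto simp: count_letters_def filter_empty_conv)

lemma gens_cyclically_reduced:
  assumes "cyclically_reduced c" "conj_words c v"
  shows "gens c \<subseteq> gens v"
proof
  fix x assume "x \<in> gens c"
  then have "count_letters (\<lambda>l. fst l = x) c \<noteq> 0" by (auto simp: count_letters_eq_0)
  then have "count_letters (\<lambda>l. fst l = x) v \<noteq> 0"
    using count_letters_cyclically_reduced[OF assms, of "\<lambda>l. fst l = x"] by linarith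
  then show "x \<in> gens v" by (auto simp: count_letters_eq_0)
qed

lemma length_cyclically_reduced:
  "cyclically_reduced c \<Longrightarrow> conj_words c v \<Longrightarrow> length c \<le> length v"
  using count_letters_cyclically_reduced[of c v "\<lambda>_. True"] by (simp add: count_letters_def)

section \<open>Exponent sums\<close>

definition esum :: "'a \<Rightarrow> 'a letter list \<Rightarrow> int" where
  "esum x w = (\<Sum>l\<leftarrow>w. if fst l = x then if snd l then 1 else - 1 else 0)"

lemma esum_simps [simp]:
  "esum x [] = 0"
  "esum x (l # w) = (if fst l = x then if snd l then 1 else - 1 else 0) + esum x w"
  "esum x (u @ v) = esum x u + esum x v"
  by (simp_all add: esum_def)

lemma esum_inv_word [simp]: "esum x (inv_word w) = - esum x w"
  by (induction w) (auto simp: inv_letter_def)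

lemma word_val_esum: "word_val integer_group (\<lambda>y. if y = x then 1 else 0) w = esum x w"
  by (induction w) (auto simp: letter_val_def)

lemma esum_red_eq: "red u = red v \<Longrightarrow> esum x u = esum x v"
  using group.word_val_red_eq[OF group_integer_group, of "\<lambda>y. if y = x then 1 else 0" u v]
  by (simp add: word_val_esum)

lemma esum_conj_words: "conj_words u v \<Longrightarrow> esum x u = esum x v"
  by (auto simp: conj_words_def dest!: esum_red_eq[where x = x])

lemma esum_consequence:
  assumes "\<And>r. r \<in> R \<Longrightarrow> reduced r" "\<And>r. r \<in> R \<Longrightarrow> esum x r = 0" "consequence R w"
  shows "esum x w = 0"
  using group.consequence_word_val[OF group_integer_group, of "\<lambda>y. if y = x then 1 else 0" R w] assms
  by (simp add: word_val_esum)

lemma esum_zero_if_no_gen: "x \<notin> gens w \<Longrightarrow> esum x w = 0"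
  by (induction w) auto

lemma cyclically_reduced_reduced: "cyclically_reduced c \<Longrightarrow> reduced c"
  by (simp add: cyclically_reduced_def)

definition gen_power :: "'a \<Rightarrow> int \<Rightarrow> 'a letter list" where
  "gen_power x k = replicate (nat \<bar>k\<bar>) (x, k \<ge> 0)"

lemma (in group) word_val_gen_power:
  assumes "\<And>x. \<rho> x \<in> carrier G"
  shows "word_val G \<rho> (gen_power x k) = \<rho> x [^] k"
proof -
  have "word_val G \<rho> (replicate n (x, True)) = \<rho> x [^] n" for n
    by (induction n)
      (simp_all add: letter_val_def assms, metis assms nat_pow_Suc nat_pow_Suc2)
  moreover have "word_val G \<rho> (replicate n (x, False)) = inv (\<rho> x [^] n)" for n
    using assms by (induction n) (simp_all add: letter_val_def inv_mult_group)
  ultimately have pos: "word_val G \<rho> (replicate n (x, True)) = \<rho> x [^] n"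
    and neg: "word_val G \<rho> (replicate n (x, False)) = inv (\<rho> x [^] n)" for n
    by blast+
  show ?thesis
  proof (cases k rule: int_cases2)
    case (nonneg n)
    then show ?thesis
      by (simp add: gen_power_def pos int_pow_int)
  next
    case (nonpos n)
    show ?thesis
    proof (cases "n = 0")
      case False
      then show ?thesis
        using nonpos assms by (simp add: gen_power_def neg int_pow_neg_int)
    qed (simp add: nonpos gen_power_def)
  qed
qed

lemma esum_gen_power [simp]: "esum y (gen_power x k) = (if x = y then k else 0)"
proof -
  have "esum y (replicate n (x, b)) = (if x = y then if b then int n else - int n else 0)" for n b
    by (induction n) auto
  then show ?thesis by (simp add: gen_power_def)
qed

lemma gens_gen_power: "gens (gen_power x k) \<subseteq> {x}"
  by (auto simp: gen_power_def)

section \<open>HNN extensions as permutation groups\<close>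

text \<open>Permutations of a whole type rather than of a carrier set: points outside the set of interest
  are simply fixed.\<close>

definition perms :: "('w \<Rightarrow> 'w) monoid" where
  "perms = \<lparr>carrier = {f. bij f}, mult = (\<circ>), one = id\<rparr>"

lemma perms_simps [simp]:
  "carrier perms = {f. bij f}" "f \<otimes>\<^bsub>perms\<^esub> g = f \<circ> g" "\<one>\<^bsub>perms\<^esub> = id"
  by (simp_all add: perms_def)

lemma group_perms: "group (perms :: ('w \<Rightarrow> 'w) monoid)"
proof (rule groupI)
  fix f :: "'w \<Rightarrow> 'w" assume "f \<in> carrier perms"
  then have "bij (inv_into UNIV f)" "inv_into UNIV f \<circ> f = id"
    by (auto simp: bij_imp_bij_inv inv_o_cancel bij_is_inj)
  then show "\<exists>g\<in>carrier perms. g \<otimes>\<^bsub>perms\<^esub> f = \<one>\<^bsub>perms\<^esub>" by auto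
qed (auto intro: bij_comp)

lemma inv_perms: "bij f \<Longrightarrow> inv\<^bsub>perms\<^esub> f = inv_into UNIV f"
  by (rule group.inv_equality[OF group_perms])
    (auto simp: bij_imp_bij_inv inv_o_cancel bij_is_inj)

text \<open>The set \<open>D l\<close> receives all points of \<open>\<Omega>\<close> outside \<open>D (l\<inverse>)\<close> under the letter \<open>l\<close>. Along a reduced word
  the base point \<open>\<omega>\<close> therefore moves from one of these sets to the next and never returns.\<close>

lemma ping_pong:
  fixes \<rho> :: "'a \<Rightarrow> 'w \<Rightarrow> 'w"
  assumes base: "\<omega> \<in> \<Omega>" "\<And>l. \<omega> \<notin> D l" and sub: "\<And>l. D l \<subseteq> \<Omega>"
    and disj: "\<And>k l. k \<noteq> l \<Longrightarrow> D k \<inter> D l = {}"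
    and move: "\<And>l s. s \<in> \<Omega> \<Longrightarrow> s \<notin> D (inv_letter l) \<Longrightarrow> letter_val perms \<rho> l s \<in> D l"
    and w: "reduced w" "w \<noteq> []"
  shows "word_val perms \<rho> w \<noteq> id"
proof -
  have "word_val perms \<rho> w \<omega> \<in> D (hd w)"
    using w
  proof (induction w)
    case (Cons l w)
    show ?case
    proof (cases "w = []")
      case True
      then show ?thesis using base move by simp
    next
      case False
      then have w: "word_val perms \<rho> w \<omega> \<in> D (hd w)" and "hd w \<noteq> inv_letter l"
        using Cons by (auto simp: reduced_Cons)
      then have "word_val perms \<rho> w \<omega> \<notin> D (inv_letter l)"
        using disj[of "hd w" "inv_letter l"] by blast
      then show ?thesis
        using move[of "word_val perms \<rho> w \<omega>" l] sub[of "hd w"] w by auto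
    qed
  qed simp
  then show ?thesis using base(2)[of "hd w"] by auto
qed

context group
begin

text \<open>The left regular representation, with a countable supply of copies of the group.\<close>

definition translate :: "'a \<Rightarrow> 'a \<times> nat \<Rightarrow> 'a \<times> nat" where
  "translate h s = (if fst s \<in> carrier G then (h \<otimes> fst s, snd s) else s)"

lemma translate_eq [simp]: "k \<in> carrier G \<Longrightarrow> translate h (k, n) = (h \<otimes> k, n)"
  by (simp add: translate_def)

lemma translate_translate:
  "h \<in> carrier G \<Longrightarrow> g \<in> carrier G \<Longrightarrow> translate h (translate g s) = translate (h \<otimes> g) s"
  by (cases "fst s \<in> carrier G") (simp_all add: translate_def m_assoc)

lemma translate_one: "translate \<one> s = s"
  by (cases s) (auto simp: translate_def)

lemma bij_translate: "h \<in> carrier G \<Longrightarrow> bij (translate h)"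
  by (rule o_bij[of "translate (inv h)"])
    (auto simp: fun_eq_iff translate_translate translate_one)

lemma translate_hom: "translate \<in> hom G perms"
  by (auto simp: hom_def bij_translate fun_eq_iff translate_translate)

lemma inj_translate: "inj_on translate (carrier G)"
proof (rule inj_onI)
  fix g h assume "g \<in> carrier G" "h \<in> carrier G" "translate g = translate h"
  then have "translate g (\<one>, 0) = translate h (\<one>, 0)" by simp
  then show "g = h" using \<open>g \<in> carrier G\<close> \<open>h \<in> carrier G\<close> by simp
qed

text \<open>All free actions with countably infinitely many orbits look the same: after the choice of a
  representative in each orbit, \<open>S\<close> becomes \<open>C \<times> \<nat>\<close>.\<close>

lemma free_set_coordinates:
  assumes C: "subgroup C G" and count: "countable (carrier G)"
    and S: "S \<subseteq> carrier G \<times> UNIV" and S_inv: "\<forall>a\<in>C. \<forall>s\<in>S. translate a s \<in> S"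
    and inf: "infinite (snd ` S)"
  shows "\<exists>f :: 'a \<times> nat \<Rightarrow> 'a \<times> nat. bij_betw f S (C \<times> UNIV) \<and>
    (\<forall>a\<in>C. \<forall>s\<in>S. f (translate a s) = (a \<otimes> fst (f s), snd (f s)))"
proof -
  \<comment> \<open>the orbit of a point, with a representative chosen in each orbit\<close>
  define orb where "orb s = (C #> fst s, snd s)" for s :: "'a \<times> nat"
  define rep where "rep s = inv_into S orb (orb s)" for s
  define f where "f s = (fst s \<otimes> inv fst (rep s), to_nat_on (orb ` S) (orb s))" for s
  have CG: "C \<subseteq> carrier G" using C by (rule subgroup.subset)
  have fstS: "fst s \<in> carrier G" if "s \<in> S" for s using S that by auto
  have rep: "rep s \<in> S" "orb (rep s) = orb s" if "s \<in> S" for s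
    using that unfolding rep_def by (auto intro: inv_into_into f_inv_into_f)
  have orb_translate: "orb (translate a s) = orb s" if "a \<in> C" "s \<in> S" for a s
  proof -
    have "C #> (a \<otimes> fst s) = (C #> a) #> fst s"
      using that fstS[of s] CG by (intro coset_mult_assoc[symmetric]) auto
    also have "C #> a = C"
      using that C CG by (intro coset_join2) auto
    finally show ?thesis
      using fstS[OF that(2)] by (simp add: orb_def translate_def)
  qed
  have "bij_betw (to_nat_on (orb ` S)) (orb ` S) UNIV"
  proof (rule to_nat_on_infinite)
    have "countable S"
      using countable_subset[OF S] count by (simp add: countable_SIGMA)
    then show "countable (orb ` S)" by simp
    have "snd ` S = snd ` orb ` S" by (auto simp: orb_def image_image)
    then show "infinite (orb ` S)" using inf by auto
  qed
  then have nat_inj: "inj_on (to_nat_on (orb ` S)) (orb ` S)"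
    and nat_surj: "to_nat_on (orb ` S) ` orb ` S = UNIV"
    by (auto simp: bij_betw_def)
  have f_C: "fst (f s) \<in> C" if "s \<in> S" for s
  proof -
    have "C #> fst (rep s) = C #> fst s" using rep[OF that] by (auto simp: orb_def)
    then have "fst s \<in> C #> fst (rep s)"
      using rcos_self[OF fstS[OF that] C] by simp
    then obtain a where "a \<in> C" "fst s = a \<otimes> fst (rep s)" by (auto simp: r_coset_def)
    moreover have "fst (rep s) \<in> carrier G" "a \<in> carrier G"
      using fstS[OF rep(1)[OF that]] CG \<open>a \<in> C\<close> by auto
    ultimately show ?thesis
      by (simp add: f_def m_assoc)
  qed
  have inj: "inj_on f S"
  proof (rule inj_onI)
    fix s s' assume s: "s \<in> S" "s' \<in> S" "f s = f s'"
    then have orb: "orb s = orb s'" using nat_inj by (auto simp: f_def inj_on_def)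
    then have "rep s = rep s'" by (simp add: rep_def)
    moreover have "fst (rep s') \<in> carrier G" using rep s fstS by blast
    ultimately have "fst s = fst s'"
      using s fstS by (auto simp: f_def)
    then show "s = s'" using orb by (auto simp: orb_def prod_eq_iff)
  qed
  have surj: "f ` S = C \<times> UNIV"
  proof
    show "f ` S \<subseteq> C \<times> UNIV"
      using f_C by (simp add: image_subset_iff mem_Times_iff)
    show "C \<times> UNIV \<subseteq> f ` S"
    proof
      fix p :: "'a \<times> nat" assume "p \<in> C \<times> UNIV"
      then obtain a m where p: "p = (a, m)" "a \<in> C" by auto
      have "m \<in> to_nat_on (orb ` S) ` orb ` S" using nat_surj by simp
      then obtain s where s: "s \<in> S" "to_nat_on (orb ` S) (orb s) = m" by blast
      let ?s = "translate a (rep s)"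
      have "?s \<in> S" using S_inv p rep s by blast
      moreover have "orb ?s = orb s" using orb_translate p rep s by metis
      moreover have "rep ?s = rep s" using \<open>orb ?s = orb s\<close> by (simp add: rep_def)
      moreover have "fst (rep s) \<in> carrier G" "a \<in> carrier G" using rep s fstS p CG by auto
      moreover from this have "fst ?s = a \<otimes> fst (rep s)" by (simp add: translate_def)
      ultimately have "f ?s = p"
        using s p by (simp add: f_def m_assoc)
      then show "p \<in> f ` S" using \<open>?s \<in> S\<close> by blast
    qed
  qed
  have "f (translate a s) = (a \<otimes> fst (f s), snd (f s))" if "a \<in> C" "s \<in> S" for a s
  proof -
    have "rep (translate a s) = rep s"
      using orb_translate[OF that] by (simp add: rep_def)
    moreover have "fst s \<in> carrier G" "fst (rep s) \<in> carrier G" "a \<in> carrier G"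
      using that rep fstS CG by auto
    moreover from this have "fst (translate a s) = a \<otimes> fst s" by (simp add: translate_def)
    ultimately show ?thesis
      using orb_translate[OF that] by (simp add: f_def m_assoc)
  qed
  then show ?thesis by (intro exI[of _ f]) (simp add: bij_betw_def inj surj)
qed

lemma equivariant_bijection:
  assumes count: "countable (carrier G)"
    and C: "subgroup C G" "S \<subseteq> carrier G \<times> UNIV" "\<forall>a\<in>C. \<forall>s\<in>S. translate a s \<in> S"
      "infinite (snd ` S)"
    and D: "subgroup D G" "S' \<subseteq> carrier G \<times> UNIV" "\<forall>b\<in>D. \<forall>s\<in>S'. translate b s \<in> S'"
      "infinite (snd ` S')"
    and \<phi>: "bij_betw \<phi> C D" "\<forall>a\<in>C. \<forall>b\<in>C. \<phi> (a \<otimes> b) = \<phi> a \<otimes> \<phi> b"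
  shows "\<exists>g. bij_betw g S S' \<and>
    (\<forall>a\<in>C. \<forall>s\<in>S. g (translate a s) = translate (\<phi> a) (g s))"
proof -
  obtain f where f: "bij_betw f S (C \<times> (UNIV :: nat set))"
    and f_eq: "\<forall>a\<in>C. \<forall>s\<in>S. f (translate a s) = (a \<otimes> fst (f s), snd (f s))"
    using free_set_coordinates[OF C(1) count C(2,3,4)] by (elim exE conjE)
  obtain f' where f': "bij_betw f' S' (D \<times> (UNIV :: nat set))"
    and f'_eq: "\<forall>a\<in>D. \<forall>s\<in>S'. f' (translate a s) = (a \<otimes> fst (f' s), snd (f' s))"
    using free_set_coordinates[OF D(1) count D(2,3,4)] by (elim exE conjE)
  define g where "g = inv_into S' f' \<circ> (map_prod \<phi> id \<circ> f)"
  have "bij_betw (map_prod \<phi> id) (C \<times> (UNIV :: nat set)) (D \<times> UNIV)"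
    using \<phi>(1) by (intro bij_betw_map_prod) auto
  then have bij_g: "bij_betw g S S'"
    unfolding g_def using bij_betw_trans[OF bij_betw_trans[OF f] bij_betw_inv_into[OF f']] by blast
  have f'_g: "f' (g s) = map_prod \<phi> id (f s)" if "s \<in> S" for s
  proof -
    have "map_prod \<phi> id (f s) \<in> D \<times> UNIV"
      using bij_betw_apply[OF f that] bij_betw_apply[OF \<phi>(1)] by (cases "f s") simp
    then show ?thesis
      using f' by (simp add: g_def bij_betw_inv_into_right)
  qed
  have "g (translate a s) = translate (\<phi> a) (g s)" if as: "a \<in> C" "s \<in> S" for a s
  proof -
    have gs: "g s \<in> S'" and g1: "g (translate a s) \<in> S'"
      using bij_betw_apply[OF bij_g] as C(3) by blast+
    have \<phi>a: "\<phi> a \<in> D" using bij_betw_apply[OF \<phi>(1)] as by blast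
    have "fst (f s) \<in> C" using bij_betw_apply[OF f as(2)] by (simp add: mem_Times_iff)
    then have "f' (g (translate a s)) = (\<phi> a \<otimes> \<phi> (fst (f s)), snd (f s))"
      using f'_g[OF C(3)[rule_format, OF as]] f_eq[rule_format, OF as] \<phi>(2)[rule_format, OF as(1)] by simp
    also have "\<dots> = f' (translate (\<phi> a) (g s))"
      using f'_eq[rule_format, OF \<phi>a gs] f'_g[OF as(2)] by simp
    finally show ?thesis
      by (rule inj_onD[OF bij_betw_imp_inj_on[OF f'] _ g1 D(3)[rule_format, OF \<phi>a gs]])
  qed
  then show ?thesis using bij_g by blast
qed

end

context group
begin

definition words_span :: "('x \<Rightarrow> 'a) \<Rightarrow> 'x set \<Rightarrow> 'a set" where
  "words_span q S = word_val G q ` {w. gens w \<subseteq> S}"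

lemma subgroup_words_span:
  assumes q: "\<And>x. q x \<in> carrier G"
  shows "subgroup (words_span q S) G"
proof (rule subgroupI)
  show "words_span q S \<subseteq> carrier G" using q by (auto simp: words_span_def)
  show "words_span q S \<noteq> {}" by (auto simp: words_span_def intro: exI[of _ "[]"])
next
  fix a assume "a \<in> words_span q S"
  then obtain w where "gens w \<subseteq> S" "a = word_val G q w" by (auto simp: words_span_def)
  then have "inv a = word_val G q (inv_word w)" "gens (inv_word w) \<subseteq> S"
    using q by (simp_all only: word_val_inv_word gens_inv_word)
  then show "inv a \<in> words_span q S" unfolding words_span_def by blast
next
  fix a b assume "a \<in> words_span q S" "b \<in> words_span q S"
  then obtain u v where "gens u \<subseteq> S" "a = word_val G q u" "gens v \<subseteq> S" "b = word_val G q v"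
    by (auto simp: words_span_def)
  then have "a \<otimes> b = word_val G q (u @ v)" "gens (u @ v) \<subseteq> S"
    using q by (auto simp: word_val_append)
  then show "a \<otimes> b \<in> words_span q S" unfolding words_span_def by blast
qed

lemma gen_in_words_span:
  assumes "q x \<in> carrier G" "x \<in> S"
  shows "q x \<in> words_span q S"
proof -
  have "q x = word_val G q [(x, True)]" using assms by (simp add: letter_val_def)
  moreover have "gens [(x, True)] \<subseteq> S" using assms by simp
  ultimately show ?thesis unfolding words_span_def by blast
qed

lemma same_relations_iso:
  assumes q1: "\<And>x. q1 x \<in> carrier G" and q2: "\<And>x. q2 x \<in> carrier G"
    and rel: "\<And>w. gens w \<subseteq> S \<Longrightarrow> word_val G q1 w = \<one> \<longleftrightarrow> word_val G q2 w = \<one>"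
  shows "\<exists>\<phi>. bij_betw \<phi> (words_span q1 S) (words_span q2 S) \<and>
    (\<forall>a\<in>words_span q1 S. \<forall>b\<in>words_span q1 S. \<phi> (a \<otimes> b) = \<phi> a \<otimes> \<phi> b) \<and>
    (\<forall>w. gens w \<subseteq> S \<longrightarrow> \<phi> (word_val G q1 w) = word_val G q2 w)"
proof -
  define \<phi> where "\<phi> a = word_val G q2 (SOME w. gens w \<subseteq> S \<and> word_val G q1 w = a)" for a
  have eq: "word_val G q1 u = word_val G q1 v \<longleftrightarrow> word_val G q2 u = word_val G q2 v"
    if uv: "gens u \<subseteq> S" "gens v \<subseteq> S" for u v
  proof -
    have "word_val G q u = word_val G q v \<longleftrightarrow> word_val G q (inv_word v @ u) = \<one>"
      if q: "\<And>x. q x \<in> carrier G" for q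
    proof -
      have "a = b \<longleftrightarrow> inv b \<otimes> a = \<one>" if "a \<in> carrier G" "b \<in> carrier G" for a b
        using that Units_l_cancel[of "inv b" a b] by (simp add: Units_eq)
      from this[of "word_val G q u" "word_val G q v"] show ?thesis
        using q by (simp add: word_val_append word_val_inv_word)
    qed
    moreover have "gens (inv_word v @ u) \<subseteq> S"
      using uv by (simp only: set_append image_Un gens_inv_word Un_least)
    ultimately show ?thesis using rel q1 q2 by simp
  qed
  have \<phi>: "\<phi> (word_val G q1 w) = word_val G q2 w" if "gens w \<subseteq> S" for w
  proof -
    let ?P = "\<lambda>u. gens u \<subseteq> S \<and> word_val G q1 u = word_val G q1 w"
    have "?P (SOME u. ?P u)" using that by (intro someI[of ?P w]) simp
    then show ?thesis unfolding \<phi>_def using eq that by blast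
  qed
  have "bij_betw \<phi> (words_span q1 S) (words_span q2 S)"
    unfolding bij_betw_def
  proof
    show "inj_on \<phi> (words_span q1 S)"
      by (rule inj_onI) (auto simp: words_span_def \<phi> eq)
    show "\<phi> ` words_span q1 S = words_span q2 S"
      unfolding words_span_def image_image by (rule image_cong) (auto simp: \<phi>)
  qed
  moreover have "\<phi> (a \<otimes> b) = \<phi> a \<otimes> \<phi> b"
    if "a \<in> words_span q1 S" "b \<in> words_span q1 S" for a b
  proof -
    obtain u v where uv: "gens u \<subseteq> S" "a = word_val G q1 u" "gens v \<subseteq> S" "b = word_val G q1 v"
      using \<open>a \<in> _\<close> \<open>b \<in> _\<close> by (auto simp: words_span_def)
    then have "\<phi> (a \<otimes> b) = \<phi> (word_val G q1 (u @ v))" using q1 by (simp add: word_val_append)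
    also have "\<dots> = word_val G q2 (u @ v)" by (rule \<phi>) (use uv in auto)
    also have "\<dots> = \<phi> a \<otimes> \<phi> b" using uv q2 by (simp add: word_val_append \<phi>)
    finally show ?thesis .
  qed
  ultimately show ?thesis
    using \<phi> by (intro exI[of _ \<phi>]) simp
qed

text \<open>The stable letter of an HNN extension, realised as a permutation. The sets \<open>Xp\<close> and \<open>Xm\<close>
  stand for the normal forms that begin with the stable letter and with its inverse. All that is
  needed is that \<open>\<tau>\<close> intertwines the two actions on the complement of \<open>Xm\<close> and on \<open>Xp\<close>, and
  likewise on \<open>Xm\<close> and on the complement of \<open>Xp\<close>; such maps exist since all four actions are free
  with infinitely many orbits. Of the copies of the group, those with number 1 and 2 modulo 3
  contain \<open>Xp\<close> and \<open>Xm\<close> with their translates, and the others leave room for a base point.\<close>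

lemma ex_stable_letter:
  assumes count: "countable (carrier G)"
    and C: "subgroup C G" and D: "subgroup D G"
    and \<phi>: "bij_betw \<phi> C D" "\<forall>a\<in>C. \<forall>b\<in>C. \<phi> (a \<otimes> b) = \<phi> a \<otimes> \<phi> b"
  defines "Xm \<equiv> {(k, n). k \<in> C \<and> n mod 3 = (2 :: nat)}"
    and "Xp \<equiv> {(k, n). k \<in> D \<and> n mod 3 = (1 :: nat)}"
  shows "\<exists>\<tau>. bij \<tau> \<and> (\<forall>a\<in>C. \<tau> \<circ> translate a = translate (\<phi> a) \<circ> \<tau>) \<and>
    \<tau> ` (carrier G \<times> UNIV - Xm) = Xp \<and> \<tau> ` Xm = carrier G \<times> UNIV - Xp"
proof -
  let ?\<Omega> = "carrier G \<times> (UNIV :: nat set)"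
  have CG: "C \<subseteq> carrier G" and DG: "D \<subseteq> carrier G" using C D by (auto dest: subgroup.subset)
  have one: "\<one> \<in> C" "\<one> \<in> D" using C D by (auto intro: subgroup.one_closed)
  have inf: "infinite {n :: nat. n mod 3 = r}" if "r < 3" for r
  proof
    assume "finite {n :: nat. n mod 3 = r}"
    moreover have "range (\<lambda>n. 3 * n + r) \<subseteq> {n. n mod 3 = r}" using that by auto
    ultimately have "finite (range (\<lambda>n :: nat. 3 * n + r))" by (rule finite_subset[rotated])
    moreover have "inj (\<lambda>n :: nat. 3 * n + r)" by (auto simp: inj_def)
    ultimately show False using finite_imageD by blast
  qed
  have coset_inv: "a \<otimes> k \<in> E \<longleftrightarrow> k \<in> E" if "subgroup E G" "a \<in> E" "k \<in> carrier G" for E a k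
  proof -
    have "a \<in> carrier G" using that by (meson subgroup.mem_carrier)
    have "inv a \<otimes> (a \<otimes> k) = k" using that \<open>a \<in> carrier G\<close> by (simp add: m_assoc[symmetric])
    then show ?thesis using that by (metis subgroup.m_closed subgroup.m_inv_closed)
  qed
  have "snd ` (?\<Omega> - Xm) \<supseteq> {n. n mod 3 = 0}" "snd ` Xm \<supseteq> {n. n mod 3 = 2}"
    "snd ` (?\<Omega> - Xp) \<supseteq> {n. n mod 3 = 0}" "snd ` Xp \<supseteq> {n. n mod 3 = 1}"
    using one CG by (force simp: Xm_def Xp_def image_iff)+
  then have infs: "infinite (snd ` (?\<Omega> - Xm))" "infinite (snd ` Xm)"
    "infinite (snd ` (?\<Omega> - Xp))" "infinite (snd ` Xp)"
    using inf[of 0] inf[of 1] inf[of 2] by (auto dest: finite_subset)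
  have Om: "Xm \<subseteq> ?\<Omega>" "Xp \<subseteq> ?\<Omega>" using CG DG by (auto simp: Xm_def Xp_def)
  have invm: "translate a s \<in> Xm \<longleftrightarrow> s \<in> Xm" if "a \<in> C" "s \<in> ?\<Omega>" for a s
    using that coset_inv[OF C that(1)] by (auto simp: Xm_def)
  have invp: "translate a s \<in> Xp \<longleftrightarrow> s \<in> Xp" if "a \<in> D" "s \<in> ?\<Omega>" for a s
    using that coset_inv[OF D that(1)] by (auto simp: Xp_def)
  have inv\<Omega>: "translate a s \<in> ?\<Omega>" if "a \<in> carrier G" "s \<in> ?\<Omega>" for a s
    using that by auto
  have act: "\<forall>a\<in>C. \<forall>s\<in>?\<Omega> - Xm. translate a s \<in> ?\<Omega> - Xm" "\<forall>a\<in>C. \<forall>s\<in>Xm. translate a s \<in> Xm"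
    "\<forall>a\<in>D. \<forall>s\<in>?\<Omega> - Xp. translate a s \<in> ?\<Omega> - Xp" "\<forall>a\<in>D. \<forall>s\<in>Xp. translate a s \<in> Xp"
    by (simp_all add: invm invp inv\<Omega> subsetD[OF CG] subsetD[OF DG] subsetD[OF Om(1)] subsetD[OF Om(2)]
        del: mem_Sigma_iff)
  obtain g1 where g1: "bij_betw g1 (?\<Omega> - Xm) Xp"
    and g1_eq: "\<forall>a\<in>C. \<forall>s\<in>?\<Omega> - Xm. g1 (translate a s) = translate (\<phi> a) (g1 s)"
    using equivariant_bijection[OF count C Diff_subset act(1) infs(1) D Om(2) act(4) infs(4) \<phi>]
    by (elim exE conjE)
  obtain g2 where g2: "bij_betw g2 Xm (?\<Omega> - Xp)"
    and g2_eq: "\<forall>a\<in>C. \<forall>s\<in>Xm. g2 (translate a s) = translate (\<phi> a) (g2 s)"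
    using equivariant_bijection[OF count C Om(1) act(2) infs(2) D Diff_subset act(3) infs(3) \<phi>]
    by (elim exE conjE)
  define \<tau> where "\<tau> s = (if s \<in> Xm then g2 s else if s \<in> ?\<Omega> then g1 s else s)" for s
  have \<tau>1: "bij_betw \<tau> (?\<Omega> - Xm) Xp"
    using g1 by (rule bij_betw_cong[THEN iffD1, rotated]) (auto simp: \<tau>_def)
  have \<tau>2: "bij_betw \<tau> Xm (?\<Omega> - Xp)"
    using g2 by (rule bij_betw_cong[THEN iffD1, rotated]) (auto simp: \<tau>_def)
  have \<tau>3: "bij_betw \<tau> (- ?\<Omega>) (- ?\<Omega>)"
    using bij_betw_id by (rule bij_betw_cong[THEN iffD1, rotated]) (use Om in \<open>auto simp: \<tau>_def\<close>)
  have "bij_betw \<tau> ((?\<Omega> - Xm) \<union> Xm) (Xp \<union> (?\<Omega> - Xp))"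
    using \<tau>1 \<tau>2 by (rule bij_betw_combine) auto
  moreover have "(?\<Omega> - Xm) \<union> Xm = ?\<Omega>" "Xp \<union> (?\<Omega> - Xp) = ?\<Omega>" using Om by auto
  ultimately have \<tau>\<Omega>: "bij_betw \<tau> ?\<Omega> ?\<Omega>" by simp
  then have "bij_betw \<tau> (?\<Omega> \<union> - ?\<Omega>) (?\<Omega> \<union> - ?\<Omega>)"
    using \<tau>3 by (rule bij_betw_combine) auto
  then have "bij \<tau>" by (simp only: Compl_partition)
  moreover have "\<tau> (translate a s) = translate (\<phi> a) (\<tau> s)" if "a \<in> C" for a s
  proof -
    consider "s \<in> Xm" | "s \<in> ?\<Omega> - Xm" | "s \<notin> ?\<Omega>" by blast
    then show ?thesis
    proof cases
      case 1
      then have "translate a s \<in> Xm" using invm that Om by blast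
      then show ?thesis using 1 g2_eq that by (simp add: \<tau>_def)
    next
      case 2
      then have "translate a s \<in> ?\<Omega> - Xm" using invm inv\<Omega> that CG by blast
      then show ?thesis using 2 g1_eq that by (simp add: \<tau>_def)
    next
      case 3
      then have "fst s \<notin> carrier G" "s \<notin> Xm" using Om by (auto simp: mem_Times_iff)
      then show ?thesis using 3 by (simp add: translate_def \<tau>_def)
    qed
  qed
  ultimately show ?thesis
    using \<tau>1 \<tau>2 by (intro exI[of _ \<tau>]) (auto simp: bij_betw_def fun_eq_iff)
qed

end

text \<open>Two families of elements that satisfy the same relations generate isomorphic subgroups and can
  be conjugated to each other in a larger group. If \<open>g\<close> is not in the first subgroup and \<open>h\<close> not
  in the second, then \<open>\<tau>\<close> and \<open>h\<tau>g\<close> play ping-pong with the sets \<open>Xp\<close>, \<open>Xm\<close>, \<open>hXp\<close> and \<open>g\<inverse>Xm\<close>: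
  these are disjoint because \<open>Xp\<close> and \<open>Xm\<close> are disjoint from their translates by elements outside
  the second and the first subgroup, respectively.\<close>

lemma (in group) hnn_model:
  fixes q1 q2 :: "'x \<Rightarrow> 'a"
  assumes count: "countable (carrier G)"
    and q1: "\<And>x. q1 x \<in> carrier G" and q2: "\<And>x. q2 x \<in> carrier G"
    and rel: "\<And>w. gens w \<subseteq> S \<Longrightarrow> word_val G q1 w = \<one> \<longleftrightarrow> word_val G q2 w = \<one>"
  shows "\<exists>(L :: 'a \<Rightarrow> 'a \<times> nat \<Rightarrow> 'a \<times> nat) \<tau>. L \<in> hom G perms \<and> inj_on L (carrier G) \<and> bij \<tau> \<and>
    (\<forall>x\<in>S. \<tau> \<circ> L (q1 x) = L (q2 x) \<circ> \<tau>) \<and>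
    (\<forall>g\<in>carrier G - words_span q1 S. \<forall>h\<in>carrier G - words_span q2 S. \<forall>w :: bool letter list.
      reduced w \<longrightarrow> w \<noteq> [] \<longrightarrow> word_val perms (\<lambda>b. if b then \<tau> else L h \<circ> \<tau> \<circ> L g) w \<noteq> id)"
proof -
  let ?\<Omega> = "carrier G \<times> (UNIV :: nat set)"
  let ?C = "words_span q1 S" and ?D = "words_span q2 S"
  have C: "subgroup ?C G" and D: "subgroup ?D G"
    using q1 q2 by (simp_all add: subgroup_words_span)
  have "\<exists>\<phi>. bij_betw \<phi> ?C ?D \<and> (\<forall>a\<in>?C. \<forall>b\<in>?C. \<phi> (a \<otimes> b) = \<phi> a \<otimes> \<phi> b) \<and>
    (\<forall>w. gens w \<subseteq> S \<longrightarrow> \<phi> (word_val G q1 w) = word_val G q2 w)"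
    by (rule same_relations_iso) (use q1 q2 rel in auto)
  then obtain \<phi> where \<phi>: "bij_betw \<phi> ?C ?D" "\<forall>a\<in>?C. \<forall>b\<in>?C. \<phi> (a \<otimes> b) = \<phi> a \<otimes> \<phi> b"
    and \<phi>_gen: "\<forall>w. gens w \<subseteq> S \<longrightarrow> \<phi> (word_val G q1 w) = word_val G q2 w"
    by (elim exE conjE)
  define Xm Xp where "Xm = {(k, n). k \<in> ?C \<and> n mod 3 = (2 :: nat)}"
    and "Xp = {(k, n). k \<in> ?D \<and> n mod 3 = (1 :: nat)}"
  from ex_stable_letter[OF count C D \<phi>] obtain \<tau> where \<tau>: "bij \<tau>"
    and comm: "\<forall>a\<in>?C. \<tau> \<circ> translate a = translate (\<phi> a) \<circ> \<tau>"
    and \<tau>p: "\<tau> ` (?\<Omega> - Xm) = Xp" and \<tau>m: "\<tau> ` Xm = ?\<Omega> - Xp"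
    unfolding Xm_def Xp_def by (elim exE conjE)
  have \<phi>_q: "\<phi> (q1 x) = q2 x" if "x \<in> S" for x
    using \<phi>_gen[rule_format, of "[(x, True)]"] that q1 q2 by (simp add: letter_val_def)
  have "\<tau> \<circ> translate (q1 x) = translate (q2 x) \<circ> \<tau>" if "x \<in> S" for x
    using comm[rule_format, OF gen_in_words_span[of q1 x S, OF q1 that]] \<phi>_q[OF that] by simp
  moreover have "word_val perms (\<lambda>b. if b then \<tau> else translate h \<circ> \<tau> \<circ> translate g) w \<noteq> id"
    if g: "g \<in> carrier G - ?C" and h: "h \<in> carrier G - ?D" and w: "reduced w" "w \<noteq> []"
    for g h and w :: "bool letter list"
  proof -
    have gG: "g \<in> carrier G" and hG: "h \<in> carrier G" using g h by auto
    let ?q = "translate h \<circ> \<tau> \<circ> translate g"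
    have q: "bij ?q" using \<tau> bij_translate gG hG by (intro bij_comp)
    have Om: "Xm \<subseteq> ?\<Omega>" "Xp \<subseteq> ?\<Omega>"
      using subgroup.subset[OF C] subgroup.subset[OF D] by (auto simp: Xm_def Xp_def)
    have tOm: "translate k s \<in> ?\<Omega>" if "k \<in> carrier G" "s \<in> ?\<Omega>" for k s
      using that by auto
    have cancel: "translate (inv k) (translate k s) = s" "translate k (translate (inv k) s) = s"
      if "k \<in> carrier G" for k s
      using that by (simp_all add: translate_translate translate_one)
    have \<tau>p_in: "\<tau> s \<in> Xp" if "s \<in> ?\<Omega>" "s \<notin> Xm" for s using \<tau>p that by blast
    have \<tau>m_in: "inv_into UNIV \<tau> s \<in> Xm" if s: "s \<in> ?\<Omega>" "s \<notin> Xp" for s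
    proof -
      have "s \<in> \<tau> ` Xm" using s \<tau>m by blast
      then show ?thesis using \<tau> by (auto simp: bij_is_inj)
    qed
    let ?hp = "translate h ` Xp" and ?gm = "translate (inv g) ` Xm"
    have qp_in: "?q s \<in> ?hp" if s: "s \<in> ?\<Omega>" "s \<notin> ?gm" for s
    proof -
      have "translate g s \<notin> Xm" using s(2) cancel(1)[OF gG, of s] by (metis imageI)
      then show ?thesis using \<tau>p_in[of "translate g s"] tOm[OF gG s(1)] by simp
    qed
    have qm_in: "inv_into UNIV ?q s \<in> ?gm" if s: "s \<in> ?\<Omega>" "s \<notin> ?hp" for s
    proof -
      have "translate (inv h) s \<notin> Xp" using s(2) cancel(2)[OF hG, of s] by (metis imageI)
      then have "translate (inv h) s \<in> \<tau> ` Xm" using tOm[of "inv h" s] s(1) hG \<tau>m by simp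
      then obtain x where x: "x \<in> Xm" "translate (inv h) s = \<tau> x" by blast
      then have "?q (translate (inv g) x) = s"
        using cancel(2)[OF hG, of s] cancel(2)[OF gG, of x] by simp
      then have "inv_into UNIV ?q s = translate (inv g) x"
        using q by (metis bij_inv_eq_iff)
      then show ?thesis using x by blast
    qed
    have not_D: "h \<otimes> k \<notin> ?D" if "k \<in> ?D" for k
    proof
      assume "h \<otimes> k \<in> ?D"
      then have "h \<otimes> k \<otimes> inv k \<in> ?D" using D that by (meson subgroup.m_closed subgroup.m_inv_closed)
      moreover have "k \<in> carrier G" using that D by (rule subgroup.mem_carrier[rotated])
      ultimately show False using h by (simp add: m_assoc)
    qed
    have not_C: "inv g \<otimes> k \<notin> ?C" if "k \<in> ?C" for k
    proof
      have k: "k \<in> carrier G" using that C by (rule subgroup.mem_carrier[rotated])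
      assume "inv g \<otimes> k \<in> ?C"
      then have "k \<otimes> inv (inv g \<otimes> k) \<in> ?C"
        using C that by (meson subgroup.m_closed subgroup.m_inv_closed)
      moreover have "k \<otimes> inv (inv g \<otimes> k) = g" using k gG by (simp add: inv_mult_group m_assoc[symmetric])
      ultimately show False using g by simp
    qed
    have kC: "k \<in> carrier G" if "k \<in> ?C" for k using that C by (rule subgroup.mem_carrier[rotated])
    have kD: "k \<in> carrier G" if "k \<in> ?D" for k using that D by (rule subgroup.mem_carrier[rotated])
    have dis: "Xp \<inter> Xm = {}" "Xp \<inter> ?hp = {}" "Xp \<inter> ?gm = {}" "Xm \<inter> ?hp = {}" "Xm \<inter> ?gm = {}"
      "?hp \<inter> ?gm = {}"
      using not_C not_D by (auto simp: Xp_def Xm_def kC kD)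
    \<comment> \<open>the letter \<open>True\<close> stands for \<open>\<tau>\<close>, the letter \<open>False\<close> for \<open>h\<tau>g\<close>\<close>
    let ?E = "\<lambda>l. if fst l then if snd l then Xp else Xm else if snd l then ?hp else ?gm"
    show ?thesis
    proof (rule ping_pong[where \<Omega> = ?\<Omega> and D = ?E and \<omega> = "(\<one>, 0)"])
      show "(\<one>, 0) \<in> ?\<Omega>" by simp
      show "(\<one>, 0) \<notin> ?E l" for l by (auto simp: Xp_def Xm_def kC kD)
      show "?E l \<subseteq> ?\<Omega>" for l using Om tOm[OF hG] tOm[of "inv g"] gG by auto
      show "?E k \<inter> ?E l = {}" if "k \<noteq> l" for k l
        using that dis by (cases k; cases l) (auto simp del: Int_iff split: if_splits)
      show "letter_val perms (\<lambda>b. if b then \<tau> else ?q) l s \<in> ?E l"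
        if "s \<in> ?\<Omega>" "s \<notin> ?E (inv_letter l)" for l s
      proof (cases l)
        case (Pair b e)
        then show ?thesis
          using that \<tau>p_in \<tau>m_in qp_in qm_in inv_perms[OF \<tau>] inv_perms[OF q]
          by (cases b; cases e) (simp_all add: letter_val_def inv_letter_def)
      qed
    qed (use w in auto)
  qed
  ultimately show ?thesis
    using translate_hom inj_translate \<tau>
    by (intro exI[of _ translate] exI[of _ \<tau>] conjI ballI allI impI) assumption+
qed

section \<open>Rewriting words of exponent sum zero\<close>

text \<open>The letter \<open>(b, i)\<close> of the rewritten word stands for \<open>t\<^sup>ibt\<^sup>-\<^sup>i\<close>. The argument \<open>i\<close> is the exponent
  sum of \<open>t\<close> in the part of the word that has been read.\<close>

primrec hnn_rewrite :: "'a \<Rightarrow> int \<Rightarrow> 'a letter list \<Rightarrow> ('a \<times> int) letter list" where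
  "hnn_rewrite t i [] = []"
| "hnn_rewrite t i (l # w) =
     (if fst l = t then hnn_rewrite t (if snd l then i + 1 else i - 1) w
      else ((fst l, i), snd l) # hnn_rewrite t i w)"

lemma gens_hnn_rewrite: "y \<in> gens (hnn_rewrite t i w) \<Longrightarrow> fst y \<in> gens w \<and> fst y \<noteq> t"
  by (induction w arbitrary: i) (auto split: if_splits)

lemma length_hnn_rewrite: "length (hnn_rewrite t i w) = count_letters (\<lambda>l. fst l \<noteq> t) w"
  by (induction w arbitrary: i) auto

context group
begin

definition conj_pow :: "'a \<Rightarrow> int \<Rightarrow> 'a \<Rightarrow> 'a" where
  "conj_pow t k x = t [^] k \<otimes> x \<otimes> inv (t [^] k)"

lemma conj_pow_closed [simp]: "t \<in> carrier G \<Longrightarrow> x \<in> carrier G \<Longrightarrow> conj_pow t k x \<in> carrier G"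
  by (simp add: conj_pow_def)

lemma conj_pow_add:
  assumes "t \<in> carrier G" "x \<in> carrier G"
  shows "conj_pow t k (conj_pow t l x) = conj_pow t (k + l) x"
  using assms by (simp add: conj_pow_def int_pow_mult inv_mult_group m_assoc)

lemma conj_pow_0 [simp]: "x \<in> carrier G \<Longrightarrow> conj_pow t 0 x = x"
  by (simp add: conj_pow_def)

lemma conj_pow_1:
  assumes "t \<in> carrier G" "x \<in> carrier G" "y \<in> carrier G" "t \<otimes> x = y \<otimes> t"
  shows "conj_pow t 1 x = y"
  using assms by (simp add: conj_pow_def m_assoc)

lemma conj_pow_mult:
  assumes "t \<in> carrier G" "x \<in> carrier G" "y \<in> carrier G"
  shows "conj_pow t k (x \<otimes> y) = conj_pow t k x \<otimes> conj_pow t k y"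
proof -
  have "inv (t [^] k) \<otimes> (t [^] k \<otimes> z) = z" if "z \<in> carrier G" for z
    using assms that by (simp add: m_assoc[symmetric])
  then show ?thesis using assms by (simp add: conj_pow_def m_assoc)
qed

lemma conj_pow_inv:
  "t \<in> carrier G \<Longrightarrow> x \<in> carrier G \<Longrightarrow> conj_pow t k (inv x) = inv (conj_pow t k x)"
  by (simp add: conj_pow_def inv_mult_group m_assoc)

lemma conj_pow_one [simp]: "t \<in> carrier G \<Longrightarrow> conj_pow t k \<one> = \<one>"
  by (simp add: conj_pow_def)

lemma conj_pow_hom: "t \<in> carrier G \<Longrightarrow> conj_pow t k \<in> hom G G"
  by (auto simp: hom_def conj_pow_mult)

lemma conj_pow_eq_one:
  assumes "t \<in> carrier G" "x \<in> carrier G"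
  shows "conj_pow t k x = \<one> \<longleftrightarrow> x = \<one>"
proof
  assume "conj_pow t k x = \<one>"
  then have "conj_pow t (- k) (conj_pow t k x) = conj_pow t (- k) \<one>" by simp
  then show "x = \<one>" using assms by (simp add: conj_pow_add)
qed (use assms in simp)

definition conj_val :: "('x \<Rightarrow> 'a) \<Rightarrow> 'x \<Rightarrow> 'x \<times> int \<Rightarrow> 'a" where
  "conj_val \<rho> t y = conj_pow (\<rho> t) (snd y) (\<rho> (fst y))"

lemma conj_val_closed [simp]: "(\<And>x. \<rho> x \<in> carrier G) \<Longrightarrow> conj_val \<rho> t y \<in> carrier G"
  by (simp add: conj_val_def)

text \<open>The factor \<open>t\<^sup>i\<close> is pushed through the word from left to right.\<close>

lemma word_val_hnn_rewrite_aux: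
  assumes \<rho>: "\<And>x. \<rho> x \<in> carrier G"
  shows "\<rho> t [^] i \<otimes> word_val G \<rho> w
    = word_val G (conj_val \<rho> t) (hnn_rewrite t i w) \<otimes> \<rho> t [^] (i + esum t w)"
proof (induction w arbitrary: i)
  case Nil
  then show ?case using \<rho> by simp
next
  case (Cons l w)
  obtain x e where l: "l = (x, e)" by (cases l)
  show ?case
  proof (cases "x = t")
    case True
    have "\<rho> t [^] i \<otimes> letter_val G \<rho> l = \<rho> t [^] (if e then i + 1 else i - 1)"
      using \<rho> int_pow_mult[of "\<rho> t" i 1] int_pow_diff[of "\<rho> t" i 1]
      by (simp add: l True letter_val_def)
    then have "\<rho> t [^] i \<otimes> word_val G \<rho> (l # w)
        = \<rho> t [^] (if e then i + 1 else i - 1) \<otimes> word_val G \<rho> w"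
      using \<rho> by (simp add: m_assoc[symmetric])
    also have "\<dots> = word_val G (conj_val \<rho> t) (hnn_rewrite t (if e then i + 1 else i - 1) w)
        \<otimes> \<rho> t [^] ((if e then i + 1 else i - 1) + esum t w)"
      by (rule Cons)
    finally show ?thesis by (simp add: l True algebra_simps split: if_splits)
  next
    case False
    have cl: "letter_val G (conj_val \<rho> t) ((x, i), e) = conj_pow (\<rho> t) i (letter_val G \<rho> l)"
      using \<rho> by (simp add: l letter_val_def conj_val_def conj_pow_inv)
    have "\<rho> t [^] i \<otimes> word_val G \<rho> (l # w)
        = conj_pow (\<rho> t) i (letter_val G \<rho> l) \<otimes> (\<rho> t [^] i \<otimes> word_val G \<rho> w)"
      using \<rho> inv_solve_left[of "word_val G \<rho> w" "\<rho> t [^] i" "\<rho> t [^] i \<otimes> word_val G \<rho> w"]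
      by (simp add: conj_pow_def m_assoc)
    also have "\<dots> = word_val G (conj_val \<rho> t) (hnn_rewrite t i (l # w)) \<otimes> \<rho> t [^] (i + esum t (l # w))"
      using False \<rho> cl by (simp add: Cons l m_assoc)
    finally show ?thesis .
  qed
qed

lemma word_val_hnn_rewrite:
  assumes "\<And>x. \<rho> x \<in> carrier G" "esum t w = 0"
  shows "word_val G \<rho> w = word_val G (conj_val \<rho> t) (hnn_rewrite t 0 w)"
  using word_val_hnn_rewrite_aux[of \<rho> t 0 w] assms by simp

end

section \<open>One-relator groups inside HNN extensions\<close>

text \<open>The conclusion of the Freiheitssatz for a single relator, which has to be available as a
  hypothesis in the induction.\<close>

definition magnus_property :: "'a letter list \<Rightarrow> bool" where
  "magnus_property r \<longleftrightarrow> (\<forall>x\<in>gens r. \<forall>u. x \<notin> gens u \<longrightarrow> consequence {r} u \<longrightarrow> red u = [])"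

lemma countable_presented_group:
  "countable (carrier (presented_group (UNIV :: 'a :: countable set) R))"
proof -
  have "carrier (presented_group (UNIV :: 'a set) R)
      \<subseteq> (\<lambda>w. normal_closure (free_group UNIV) R #>\<^bsub>free_group UNIV\<^esub> w) ` UNIV"
    by (auto simp: presented_group_def carrier_FactGroup)
  then show ?thesis by (rule countable_subset) simp
qed

text \<open>In the group with relator \<open>r\<close> the generators in \<open>S\<close> omit \<open>(a, \<nu>)\<close> and their shifts omit
  \<open>(a, \<mu>)\<close>. Both of these occur in \<open>r\<close>, so both families are free by the Magnus property and
  \<open>hnn_model\<close> yields a permutation \<open>\<tau>\<close> that shifts the indices by one. The last part of the
  conclusion is ping-pong with the elements \<open>(a, \<mu>)\<close> and \<open>(a, \<nu>)\<close>; its two hypotheses say that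
  they do not belong to the subgroups generated by the shift of \<open>S\<close> and by \<open>S\<close>, respectively.\<close>

lemma one_relator_hnn:
  fixes r :: "('a :: countable \<times> int) letter list"
  assumes r: "cyclically_reduced r" "magnus_property r" and ends: "(a, \<mu>) \<in> gens r" "(a, \<nu>) \<in> gens r"
  defines "S \<equiv> {(b, i). b \<noteq> a \<or> \<mu> \<le> i \<and> i < \<nu>}" and "sh \<equiv> (\<lambda>(b, i). (b, i + 1))"
  shows "\<exists>(\<sigma> :: 'a \<times> int \<Rightarrow> ('a \<times> int) letter list set \<times> nat \<Rightarrow> ('a \<times> int) letter list set \<times> nat) \<tau>.
    (\<forall>y. bij (\<sigma> y)) \<and> bij \<tau> \<and> (\<forall>w. word_val perms \<sigma> w = id \<longleftrightarrow> consequence {r} w) \<and>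
    (\<forall>y\<in>S. \<tau> \<circ> \<sigma> y = \<sigma> (sh y) \<circ> \<tau>) \<and>
    ((\<forall>w. gens w \<subseteq> S \<longrightarrow> \<not> consequence {r} (((a, \<nu>), False) # w)) \<longrightarrow>
     (\<forall>w. gens w \<subseteq> S \<longrightarrow> \<not> consequence {r} (((a, \<mu>), False) # map (map_prod sh id) w)) \<longrightarrow>
     (\<forall>w :: bool letter list. reduced w \<longrightarrow> w \<noteq> [] \<longrightarrow>
       word_val perms (\<lambda>b. if b then \<tau> else \<sigma> (a, \<mu>) \<circ> \<tau> \<circ> \<sigma> (a, \<nu>)) w \<noteq> id))"
proof -
  define H where "H = presented_group (UNIV :: ('a \<times> int) set) {r}"
  define q where "q = pres_gen {r}"
  have red: "\<And>r'. r' \<in> {r} \<Longrightarrow> reduced r'" using r by (simp add: cyclically_reduced_reduced)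
  interpret H: group H unfolding H_def using red by (rule group_presented)
  have q: "q x \<in> carrier H" for x unfolding q_def H_def using red by (rule pres_gen_closed)
  have cons: "word_val H q w = \<one>\<^bsub>H\<^esub> \<longleftrightarrow> consequence {r} w" for w
    unfolding q_def H_def using red by (rule word_val_pres_gen_one)
  have "inj sh" by (auto simp: sh_def inj_def)
  have free: "word_val H q w = \<one>\<^bsub>H\<^esub> \<longleftrightarrow> red w = []" if "y \<in> gens r" "y \<notin> gens w" for w y
  proof
    assume "word_val H q w = \<one>\<^bsub>H\<^esub>"
    then show "red w = []" using r(2) that cons unfolding magnus_property_def by blast
  next
    assume "red w = []"
    then show "word_val H q w = \<one>\<^bsub>H\<^esub>" using H.word_val_red[of q w] q by simp
  qed
  have rel: "word_val H q w = \<one>\<^bsub>H\<^esub> \<longleftrightarrow> word_val H (q \<circ> sh) w = \<one>\<^bsub>H\<^esub>" if w: "gens w \<subseteq> S" for w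
  proof -
    have "(a, \<nu>) \<notin> gens w" using w by (auto simp: S_def)
    then have "word_val H q w = \<one>\<^bsub>H\<^esub> \<longleftrightarrow> red w = []" by (rule free[OF ends(2)])
    moreover have "(a, \<mu>) \<notin> gens (map (map_prod sh id) w)"
      using w by (force simp: S_def sh_def)
    then have "word_val H (q \<circ> sh) w = \<one>\<^bsub>H\<^esub> \<longleftrightarrow> red (map (map_prod sh id) w) = []"
      using free[OF ends(1)] by (simp add: word_val_map[symmetric])
    ultimately show ?thesis using red_map_eq_Nil_iff[OF \<open>inj sh\<close>] by simp
  qed
  have "countable (carrier H)" unfolding H_def by (rule countable_presented_group)
  then have "\<exists>(L :: ('a \<times> int) letter list set \<Rightarrow> ('a \<times> int) letter list set \<times> nat \<Rightarrow> _) \<tau>.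
    L \<in> hom H perms \<and> inj_on L (carrier H) \<and> bij \<tau> \<and>
    (\<forall>x\<in>S. \<tau> \<circ> L (q x) = L ((q \<circ> sh) x) \<circ> \<tau>) \<and>
    (\<forall>g\<in>carrier H - H.words_span q S. \<forall>h\<in>carrier H - H.words_span (q \<circ> sh) S.
      \<forall>w :: bool letter list. reduced w \<longrightarrow> w \<noteq> [] \<longrightarrow>
        word_val perms (\<lambda>b. if b then \<tau> else L h \<circ> \<tau> \<circ> L g) w \<noteq> id)"
    by (rule H.hnn_model) (assumption | rule rel | simp add: q)+
  then obtain L :: "('a \<times> int) letter list set \<Rightarrow> ('a \<times> int) letter list set \<times> nat \<Rightarrow> _" and \<tau>
    where L: "L \<in> hom H perms" "inj_on L (carrier H)" and \<tau>: "bij \<tau>"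
      "\<forall>x\<in>S. \<tau> \<circ> L (q x) = L ((q \<circ> sh) x) \<circ> \<tau>"
      and pp: "\<forall>g\<in>carrier H - H.words_span q S. \<forall>h\<in>carrier H - H.words_span (q \<circ> sh) S.
        \<forall>w :: bool letter list. reduced w \<longrightarrow> w \<noteq> [] \<longrightarrow>
          word_val perms (\<lambda>b. if b then \<tau> else L h \<circ> \<tau> \<circ> L g) w \<noteq> id"
    by (elim exE conjE)
  interpret L: group_hom H perms L
    using L(1) by (simp add: group_hom_def group_hom_axioms_def group_perms H.is_group)
  define \<sigma> where "\<sigma> = L \<circ> q"
  have "bij (\<sigma> y)" for y using L.hom_closed[OF q] by (simp add: \<sigma>_def)
  moreover have "word_val perms \<sigma> w = id \<longleftrightarrow> consequence {r} w" for w
  proof -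
    have "word_val perms \<sigma> w = L (word_val H q w)"
      unfolding \<sigma>_def by (rule word_val_hom[symmetric]) (simp_all add: group_perms H.is_group L q)
    moreover have "L (word_val H q w) = id \<longleftrightarrow> word_val H q w = \<one>\<^bsub>H\<^esub>"
      using L.hom_one inj_onD[OF L(2), of "word_val H q w" "\<one>\<^bsub>H\<^esub>"] q by auto
    ultimately show ?thesis using cons by simp
  qed
  moreover have "\<forall>y\<in>S. \<tau> \<circ> \<sigma> y = \<sigma> (sh y) \<circ> \<tau>" using \<tau> by (simp add: \<sigma>_def)
  moreover have "word_val perms (\<lambda>b. if b then \<tau> else \<sigma> (a, \<mu>) \<circ> \<tau> \<circ> \<sigma> (a, \<nu>)) w \<noteq> id"
    if 1: "\<forall>w. gens w \<subseteq> S \<longrightarrow> \<not> consequence {r} (((a, \<nu>), False) # w)"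
      and 2: "\<forall>w. gens w \<subseteq> S \<longrightarrow> \<not> consequence {r} (((a, \<mu>), False) # map (map_prod sh id) w)"
      and w: "reduced w" "w \<noteq> []" for w :: "bool letter list"
  proof -
    have "word_val H q ((y, False) # w) = \<one>\<^bsub>H\<^esub>" if "q y = word_val H q w" for y w
      using q that by (simp add: letter_val_def)
    then have neq: "q y \<noteq> word_val H q w" if "\<not> consequence {r} ((y, False) # w)" for y w
      using that cons by blast
    have "q (a, \<nu>) \<in> carrier H - H.words_span q S"
      using q unfolding H.words_span_def using neq 1 by blast
    moreover have "q (a, \<mu>) \<in> carrier H - H.words_span (q \<circ> sh) S"
      using q unfolding H.words_span_def using neq 2 by (auto simp: word_val_map[symmetric])
    ultimately have "word_val perms (\<lambda>b. if b then \<tau> else L (q (a, \<mu>)) \<circ> \<tau> \<circ> L (q (a, \<nu>))) w \<noteq> id"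
      using pp w by blast
    then show ?thesis unfolding \<sigma>_def o_apply .
  qed
  ultimately show ?thesis
    using \<tau>(1) by (intro exI[of _ \<sigma>] exI[of _ \<tau>] conjI ballI allI impI) (assumption | blast)+
qed

text \<open>The group with relator \<open>r\<close> is represented by permutations in such a way that \<open>t\<^sup>ibt\<^sup>-\<^sup>i\<close> acts as
  the generator \<open>(b, i)\<close> of the group with the rewritten relator \<open>r1\<close>. The range of \<open>i\<close> is
  limited for \<open>b = a\<close>, since the associated subgroups contain only letters \<open>(a, i)\<close> with indices
  between those that occur in \<open>r1\<close>.\<close>

lemma one_relator_rewritten_hnn:
  fixes r :: "'a :: countable letter list" and t :: 'a
  assumes r: "esum t r = 0"
    and r1: "cyclically_reduced r1" "conj_words r1 (hnn_rewrite t 0 r)" "magnus_property r1"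
    and ends: "(a, \<mu>) \<in> gens r1" "(a, \<nu>) \<in> gens r1"
      "\<forall>i. (a, i) \<in> gens r1 \<longrightarrow> \<mu> \<le> i \<and> i \<le> \<nu>"
  defines "S \<equiv> {(b, i). b \<noteq> a \<or> \<mu> \<le> i \<and> i < \<nu>}" and "sh \<equiv> (\<lambda>(b, i). (b, i + 1))"
    and "conj_of \<equiv> \<lambda>\<rho> y. group.conj_val perms \<rho> t y"
  shows "\<exists>\<rho> :: 'a \<Rightarrow> ('a \<times> int) letter list set \<times> nat \<Rightarrow> ('a \<times> int) letter list set \<times> nat.
    (\<forall>x. bij (\<rho> x)) \<and> word_val perms \<rho> r = id \<and>
    (\<forall>w. gens w \<subseteq> {(b, i). b \<noteq> t \<and> (b = a \<longrightarrow> \<mu> \<le> i \<and> i \<le> \<nu>)} \<longrightarrow>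
      (word_val perms (conj_of \<rho>) w = id \<longleftrightarrow> consequence {r1} w)) \<and>
    ((\<forall>w. gens w \<subseteq> S \<longrightarrow> \<not> consequence {r1} (((a, \<nu>), False) # w)) \<longrightarrow>
     (\<forall>w. gens w \<subseteq> S \<longrightarrow> \<not> consequence {r1} (((a, \<mu>), False) # map (map_prod sh id) w)) \<longrightarrow>
     (\<forall>w :: bool letter list. reduced w \<longrightarrow> w \<noteq> [] \<longrightarrow>
       word_val perms (\<lambda>b. if b then \<rho> t else conj_of \<rho> (a, \<mu>) \<circ> \<rho> t \<circ> conj_of \<rho> (a, \<nu>)) w \<noteq> id))"
proof -
  interpret P: group "perms :: ('w \<Rightarrow> 'w) monoid" by (rule group_perms)
  from one_relator_hnn[OF r1(1,3) ends(1,2)]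
  obtain \<sigma> :: "'a \<times> int \<Rightarrow> ('a \<times> int) letter list set \<times> nat \<Rightarrow> ('a \<times> int) letter list set \<times> nat"
    and \<tau> where \<sigma>: "\<forall>y. bij (\<sigma> y)" and \<tau>: "bij \<tau>"
      and cons: "\<forall>w. word_val perms \<sigma> w = id \<longleftrightarrow> consequence {r1} w"
      and comm: "\<forall>y\<in>S. \<tau> \<circ> \<sigma> y = \<sigma> (sh y) \<circ> \<tau>"
      and pp: "((\<forall>w. gens w \<subseteq> S \<longrightarrow> \<not> consequence {r1} (((a, \<nu>), False) # w)) \<longrightarrow>
     (\<forall>w. gens w \<subseteq> S \<longrightarrow> \<not> consequence {r1} (((a, \<mu>), False) # map (map_prod sh id) w)) \<longrightarrow>
     (\<forall>w :: bool letter list. reduced w \<longrightarrow> w \<noteq> [] \<longrightarrow>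
       word_val perms (\<lambda>b. if b then \<tau> else \<sigma> (a, \<mu>) \<circ> \<tau> \<circ> \<sigma> (a, \<nu>)) w \<noteq> id))"
    unfolding S_def sh_def by (elim exE conjE)
  have "(a, \<mu>) \<in> gens (hnn_rewrite t 0 r)"
    using gens_cyclically_reduced[OF r1(1,2)] ends(1) by blast
  then have "a \<noteq> t" using gens_hnn_rewrite[of "(a, \<mu>)" t 0 r] by simp
  \<comment> \<open>the index at which the image of a generator is read off: 0 need not lie in the range for \<open>a\<close>\<close>
  define m where "m b = (if b = a then \<mu> else 0)" for b
  define \<rho> where "\<rho> b = (if b = t then \<tau> else P.conj_pow \<tau> (- m b) (\<sigma> (b, m b)))" for b
  have \<rho>: "bij (\<rho> b)" for b
    using P.conj_pow_closed[of \<tau> "\<sigma> (b, m b)"] \<sigma> \<tau> by (simp add: \<rho>_def)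
  \<comment> \<open>the index rises one step at a time, as long as it stays in the range where \<open>\<tau>\<close> shifts it\<close>
  have up: "P.conj_pow \<tau> (int k) (\<sigma> (b, i)) = \<sigma> (b, i + int k)"
    if "\<And>j. i \<le> j \<Longrightarrow> j < i + int k \<Longrightarrow> (b, j) \<in> S" for b i k
    using that
  proof (induction k)
    case 0
    then show ?case using \<sigma> by simp
  next
    case (Suc k)
    have "P.conj_pow \<tau> (int (Suc k)) (\<sigma> (b, i)) = P.conj_pow \<tau> 1 (P.conj_pow \<tau> (int k) (\<sigma> (b, i)))"
      using \<sigma> \<tau> by (simp add: P.conj_pow_add)
    also have "\<dots> = P.conj_pow \<tau> 1 (\<sigma> (b, i + int k))"
      using Suc by simp
    also have "\<dots> = \<sigma> (b, i + int k + 1)"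
    proof (rule P.conj_pow_1)
      have "(b, i + int k) \<in> S" using Suc.prems[of "i + int k"] by simp
      then show "\<tau> \<otimes>\<^bsub>perms\<^esub> \<sigma> (b, i + int k) = \<sigma> (b, i + int k + 1) \<otimes>\<^bsub>perms\<^esub> \<tau>"
        using comm[rule_format, of "(b, i + int k)"] by (simp add: sh_def)
    qed (use \<sigma> \<tau> in auto)
    finally show ?case by (simp add: algebra_simps)
  qed
  have conj: "conj_of \<rho> (b, i) = \<sigma> (b, i)" if "b \<noteq> t" "b = a \<longrightarrow> \<mu> \<le> i \<and> i \<le> \<nu>" for b i
  proof -
    have "conj_of \<rho> (b, i) = P.conj_pow \<tau> (i - m b) (\<sigma> (b, m b))"
      using that \<sigma> \<tau> by (simp add: conj_of_def P.conj_val_def \<rho>_def P.conj_pow_add)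
    also have "\<dots> = \<sigma> (b, i)"
    proof (cases "m b \<le> i")
      case True
      then show ?thesis
        using up[of "m b" "nat (i - m b)" b] that by (auto simp: m_def S_def split: if_splits)
    next
      case False
      then have "b \<noteq> a" using that by (auto simp: m_def)
      then have "P.conj_pow \<tau> (m b - i) (\<sigma> (b, i)) = \<sigma> (b, m b)"
        using up[of i "nat (m b - i)" b] False by (auto simp: S_def)
      then have "P.conj_pow \<tau> (i - m b) (\<sigma> (b, m b))
          = P.conj_pow \<tau> (i - m b) (P.conj_pow \<tau> (m b - i) (\<sigma> (b, i)))" by simp
      also have "\<dots> = \<sigma> (b, i)" using \<sigma> \<tau> by (simp add: P.conj_pow_add)
      finally show ?thesis .
    qed
    finally show ?thesis .
  qed
  have cons': "word_val perms (conj_of \<rho>) w = id \<longleftrightarrow> consequence {r1} w"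
    if "gens w \<subseteq> {(b, i). b \<noteq> t \<and> (b = a \<longrightarrow> \<mu> \<le> i \<and> i \<le> \<nu>)}" for w
  proof -
    have "word_val perms (conj_of \<rho>) w = word_val perms \<sigma> w"
      by (rule word_val_cong) (use conj that in auto)
    then show ?thesis using cons by simp
  qed
  have "gens r1 \<subseteq> {(b, i). b \<noteq> t \<and> (b = a \<longrightarrow> \<mu> \<le> i \<and> i \<le> \<nu>)}"
  proof
    fix y assume y: "y \<in> gens r1"
    then have "y \<in> gens (hnn_rewrite t 0 r)" using gens_cyclically_reduced[OF r1(1,2)] by blast
    then have "fst y \<noteq> t" using gens_hnn_rewrite[of y t 0 r] by simp
    then show "y \<in> {(b, i). b \<noteq> t \<and> (b = a \<longrightarrow> \<mu> \<le> i \<and> i \<le> \<nu>)}"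
      using ends(3) y by (cases y) (simp, blast)
  qed
  moreover have "consequence {r1} r1"
    using r1(1) by (simp add: consequence_relator cyclically_reduced_reduced)
  ultimately have "word_val perms (conj_of \<rho>) r1 = id" using cons'[of r1] by simp
  then have "word_val perms (conj_of \<rho>) (hnn_rewrite t 0 r) = id"
    using P.conj_words_word_val[OF _ r1(2), of "conj_of \<rho>"] P.conj_val_closed[of \<rho> t] \<rho>
    unfolding conj_of_def perms_simps by blast
  then have \<rho>r: "word_val perms \<rho> r = id"
    using P.word_val_hnn_rewrite[of \<rho> t r] r \<rho> unfolding conj_of_def by simp
  have "\<mu> \<le> \<nu>" using ends by blast
  then have e: "conj_of \<rho> (a, \<mu>) = \<sigma> (a, \<mu>)" "conj_of \<rho> (a, \<nu>) = \<sigma> (a, \<nu>)" "\<rho> t = \<tau>"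
    using conj \<open>a \<noteq> t\<close> by (auto simp: \<rho>_def)
  show ?thesis
  proof (rule exI[of _ \<rho>], unfold e, intro conjI)
    show "\<forall>w. gens w \<subseteq> {(b, i). b \<noteq> t \<and> (b = a \<longrightarrow> \<mu> \<le> i \<and> i \<le> \<nu>)} \<longrightarrow>
      (word_val perms (conj_of \<rho>) w = id \<longleftrightarrow> consequence {r1} w)"
      using cons' by blast
  qed (use \<rho> \<rho>r pp in \<open>simp_all only: simp_thms\<close>)
qed

section \<open>The Freiheitssatz\<close>

lemma subst_inv_word: "subst f (inv_word w) = inv_word (subst f w)"
proof -
  have app: "subst f (u @ v) = subst f u @ subst f v" for u v by (induction u) auto
  show ?thesis by (induction w) (auto simp: app inv_letter_def)
qed

lemma subst_append: "subst f (u @ v) = subst f u @ subst f v"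
  by (induction u) auto

lemma red_subst: "red (subst f w) = word_val (free_group UNIV) (\<lambda>x. red (f x)) w"
  using group.word_val_subst[OF group_free_group[of UNIV], of free_gen f w] by (simp add: word_val_free_gen)

lemma red_subst_cong: "red u = red v \<Longrightarrow> red (subst f u) = red (subst f v)"
  unfolding red_subst by (rule group.word_val_red_eq[OF group_free_group]) simp_all

lemma conj_words_subst:
  assumes "conj_words u v"
  shows "conj_words (subst f u) (subst f v)"
proof -
  obtain g where "red u = red (g @ v @ inv_word g)" using assms by (auto simp: conj_words_def)
  from red_subst_cong[OF this, of f] show ?thesis
    unfolding conj_words_def by (auto simp: subst_append subst_inv_word)
qed

lemma consequence_subst:
  assumes R0: "\<And>r. r \<in> R0 \<Longrightarrow> reduced r" and R: "\<And>s. s \<in> R \<Longrightarrow> reduced s"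
    and f: "\<And>r. r \<in> R0 \<Longrightarrow> consequence R (subst f r)" and u: "consequence R0 u"
  shows "consequence R (subst f u)"
proof -
  interpret Q: group "presented_group UNIV R" using R by (rule group_presented)
  let ?q = "pres_gen R"
  have q: "?q x \<in> carrier (presented_group UNIV R)" for x using R by (rule pres_gen_closed)
  have iff: "word_val (presented_group UNIV R) ?q w = \<one>\<^bsub>presented_group UNIV R\<^esub> \<longleftrightarrow> consequence R w" for w
    using R by (rule word_val_pres_gen_one)
  have "word_val (presented_group UNIV R) (\<lambda>x. word_val (presented_group UNIV R) ?q (f x)) u
      = \<one>\<^bsub>presented_group UNIV R\<^esub>"
    by (rule Q.consequence_word_val[where R = R0])
      (use q R0 u f iff in \<open>auto simp flip: Q.word_val_subst[OF q]\<close>)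
  then show ?thesis by (simp flip: iff add: Q.word_val_subst[OF q])
qed

lemma consequence_conj_words:
  assumes R: "\<And>s. s \<in> R \<Longrightarrow> reduced s" and "conj_words u v"
  shows "consequence R u \<longleftrightarrow> consequence R v"
proof -
  interpret Q: group "presented_group UNIV R" using R by (rule group_presented)
  have "pres_gen R x \<in> carrier (presented_group UNIV R)" for x using R by (rule pres_gen_closed)
  from Q.conj_words_word_val[of "pres_gen R" u v, OF this assms(2)] show ?thesis
    using R by (simp add: word_val_pres_gen_one)
qed

lemma map_eq_subst: "map (map_prod f id) w = subst (\<lambda>x. [(f x, True)]) w"
  by (induction w) (auto simp: inv_letter_def)

text \<open>The rewritten relator has generators in another type. An injection into \<open>nat\<close> brings it back,
  so that the induction can run over words in a single type.\<close>

lemma magnus_property_transfer: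
  fixes r :: "'a :: countable letter list"
  assumes r: "cyclically_reduced r"
    and IH: "\<And>s :: nat letter list. cyclically_reduced s \<Longrightarrow> length s \<le> length r \<Longrightarrow> magnus_property s"
  shows "magnus_property r"
  unfolding magnus_property_def
proof (intro ballI allI impI)
  fix x u assume x: "x \<in> gens r" "x \<notin> gens u" and u: "consequence {r} u"
  let ?M = "map (map_prod (to_nat :: 'a \<Rightarrow> nat) id)"
  have eq: "map_prod (to_nat :: 'a \<Rightarrow> nat) id l = inv_letter (map_prod to_nat id k) \<longleftrightarrow> l = inv_letter k" for l k
    by (cases l; cases k) (auto simp: inv_letter_def)
  have "reduced (?M r)"
    using r by (simp add: cyclically_reduced_def reduced_def successively_map eq)
  then have "cyclically_reduced (?M r)"
    using r by (auto simp: cyclically_reduced_def hd_map last_map eq)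
  then have "magnus_property (?M r)" using IH by simp
  moreover have "to_nat x \<in> gens (?M r)" using x(1) by force
  moreover have "to_nat x \<notin> gens (?M u)" using x(2) by force
  moreover have "consequence {?M r} (?M u)"
    unfolding map_eq_subst
  proof (rule consequence_subst[OF _ _ _ u])
    have "consequence {subst (\<lambda>x. [(to_nat x, True)]) r} (subst (\<lambda>x. [(to_nat x, True)]) r)"
      using \<open>reduced (?M r)\<close> by (intro consequence_relator) (simp_all add: map_eq_subst)
    then show "consequence {subst (\<lambda>x. [(to_nat x, True)]) r} (subst (\<lambda>x. [(to_nat x, True)]) s)"
      if "s \<in> {r}" for s using that by simp
  qed (use r \<open>reduced (?M r)\<close> in \<open>simp_all add: map_eq_subst cyclically_reduced_reduced\<close>)
  ultimately have "red (?M u) = []" unfolding magnus_property_def by blast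
  then show "red u = []" using red_map_eq_Nil_iff[of "to_nat :: 'a \<Rightarrow> nat"] by simp
qed

text \<open>The word for which a letter of a rewritten word stands.\<close>

definition unrewrite :: "'a \<Rightarrow> 'a \<times> int \<Rightarrow> 'a letter list" where
  "unrewrite t y = gen_power t (snd y) @ [(fst y, True)] @ inv_word (gen_power t (snd y))"

lemma (in group) word_val_unrewrite:
  assumes "\<And>x. \<rho> x \<in> carrier G"
  shows "word_val G \<rho> (subst (unrewrite t) w) = word_val G (conj_val \<rho> t) w"
  using assms
  by (simp add: word_val_subst unrewrite_def word_val_append word_val_inv_word word_val_gen_power
      letter_val_def conj_val_def[abs_def] conj_pow_def m_assoc)

lemma red_unrewrite:
  assumes "esum t w = 0"
  shows "red (subst (unrewrite t) (hnn_rewrite t 0 w)) = red w"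
proof -
  interpret F: group "free_group (UNIV :: 'a set)" by (rule group_free_group)
  show ?thesis
    using F.word_val_unrewrite[of free_gen t "hnn_rewrite t 0 w"] F.word_val_hnn_rewrite[of free_gen t w] assms
    by (simp add: word_val_free_gen)
qed

lemma red_eq_Nil_if_rewrite:
  assumes "esum t w = 0" "red (hnn_rewrite t 0 w) = []"
  shows "red w = []"
  using red_unrewrite[OF assms(1)] red_subst_cong[of "hnn_rewrite t 0 w" "[]" "unrewrite t"] assms(2)
  by simp

text \<open>Together with the counting of letters, this shows that no generator of \<open>w\<close> gets lost when the
  rewritten word is cyclically reduced.\<close>

lemma conj_words_unrewrite:
  assumes "esum t w = 0" "conj_words c (hnn_rewrite t 0 w)"
  shows "conj_words w (subst (unrewrite t) c)"
  using conj_words_trans[OF conj_words_red_eq[OF red_unrewrite[OF assms(1), symmetric]]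
      conj_words_subst[OF conj_words_sym[OF assms(2)]]] .

lemma gens_unrewrite: "gens (subst (unrewrite t) c) \<subseteq> insert t (fst ` gens c)"
proof -
  have "gens (unrewrite t y) \<subseteq> insert t {fst y}" for y :: "'a \<times> int"
    unfolding unrewrite_def set_append image_Un gens_inv_word using gens_gen_power[of t "snd y"] by auto
  then show ?thesis unfolding gens_subst by blast
qed

lemma index_range:
  assumes "(a, i) \<in> gens (r :: ('a \<times> int) letter list)"
  shows "\<exists>\<mu> \<nu>. (a, \<mu>) \<in> gens r \<and> (a, \<nu>) \<in> gens r \<and> (\<forall>i. (a, i) \<in> gens r \<longrightarrow> \<mu> \<le> i \<and> i \<le> \<nu>)"
proof -
  define I where "I = {i. (a, i) \<in> gens r}"
  have "I \<subseteq> snd ` gens r" by (force simp: I_def)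
  then have "finite I" by (rule finite_subset) simp
  moreover have "I \<noteq> {}" using assms by (auto simp: I_def)
  ultimately have "Min I \<in> I" "Max I \<in> I" "\<forall>i\<in>I. Min I \<le> i \<and> i \<le> Max I" by simp_all
  then show ?thesis unfolding I_def by blast
qed

text \<open>The inductive step for a stable letter \<open>t\<close> that differs from the omitted generator \<open>x\<close>. A
  consequence \<open>u\<close> without \<open>x\<close> has exponent sum zero in \<open>t\<close>, since the relator has. Its rewritten
  form is a word without any \<open>(x, i)\<close> and a consequence of the rewritten relator, hence
  trivial.\<close>

lemma freiheitssatz_step_base:
  fixes c :: "'a :: countable letter list"
  assumes c: "cyclically_reduced c" "esum t c = 0" and x: "x \<in> gens c" "x \<noteq> t"
    and IH: "\<And>r :: ('a \<times> int) letter list. cyclically_reduced r \<Longrightarrow>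
      length r \<le> count_letters (\<lambda>l. fst l \<noteq> t) c \<Longrightarrow> magnus_property r"
    and u: "consequence {c} u" "x \<notin> gens u"
  shows "red u = []"
proof -
  obtain r1 where r1: "cyclically_reduced r1" "conj_words r1 (hnn_rewrite t 0 c)"
    using ex_cyclic_reduction by blast
  have mag: "magnus_property r1"
    using IH[OF r1(1)] length_cyclically_reduced[OF r1] by (simp add: length_hnn_rewrite)
  have "x \<in> gens (subst (unrewrite t) r1)"
    using gens_cyclically_reduced[OF c(1) conj_words_unrewrite[OF c(2) r1(2)]] x(1) by blast
  then have "x \<in> fst ` gens r1" using gens_unrewrite[of t r1] x(2) by blast
  then obtain i where "(x, i) \<in> gens r1" by force
  from index_range[OF this] obtain \<mu> \<nu> where ends: "(x, \<mu>) \<in> gens r1" "(x, \<nu>) \<in> gens r1"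
    "\<forall>i. (x, i) \<in> gens r1 \<longrightarrow> \<mu> \<le> i \<and> i \<le> \<nu>"
    by (elim exE conjE)
  from one_relator_rewritten_hnn[OF c(2) r1 mag ends]
  obtain \<rho> :: "'a \<Rightarrow> ('a \<times> int) letter list set \<times> nat \<Rightarrow> ('a \<times> int) letter list set \<times> nat"
    where \<rho>: "\<forall>x. bij (\<rho> x)" "word_val perms \<rho> c = id"
      and cons: "\<forall>w. gens w \<subseteq> {(b, i). b \<noteq> t \<and> (b = x \<longrightarrow> \<mu> \<le> i \<and> i \<le> \<nu>)} \<longrightarrow>
        (word_val perms (\<lambda>y. group.conj_val perms \<rho> t y) w = id \<longleftrightarrow> consequence {r1} w)"
    by (elim exE conjE)
  interpret P: group "perms :: ('w \<Rightarrow> 'w) monoid" by (rule group_perms)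
  have \<rho>': "\<And>x. \<rho> x \<in> carrier perms" using \<rho> by simp
  have red_c: "\<And>r'. r' \<in> {c} \<Longrightarrow> reduced r'" using c(1) by (simp add: cyclically_reduced_reduced)
  have u0: "esum t u = 0"
    by (rule esum_consequence[OF red_c _ u(1)]) (simp_all add: c(2))
  have "word_val perms \<rho> u = \<one>\<^bsub>perms\<^esub>"
    by (rule P.consequence_word_val[OF \<rho>' red_c _ u(1)]) (simp_all add: \<rho>)
  then have "word_val perms (\<lambda>y. P.conj_val \<rho> t y) (hnn_rewrite t 0 u) = id"
    using P.word_val_hnn_rewrite[OF \<rho>' u0] by simp
  moreover have fst_rw: "fst y \<noteq> t \<and> fst y \<noteq> x" if "y \<in> gens (hnn_rewrite t 0 u)" for y
    using gens_hnn_rewrite[OF that] u(2) by auto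
  then have "gens (hnn_rewrite t 0 u) \<subseteq> {(b, i). b \<noteq> t \<and> (b = x \<longrightarrow> \<mu> \<le> i \<and> i \<le> \<nu>)}"
    by fastforce
  ultimately have "consequence {r1} (hnn_rewrite t 0 u)" using cons by blast
  moreover have "(x, \<mu>) \<notin> gens (hnn_rewrite t 0 u)" using fst_rw by fastforce
  ultimately have "red (hnn_rewrite t 0 u) = []"
    using mag ends(1) unfolding magnus_property_def by blast
  then show ?thesis by (rule red_eq_Nil_if_rewrite[OF u0])
qed

lemma (in group) word_val_conj_val_constant:
  assumes \<rho>: "\<And>x. \<rho> x \<in> carrier G" and k: "\<And>y. y \<in> gens w \<Longrightarrow> snd y = k"
  shows "word_val G (conj_val \<rho> t) w = conj_pow (\<rho> t) k (word_val G \<rho> (map (map_prod fst id) w))"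
proof -
  have "word_val G (conj_val \<rho> t) w = word_val G (conj_pow (\<rho> t) k \<circ> (\<rho> \<circ> fst)) w"
    by (rule word_val_cong) (simp add: conj_val_def k)
  also have "\<dots> = conj_pow (\<rho> t) k (word_val G (\<rho> \<circ> fst) w)"
    by (rule word_val_hom[symmetric]) (use \<rho> conj_pow_hom is_group in auto)
  finally show ?thesis by (simp add: word_val_map)
qed

text \<open>The inductive step for the case that the omitted generator is the stable letter. A word \<open>u\<close>
  without \<open>t\<close> turns, up to conjugation by a power of \<open>t\<close>, into the same word in the letters
  \<open>(b, \<mu>)\<close>. The rewritten relator contains a letter with an index other than \<open>\<mu>\<close>: otherwise \<open>c\<close>
  would be conjugate to a word without \<open>t\<close>. So the induction hypothesis applies to \<open>u\<close>.\<close>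

lemma freiheitssatz_step_stable:
  fixes c :: "'a :: countable letter list"
  assumes c: "cyclically_reduced c" "esum t c = 0" and t: "t \<in> gens c"
    and IH: "\<And>r :: ('a \<times> int) letter list. cyclically_reduced r \<Longrightarrow>
      length r \<le> count_letters (\<lambda>l. fst l \<noteq> t) c \<Longrightarrow> magnus_property r"
    and u: "consequence {c} u" "t \<notin> gens u"
  shows "red u = []"
proof -
  interpret F: group "free_group (UNIV :: 'a set)" by (rule group_free_group)
  obtain r1 where r1: "cyclically_reduced r1" "conj_words r1 (hnn_rewrite t 0 c)"
    using ex_cyclic_reduction by blast
  have mag: "magnus_property r1"
    using IH[OF r1(1)] length_cyclically_reduced[OF r1] by (simp add: length_hnn_rewrite)
  have not_t: "fst y \<noteq> t" if "y \<in> gens r1" for y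
    using gens_cyclically_reduced[OF r1] gens_hnn_rewrite[of y t 0 c] that by blast
  \<comment> \<open>if \<open>k\<close> were the only index, \<open>c\<close> would be conjugate by \<open>t\<^sup>k\<close> to a word without \<open>t\<close>\<close>
  have two: "\<exists>y\<in>gens r1. snd y \<noteq> k" for k
  proof (rule ccontr)
    assume "\<not> ?thesis"
    then have k: "\<And>y. y \<in> gens r1 \<Longrightarrow> snd y = k" by blast
    let ?v = "map (map_prod fst id) r1"
    have "red (subst (unrewrite t) r1) = word_val (free_group UNIV) free_gen
        (gen_power t k @ ?v @ inv_word (gen_power t k))"
      using F.word_val_unrewrite[of free_gen t r1]
        F.word_val_conj_val_constant[of free_gen r1 k t] k
      by (simp add: word_val_free_gen F.word_val_append F.word_val_inv_word F.word_val_gen_power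
          F.conj_pow_def F.m_assoc del: word_val_free_gen flip: word_val_free_gen)
    then have "conj_words (subst (unrewrite t) r1) ?v"
      unfolding conj_words_def word_val_free_gen by blast
    then have "conj_words c ?v"
      by (rule conj_words_trans[OF conj_words_unrewrite[OF c(2) r1(2)]])
    from gens_cyclically_reduced[OF c(1) this] t have "t \<in> gens ?v" by blast
    then show False using not_t by force
  qed
  obtain a i where "(a, i) \<in> gens r1" using two by fastforce
  from index_range[OF this] obtain \<mu> \<nu> where ends: "(a, \<mu>) \<in> gens r1" "(a, \<nu>) \<in> gens r1"
    "\<forall>i. (a, i) \<in> gens r1 \<longrightarrow> \<mu> \<le> i \<and> i \<le> \<nu>"
    by (elim exE conjE)
  obtain y where y: "y \<in> gens r1" "snd y \<noteq> \<mu>" using two by blast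
  from one_relator_rewritten_hnn[OF c(2) r1 mag ends]
  obtain \<rho> :: "'a \<Rightarrow> ('a \<times> int) letter list set \<times> nat \<Rightarrow> ('a \<times> int) letter list set \<times> nat"
    where \<rho>: "\<forall>x. bij (\<rho> x)" "word_val perms \<rho> c = id"
      and cons: "\<forall>w. gens w \<subseteq> {(b, i). b \<noteq> t \<and> (b = a \<longrightarrow> \<mu> \<le> i \<and> i \<le> \<nu>)} \<longrightarrow>
        (word_val perms (\<lambda>y. group.conj_val perms \<rho> t y) w = id \<longleftrightarrow> consequence {r1} w)"
    by (elim exE conjE)
  interpret P: group "perms :: ('w \<Rightarrow> 'w) monoid" by (rule group_perms)
  have \<rho>': "\<And>x. \<rho> x \<in> carrier perms" using \<rho> by simp
  have red_c: "\<And>r'. r' \<in> {c} \<Longrightarrow> reduced r'" using c(1) by (simp add: cyclically_reduced_reduced)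
  have \<rho>u: "word_val perms \<rho> u = \<one>\<^bsub>perms\<^esub>"
    by (rule P.consequence_word_val[OF \<rho>' red_c _ u(1)]) (simp_all add: \<rho>)
  let ?u = "map (map_prod (\<lambda>b. (b, \<mu>)) id) u"
  have fst_u: "map (map_prod fst id) ?u = u" by (simp add: map_idI prod.map_comp o_def)
  have gens_u: "gens ?u = (\<lambda>b. (b, \<mu>)) ` gens u" by (simp add: image_image)
  have snd_u: "\<And>y. y \<in> gens ?u \<Longrightarrow> snd y = \<mu>" unfolding gens_u by auto
  have "word_val perms (P.conj_val \<rho> t) ?u = P.conj_pow (\<rho> t) \<mu> (word_val perms \<rho> u)"
    using P.word_val_conj_val_constant[of \<rho> ?u \<mu> t, OF \<rho>' snd_u] unfolding fst_u .
  also have "\<dots> = id" using \<rho>u P.conj_pow_one[OF \<rho>'] by simp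
  finally have "word_val perms (\<lambda>y. P.conj_val \<rho> t y) ?u = id" .
  moreover have "gens ?u \<subseteq> {(b, i). b \<noteq> t \<and> (b = a \<longrightarrow> \<mu> \<le> i \<and> i \<le> \<nu>)}"
    using u(2) ends unfolding gens_u by blast
  ultimately have "consequence {r1} ?u" using cons by blast
  moreover have "y \<notin> gens ?u" using y(2) unfolding gens_u by auto
  ultimately have "red ?u = []"
    using mag y(1) unfolding magnus_property_def by blast
  then show ?thesis using red_map_eq_Nil_iff[of "\<lambda>b. (b, \<mu>)" u] by (simp add: inj_def)
qed

lemma (in group) word_val_trivial:
  "(\<And>x. x \<in> gens w \<Longrightarrow> \<rho> x = \<one>) \<Longrightarrow> word_val G \<rho> w = \<one>"
  by (induction w) (auto simp: letter_val_def)

lemma inv_gen_power: "inv_word (gen_power x k) = replicate (nat \<bar>k\<bar>) (x, \<not> k \<ge> 0)"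
  by (simp add: gen_power_def inv_word_def inv_letter_def)

lemma reduced_replicate: "reduced (replicate n l)"
  by (induction n) (auto simp: reduced_Cons inv_letter_def prod_eq_iff hd_replicate)

text \<open>Raising the generators to non-zero powers is an injective substitution: the image of a reduced
  word needs no reduction. For the induction the first letter of the image has to be known.\<close>

lemma reduced_subst_gen_power:
  assumes "reduced w" "\<And>y. y \<in> gens w \<Longrightarrow> k y \<noteq> 0"
  shows "reduced (subst (\<lambda>y. gen_power y (k y)) w) \<and>
    (w \<noteq> [] \<longrightarrow> subst (\<lambda>y. gen_power y (k y)) w \<noteq> [] \<and>
      hd (subst (\<lambda>y. gen_power y (k y)) w) = (fst (hd w), snd (hd w) \<longleftrightarrow> k (fst (hd w)) \<ge> 0))"
  using assms
proof (induction w)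
  case (Cons l w)
  let ?s = "subst (\<lambda>y. gen_power y (k y))"
  let ?l = "(fst l, snd l \<longleftrightarrow> k (fst l) \<ge> 0)" and ?n = "nat \<bar>k (fst l)\<bar>"
  have block: "?s (l # w) = replicate ?n ?l @ ?s w"
    by (simp add: inv_gen_power) (simp add: gen_power_def)
  have n: "?n \<noteq> 0" using Cons.prems(2)[of "fst l"] by simp
  have IH: "reduced (?s w)" "w \<noteq> [] \<Longrightarrow> ?s w \<noteq> []"
    "w \<noteq> [] \<Longrightarrow> hd (?s w) = (fst (hd w), snd (hd w) \<longleftrightarrow> k (fst (hd w)) \<ge> 0)"
    using Cons by (auto simp: reduced_Cons)
  have "?s w \<noteq> [] \<Longrightarrow> hd (?s w) \<noteq> inv_letter ?l"
    using IH(3) Cons.prems(1) by (cases "w = []") (auto simp: reduced_Cons inv_letter_def prod_eq_iff)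
  then have "reduced (?s (l # w))"
    unfolding block reduced_append using IH(1) n by (simp add: reduced_replicate last_replicate)
  moreover have "?s (l # w) \<noteq> []" "hd (?s (l # w)) = ?l"
    using n unfolding block by (simp_all add: hd_append hd_replicate)
  ultimately show ?case by simp
qed simp

lemma red_subst_gen_power_Nil:
  assumes "red (subst (\<lambda>y. gen_power y (k y)) u) = []" "\<And>y. y \<in> gens u \<Longrightarrow> k y \<noteq> 0"
  shows "red u = []"
proof (rule ccontr)
  assume "red u \<noteq> []"
  moreover have "\<And>y. y \<in> gens (red u) \<Longrightarrow> k y \<noteq> 0" using assms(2) gens_red[of u] by blast
  ultimately have "reduced (subst (\<lambda>y. gen_power y (k y)) (red u))"
      "subst (\<lambda>y. gen_power y (k y)) (red u) \<noteq> []"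
    using reduced_subst_gen_power[of "red u" k] by simp_all
  moreover have "red (subst (\<lambda>y. gen_power y (k y)) (red u)) = []"
    by (rule trans[OF red_subst_cong[of "red u" u, OF red_red_eq] assms(1)])
  ultimately show False by (simp add: red_reduced)
qed

lemma count_letters_inv_word:
  "(\<And>l. P (inv_letter l) = P l) \<Longrightarrow> count_letters P (inv_word w) = count_letters P w"
  by (induction w) auto

text \<open>If neither the omitted generator \<open>x\<close> nor another generator \<open>t\<close> of the relator has exponent
  sum zero, say the sums are \<open>\<alpha>\<close> and \<open>\<beta>\<close>, then the substitution \<open>x \<mapsto> xt\<^sup>-\<^sup>\<beta>\<close>, \<open>t \<mapsto> t\<^sup>\<alpha>\<close>
  makes the exponent sum of \<open>t\<close> vanish. It is injective on words without \<open>x\<close>, keeps the exponent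
  sum \<open>\<alpha>\<close> of \<open>x\<close>, and introduces only letters \<open>t\<close>. These do not count, because rewriting
  removes them: the induction hypothesis is applied to a relator whose length is the number of
  letters other than \<open>t\<close>.\<close>

lemma magnus_property_nat: "cyclically_reduced (r :: nat letter list) \<Longrightarrow> magnus_property r"
proof (induction "length r" arbitrary: r rule: less_induct)
  case less
  have c: "cyclically_reduced r" by (rule less.prems)
  have rr: "reduced r" using c by (rule cyclically_reduced_reduced)
  have IH: "magnus_property s" if "cyclically_reduced s" "length s < length r" for s :: "(nat \<times> int) letter list"
    using magnus_property_transfer[OF that(1)] less.hyps that(2) by simp
  show ?case
    unfolding magnus_property_def
  proof (intro ballI allI impI)
    fix x u assume x: "x \<in> gens r" "x \<notin> gens u" and u: "consequence {r} u"
    interpret F: group "free_group (UNIV :: nat set)" by (rule group_free_group)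
    show "red u = []"
    proof (cases "gens r = {x}")
      case True
      \<comment> \<open>the relator is a power of \<open>x\<close>, and killing \<open>x\<close> leaves the other generators free\<close>
      let ?\<rho> = "\<lambda>y. if y = x then \<one>\<^bsub>free_group UNIV\<^esub> else free_gen y"
      have \<rho>: "?\<rho> y \<in> carrier (free_group UNIV)" for y by simp
      have "word_val (free_group UNIV) ?\<rho> r = \<one>\<^bsub>free_group UNIV\<^esub>"
        by (rule F.word_val_trivial) (simp add: True)
      then have "word_val (free_group UNIV) ?\<rho> u = \<one>\<^bsub>free_group UNIV\<^esub>"
        by (intro F.consequence_word_val[OF \<rho> _ _ u]) (simp_all add: rr)
      also have "word_val (free_group UNIV) ?\<rho> u = word_val (free_group UNIV) free_gen u"
      proof (rule word_val_cong)
        fix y assume "y \<in> gens u"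
        then have "y \<noteq> x" using x(2) by blast
        then show "?\<rho> y = free_gen y" by simp
      qed
      finally show ?thesis by (simp add: word_val_free_gen) (simp add: free_group_def)
    next
      case False
      then obtain t where t: "t \<in> gens r" "t \<noteq> x" using x by blast
      have less_count: "count_letters (\<lambda>l. fst l \<noteq> s) r < length r" if "s \<in> gens r" for s
        using that unfolding count_letters_def
        by (metis (mono_tags, lifting) imageE length_filter_less)
      have IHc: "magnus_property s" if "cyclically_reduced s" "length s \<le> count_letters (\<lambda>l. fst l \<noteq> y) r"
        "y \<in> gens r" for s :: "(nat \<times> int) letter list" and y
        using IH[OF that(1)] less_count[OF that(3)] that(2) by simp
      define \<alpha> \<beta> where "\<alpha> = esum x r" and "\<beta> = esum t r"
      consider "\<beta> = 0" | "\<alpha> = 0" | "\<alpha> \<noteq> 0" "\<beta> \<noteq> 0" by blast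
      then show ?thesis
      proof cases
        case 1
        show ?thesis
          by (rule freiheitssatz_step_base[OF c _ x(1) _ _ u x(2), of t]) (use 1 t IHc in \<open>auto simp: \<beta>_def\<close>)
      next
        case 2
        show ?thesis
          by (rule freiheitssatz_step_stable[OF c _ x(1) _ u x(2)]) (use 2 x IHc in \<open>auto simp: \<alpha>_def\<close>)
      next
        case 3
        \<comment> \<open>one formula for \<open>t \<mapsto> t\<^sup>\<alpha>\<close> and for the other generators, so that on words without \<open>x\<close> it is a substitution of powers\<close>
        let ?f = "\<lambda>y. if y = x then (x, True) # gen_power t (- \<beta>)
          else gen_power y (if y = t then \<alpha> else 1)"
        have esums: "esum t (subst ?f w) = \<alpha> * esum t w - \<beta> * esum x w"
          "esum x (subst ?f w) = esum x w" for w
          using t by (induction w) (auto simp: algebra_simps inv_letter_def)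
        have cnt_inv: "count_letters (\<lambda>l. fst l \<noteq> t) (inv_word w) = count_letters (\<lambda>l. fst l \<noteq> t) w"
          for w :: "nat letter list"
          by (rule count_letters_inv_word) simp
        have cnt_pow: "count_letters (\<lambda>l. fst l \<noteq> t) (gen_power y k) = (if y = t then 0 else nat \<bar>k\<bar>)" for y k
          by (simp add: gen_power_def count_letters_def)
        have cnt: "count_letters (\<lambda>l. fst l \<noteq> t) (subst ?f w) = count_letters (\<lambda>l. fst l \<noteq> t) w" for w
        proof (induction w)
          case (Cons l w)
          have "count_letters (\<lambda>l. fst l \<noteq> t) (if snd l then ?f (fst l) else inv_word (?f (fst l)))
            = count_letters (\<lambda>l. fst l \<noteq> t) (?f (fst l))"
            by (simp only: cnt_inv if_distrib[of "count_letters _"] if_cancel)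
          also have "\<dots> = (if fst l \<noteq> t then 1 else 0)"
            using t by (auto simp: cnt_pow)
          finally show ?case using Cons by simp
        qed simp
        obtain d where d: "cyclically_reduced d" "conj_words d (subst ?f r)"
          using ex_cyclic_reduction by blast
        have "esum t d = 0" "esum x d \<noteq> 0"
          using esum_conj_words[OF d(2)] 3(1) esums[of r] by (simp_all add: \<alpha>_def \<beta>_def)
        then have xd: "x \<in> gens d" using esum_zero_if_no_gen[of x d] by blast
        have cnt_d: "count_letters (\<lambda>l. fst l \<noteq> t) d \<le> count_letters (\<lambda>l. fst l \<noteq> t) r"
          using count_letters_cyclically_reduced[OF d, of "\<lambda>l. fst l \<noteq> t"] cnt by simp
        have red_d: "\<And>s. s \<in> {d} \<Longrightarrow> reduced s" using d(1) by (simp add: cyclically_reduced_reduced)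
        have cons_r: "consequence {d} (subst ?f r)"
          using consequence_conj_words[where R = "{d}", OF red_d d(2)] consequence_relator[of d "{d}"] red_d by simp
        have cons_u: "consequence {d} (subst ?f u)"
          by (rule consequence_subst[OF _ red_d _ u]) (use rr cons_r in simp_all)
        have subst_u: "subst ?f u = subst (\<lambda>y. gen_power y (if y = t then \<alpha> else 1)) u"
          unfolding subst_def using x(2) by (intro arg_cong[of _ _ concat] map_cong refl) force
        have x_u: "x \<notin> gens (subst ?f u)"
        proof
          assume "x \<in> gens (subst ?f u)"
          then obtain y where "y \<in> gens u" "x \<in> gens (gen_power y (if y = t then \<alpha> else 1))"
            unfolding subst_u gens_subst by blast
          moreover from this(2) have "x \<in> {y}" by (rule subsetD[OF gens_gen_power])
          ultimately show False using x(2) by simp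
        qed
        have "magnus_property s" if "cyclically_reduced s" "length s \<le> count_letters (\<lambda>l. fst l \<noteq> t) d"
          for s :: "(nat \<times> int) letter list"
          using IHc[OF that(1) _ t(1)] that(2) cnt_d by simp
        from freiheitssatz_step_base[OF d(1) \<open>esum t d = 0\<close> xd t(2)[symmetric] this cons_u x_u]
        have "red (subst ?f u) = []" .
        then show ?thesis
          unfolding subst_u by (rule red_subst_gen_power_Nil) (use 3 in auto)
      qed
    qed
  qed
qed

theorem freiheitssatz:
  fixes r :: "'a :: countable letter list"
  assumes "cyclically_reduced r" "x \<in> gens r" "x \<notin> gens u" "consequence {r} u"
  shows "red u = []"
  using magnus_property_transfer[OF assms(1) magnus_property_nat] assms unfolding magnus_property_def by blast

section \<open>Free subgroups\<close>

text \<open>The two elements are the basis required by \<open>is_free\<close>; they are distinct and do not commute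
  because suitable words of length two and four have non-trivial values.\<close>

lemma (in group) nonabelian_free_subgroupI:
  fixes \<rho> :: "bool \<Rightarrow> 'a"
  assumes \<rho>: "\<And>b. \<rho> b \<in> carrier G"
    and free: "\<And>w. reduced w \<Longrightarrow> w \<noteq> [] \<Longrightarrow> word_val G \<rho> w \<noteq> \<one>\<^bsub>G\<^esub>"
  shows "has_nonabelian_free_subgroup G"
proof -
  have inj: "inj \<rho>"
  proof (rule injI, rule ccontr)
    fix b c assume bc: "\<rho> b = \<rho> c" "b \<noteq> c"
    then have "word_val G \<rho> [(b, True), (c, False)] = \<one>" using \<rho> by (simp add: letter_val_def)
    then show False using free[of "[(b, True), (c, False)]"] bc by (simp add: reduced_Cons inv_letter_def)
  qed
  define X where "X = range \<rho>"
  define \<iota> where "\<iota> x = (if x \<in> X then x else \<one>)" for x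
  let ?F = "free_group X" and ?h = "word_val G \<iota>"
  have \<iota>: "\<iota> x \<in> carrier G" for x using \<rho> by (auto simp: \<iota>_def X_def)
  interpret h: group_hom ?F G ?h
    using \<iota> by (auto simp: group_hom_def group_hom_axioms_def group_free_group is_group
        intro: word_val_free_hom)
  have map: "word_val G \<iota> (map (map_prod \<rho> id) v) = word_val G \<rho> v" for v
  proof -
    have "\<iota> \<circ> \<rho> = \<rho>" by (auto simp: \<iota>_def X_def)
    then show ?thesis by (simp add: word_val_map)
  qed
  have "inj_on ?h (carrier ?F)"
    unfolding h.inj_on_one_iff
  proof (intro allI impI)
    fix w assume w: "w \<in> carrier ?F" "?h w = \<one>"
    define v where "v = map (map_prod (inv_into UNIV \<rho>) id) w"
    have wv: "w = map (map_prod \<rho> id) v"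
      unfolding v_def map_map
      by (rule map_idI[symmetric])
        (use w(1) in \<open>force simp: free_group_def X_def f_inv_into_f\<close>)
    have eq: "map_prod \<rho> id l = inv_letter (map_prod \<rho> id k) \<longleftrightarrow> l = inv_letter k" for l k
      using inj by (cases l; cases k) (auto simp: inv_letter_def inj_eq)
    have "reduced v"
      using w(1) by (simp add: wv free_group_def reduced_def successively_map eq)
    then have "v = []" using free[of v] w(2) map[of v] wv by auto
    then show "w = \<one>\<^bsub>?F\<^esub>" by (simp add: wv free_group_def)
  qed
  moreover define H where "H = ?h ` carrier ?F"
  ultimately have "?h \<in> iso ?F (G\<lparr>carrier := H\<rparr>)"
    by (auto simp: iso_def hom_def bij_betw_def h.hom_mult)
  then have "is_free (G\<lparr>carrier := H\<rparr>)" unfolding is_free_def is_iso_def by blast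
  moreover have "subgroup H G" unfolding H_def by (rule h.img_is_subgroup)
  moreover have "\<not> comm_group (G\<lparr>carrier := H\<rparr>)"
  proof
    assume "comm_group (G\<lparr>carrier := H\<rparr>)"
    then interpret C: comm_group "G\<lparr>carrier := H\<rparr>" .
    have "\<rho> b \<in> H" for b
    proof -
      have "free_gen (\<rho> b) \<in> carrier ?F" by (simp add: free_group_def free_gen_def reduced_Cons X_def)
      moreover have "?h (free_gen (\<rho> b)) = \<rho> b"
        using \<rho> by (simp add: free_gen_def letter_val_def \<iota>_def X_def)
      ultimately show ?thesis unfolding H_def by force
    qed
    then have "\<rho> True \<otimes> \<rho> False = \<rho> False \<otimes> \<rho> True" using C.m_comm by simp
    then have "\<rho> True \<otimes> (\<rho> False \<otimes> (inv \<rho> True \<otimes> inv \<rho> False)) = \<one>"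
      using \<rho> by (simp add: m_assoc[symmetric]) (simp add: m_assoc)
    then have "word_val G \<rho> [(True, True), (False, True), (True, False), (False, False)] = \<one>"
      using \<rho> by (simp add: letter_val_def)
    then show False
      using free[of "[(True, True), (False, True), (True, False), (False, False)]"]
      by (simp add: reduced_Cons inv_letter_def)
  qed
  ultimately show ?thesis unfolding has_nonabelian_free_subgroup_def by blast
qed

text \<open>Freeness of two elements is inherited from a quotient, here the image of a representation.\<close>

lemma nonabelian_free_subgroup_via_image:
  fixes u :: "bool \<Rightarrow> 'a letter list" and K :: "('k, 'm) monoid_scheme"
  assumes R: "\<And>r. r \<in> R \<Longrightarrow> reduced r" and K: "group K" and \<rho>: "\<And>x. \<rho> x \<in> carrier K"
    and kill: "\<And>r. r \<in> R \<Longrightarrow> word_val K \<rho> r = \<one>\<^bsub>K\<^esub>"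
    and free: "\<And>w. reduced w \<Longrightarrow> w \<noteq> [] \<Longrightarrow> word_val K (\<lambda>b. word_val K \<rho> (u b)) w \<noteq> \<one>\<^bsub>K\<^esub>"
  shows "has_nonabelian_free_subgroup (presented_group UNIV R)"
proof -
  interpret Q: group "presented_group UNIV R" using R by (rule group_presented)
  interpret K: group K by fact
  let ?Q = "presented_group UNIV R" and ?q = "pres_gen R"
  have q: "?q x \<in> carrier ?Q" for x using R by (rule pres_gen_closed)
  show ?thesis
  proof (rule Q.nonabelian_free_subgroupI[of "\<lambda>b. word_val ?Q ?q (u b)"])
    show "word_val ?Q ?q (u b) \<in> carrier ?Q" for b using q by simp
    fix w :: "bool letter list" assume w: "reduced w" "w \<noteq> []"
    show "word_val ?Q (\<lambda>b. word_val ?Q ?q (u b)) w \<noteq> \<one>\<^bsub>?Q\<^esub>"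
    proof
      assume "word_val ?Q (\<lambda>b. word_val ?Q ?q (u b)) w = \<one>\<^bsub>?Q\<^esub>"
      then have "word_val ?Q ?q (subst u w) = \<one>\<^bsub>?Q\<^esub>" by (simp add: Q.word_val_subst[OF q])
      then have cons: "consequence R (subst u w)" using R by (simp add: consequenceI)
      have "word_val K \<rho> (subst u w) = \<one>\<^bsub>K\<^esub>"
        by (rule K.consequence_word_val[OF \<rho> _ _ cons]) (simp_all add: R kill)
      then show False using free[OF w] by (simp add: K.word_val_subst[OF \<rho>])
    qed
  qed
qed

section \<open>Isomorphisms between presented groups\<close>

lemma subst_subst: "subst g (subst f w) = subst (\<lambda>x. subst g (f x)) w"
  by (induction w) (auto simp: subst_append subst_inv_word)

lemma red_subst_id:
  assumes "\<And>x. red (f x) = [(x, True)]"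
  shows "red (subst f w) = red w"
proof -
  have "(\<lambda>x. red (f x)) = free_gen" using assms by (auto simp: free_gen_def)
  then show ?thesis by (simp add: red_subst word_val_free_gen)
qed

lemma consequence_red_eq: "red u = red v \<Longrightarrow> consequence R u \<longleftrightarrow> consequence R v"
  by (simp add: consequence_def)

text \<open>The substitution \<open>f\<close> induces a homomorphism of the free group onto the second group. The
  substitution \<open>g\<close> shows that its kernel is no larger than the normal closure of \<open>R\<close>.\<close>

lemma presented_group_iso:
  fixes R :: "'a letter list set" and S :: "'b letter list set"
  assumes R: "\<And>r. r \<in> R \<Longrightarrow> reduced r" and S: "\<And>s. s \<in> S \<Longrightarrow> reduced s"
    and f: "\<And>r. r \<in> R \<Longrightarrow> consequence S (subst f r)"
    and g: "\<And>s. s \<in> S \<Longrightarrow> consequence R (subst g s)"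
    and gf: "\<And>x. red (subst g (f x)) = [(x, True)]" and fg: "\<And>y. red (subst f (g y)) = [(y, True)]"
  shows "presented_group UNIV R \<cong> presented_group UNIV S"
proof -
  interpret Q: group "presented_group UNIV S" using S by (rule group_presented)
  let ?Q = "presented_group UNIV S" and ?q = "pres_gen S" and ?F = "free_group (UNIV :: 'a set)"
  have q: "?q x \<in> carrier ?Q" for x using S by (rule pres_gen_closed)
  have one: "word_val ?Q ?q w = \<one>\<^bsub>?Q\<^esub> \<longleftrightarrow> consequence S w" for w
    using S by (rule word_val_pres_gen_one)
  let ?h = "word_val ?Q (\<lambda>x. word_val ?Q ?q (f x))"
  have h: "?h w = word_val ?Q ?q (subst f w)" for w by (simp add: Q.word_val_subst[OF q])
  interpret h: group_hom ?F ?Q ?h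
    using q by (auto simp: group_hom_def group_hom_axioms_def group_free_group Q.is_group
        intro: Q.word_val_free_hom)
  have iff: "consequence S (subst f w) \<longleftrightarrow> consequence R w" for w
  proof
    assume cons: "consequence S (subst f w)"
    have "consequence R (subst g (subst f w))"
      by (rule consequence_subst[OF _ _ _ cons]) (simp_all add: R S g)
    then show "consequence R w"
      using consequence_red_eq[of "subst g (subst f w)" w R] gf by (simp add: subst_subst red_subst_id)
  next
    assume cons: "consequence R w"
    show "consequence S (subst f w)"
      by (rule consequence_subst[OF _ _ _ cons]) (simp_all add: R S f)
  qed
  have "kernel ?F ?Q ?h = normal_closure ?F R"
  proof
    show "kernel ?F ?Q ?h \<subseteq> normal_closure ?F R"
    proof
      fix w assume "w \<in> kernel ?F ?Q ?h"
      then have "reduced w" "consequence R w" by (auto simp: kernel_def h one iff carrier_free_UNIV)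
      then show "w \<in> normal_closure ?F R" by (simp add: consequence_def red_reduced)
    qed
    show "normal_closure ?F R \<subseteq> kernel ?F ?Q ?h"
    proof (rule normal_closure_least[OF h.normal_kernel])
      show "R \<subseteq> kernel ?F ?Q ?h"
        using R f by (auto simp: kernel_def h one carrier_free_UNIV)
    qed
  qed
  moreover have "?h ` carrier ?F = carrier ?Q"
  proof
    show "?h ` carrier ?F \<subseteq> carrier ?Q" using h.hom_closed by blast
    show "carrier ?Q \<subseteq> ?h ` carrier ?F"
    proof
      fix k assume "k \<in> carrier ?Q"
      then obtain v where v: "k = word_val ?Q ?q v"
        by (rule presented_elem[OF S, rotated])
      have "?h (red (subst g v)) = word_val ?Q (\<lambda>x. word_val ?Q ?q (f x)) (subst g v)"
        using q by (simp add: Q.word_val_red)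
      also have "\<dots> = word_val ?Q ?q (subst f (subst g v))"
        by (simp add: Q.word_val_subst[OF q])
      also have "\<dots> = k"
        unfolding v by (rule Q.word_val_red_eq[OF q]) (simp add: subst_subst red_subst_id fg)
      finally show "k \<in> ?h ` carrier ?F" by (metis imageI red_closed)
    qed
  qed
  then have "?F Mod kernel ?F ?Q ?h \<cong> ?Q" by (rule h.FactGroup_iso)
  ultimately show ?thesis unfolding presented_group_def by simp
qed

section \<open>Non-orientable presentations have one relator\<close>

instance bs_gen :: countable by countable_datatype

text \<open>A word equal to its formal inverse would have a letter that is inverse to itself or to its
  neighbour in the middle.\<close>

lemma inv_word_fixpoint_free:
  "reduced y \<Longrightarrow> inv_word y = y \<Longrightarrow> y = []"
proof (induction y rule: length_induct)
  case (1 y)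
  show ?case
  proof (cases y)
    case (Cons l z)
    have "z \<noteq> []" using 1(3) Cons by (auto simp: inv_letter_def prod_eq_iff)
    then obtain z' k where z: "z = z' @ [k]" by (cases z rule: rev_cases) auto
    have k: "k = inv_letter l" and z': "inv_word z' = z'" using 1(3) by (auto simp: Cons z)
    have "reduced z'" using 1(2) by (auto simp: Cons z reduced_Cons reduced_append)
    then have "z' = []" using 1(1) z' by (auto simp: Cons z)
    then show ?thesis using 1(2) by (simp add: Cons z k reduced_Cons)
  qed simp
qed

lemma conj_words_commute: "conj_words (u @ v) (v @ u)"
proof -
  have "red (u @ (v @ u) @ inv_word u) = red ((u @ v) @ u @ inv_word u)" by simp
  also have "\<dots> = red ((u @ v) @ [])" by (rule red_cong_append) (simp_all only: red_eq_Nil_self red_Nil)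
  finally have "red (u @ v) = red (u @ (v @ u) @ inv_word u)" by simp
  then show ?thesis unfolding conj_words_def by blast
qed

lemma conj_words_rotate: "conj_words (rotate k u) u"
  using conj_words_commute[of "drop (k mod length u) u" "take (k mod length u) u"]
  by (simp add: rotate_drop_take)

text \<open>If \<open>w = zy\<close> and \<open>w\<inverse> = yz\<close>, comparison of lengths in \<open>y\<inverse>z\<inverse> = yz\<close> shows that \<open>y\<close> and \<open>z\<close> are
  equal to their inverses.\<close>

lemma not_cyclic_perm_inv_word:
  assumes "cyclically_reduced w" "w \<noteq> []"
  shows "\<not> cyclic_perm w (inv_word w)"
proof
  assume "cyclic_perm w (inv_word w)"
  then obtain k where "w = rotate k (inv_word w)" unfolding cyclic_perm_def by blast
  then obtain y z where yz: "inv_word w = y @ z" "w = z @ y"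
    unfolding rotate_drop_take by (metis append_take_drop_id)
  then have "inv_word y @ inv_word z = y @ z" by simp
  then have "inv_word y = y" "inv_word z = z" by (simp_all add: append_eq_append_conv)
  moreover have "reduced y" "reduced z"
    using assms(1) by (simp_all add: yz(2) cyclically_reduced_def reduced_append)
  ultimately have "y = []" "z = []" using inv_word_fixpoint_free by blast+
  then show False using assms(2) yz by simp
qed

lemma esum_shift: "esum x (shift w) = esum (swap_gen x) w"
proof -
  have "swap_gen y = x \<longleftrightarrow> y = swap_gen x" for y by (cases x; cases y) auto
  then show ?thesis by (induction w) (auto simp: shift_def)
qed

text \<open>Since \<open>w\<close> is not a cyclic permutation of its own inverse, it is one of \<open>\<theta>(w)\<inverse>\<close>, hence conjugate
  to it. Comparing the exponent sums of \<open>x\<^sub>0\<close> on both sides gives the second statement.\<close>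

lemma non_orientable:
  assumes w: "cyclically_reduced w" "w \<noteq> []" and "\<not> orientable w"
  shows "consequence {w} (shift w)" "esum X0 w + esum X1 w = 0"
proof -
  have "cyclic_perm w (inv_word (shift w))"
    using assms not_cyclic_perm_inv_word[OF w] by (auto simp: orientable_def)
  then have conj: "conj_words w (inv_word (shift w))"
    unfolding cyclic_perm_def by (metis conj_words_rotate)
  have red: "\<And>s. s \<in> {w} \<Longrightarrow> reduced s" using w(1) by (simp add: cyclically_reduced_reduced)
  have "consequence {w} (inv_word (shift w))"
    using consequence_conj_words[where R = "{w}", OF red conj] consequence_relator[of w "{w}"] red by simp
  then show "consequence {w} (shift w)"
  proof -
    assume cons: "consequence {w} (inv_word (shift w))"
    interpret Q: group "presented_group UNIV {w}" using red by (rule group_presented)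
    have q: "pres_gen {w} x \<in> carrier (presented_group UNIV {w})" for x using red by (rule pres_gen_closed)
    have one: "word_val (presented_group UNIV {w}) (pres_gen {w}) v = \<one>\<^bsub>presented_group UNIV {w}\<^esub>
        \<longleftrightarrow> consequence {w} v" for v
      using red by (rule word_val_pres_gen_one)
    show ?thesis
      using cons unfolding one[symmetric] Q.word_val_inv_word[of "pres_gen {w}", OF q]
      using q by simp
  qed
  show "esum X0 w + esum X1 w = 0"
    using esum_conj_words[OF conj, of X0] by (simp add: esum_shift)
qed

section \<open>Comparison with the Baumslag--Solitar presentation\<close>

lemma (in group) word_val_bs_relator:
  assumes \<rho>: "\<And>x. \<rho> x \<in> carrier G"
  shows "word_val G \<rho> (bs_relator m) = \<one> \<longleftrightarrow> conj_pow (\<rho> T) 1 (\<rho> A) = \<rho> A [^] m"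
proof -
  interpret F: group "free_group (UNIV :: bs_gen set)" by (rule group_free_group)
  interpret h: group_hom "free_group (UNIV :: bs_gen set)" G "word_val G \<rho>"
    using \<rho> by (auto simp: group_hom_def group_hom_axioms_def group_free_group is_group
        intro: word_val_free_hom)
  have gen: "word_val G \<rho> (free_gen x) = \<rho> x" for x
    using \<rho> by (simp add: free_gen_def letter_val_def)
  have "word_val G \<rho> (bs_relator m) = \<rho> T \<otimes> \<rho> A \<otimes> inv \<rho> T \<otimes> inv (\<rho> A [^] m)"
    unfolding bs_relator_def Let_def by (simp add: gen h.hom_int_pow h.hom_mult)
  also have "\<rho> T \<otimes> \<rho> A \<otimes> inv \<rho> T = conj_pow (\<rho> T) 1 (\<rho> A)"
    using \<rho> by (simp add: conj_pow_def)
  moreover have "x \<otimes> inv y = \<one> \<longleftrightarrow> x = y" if "x \<in> carrier G" "y \<in> carrier G" for x y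
    using that by (metis inv_closed inv_equality inv_inv r_inv)
  ultimately show ?thesis using \<rho> by simp
qed

lemma reduced_bs_relator: "reduced (bs_relator m)"
proof -
  interpret F: group "free_group (UNIV :: bs_gen set)" by (rule group_free_group)
  have "bs_relator m \<in> carrier (free_group UNIV)" unfolding bs_relator_def Let_def by simp
  then show ?thesis by (simp add: carrier_free_UNIV)
qed

text \<open>The change of basis \<open>x\<^sub>0 = t\<close>, \<open>x\<^sub>1 = at\<close> between the generators of the cyclic presentation and
  those of \<open>BS(1, m)\<close>. With \<open>e = False\<close> the generator \<open>T\<close> corresponds to \<open>t\<inverse>\<close> instead of \<open>t\<close>,
  for the case that \<open>t\<inverse>at\<close> and not \<open>tat\<inverse>\<close> is a power of \<open>a\<close>.\<close>

primrec bs_word :: "bool \<Rightarrow> gen2 \<Rightarrow> bs_gen letter list" where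
  "bs_word e X0 = [(T, e)]"
| "bs_word e X1 = [(A, True), (T, e)]"

primrec gen2_word :: "bool \<Rightarrow> bs_gen \<Rightarrow> gen2 letter list" where
  "gen2_word e T = [(X0, e)]"
| "gen2_word e A = [(X1, True), (X0, False)]"

primrec gen2_val :: "('g, 'm) monoid_scheme \<Rightarrow> 'g \<Rightarrow> 'g \<Rightarrow> gen2 \<Rightarrow> 'g" where
  "gen2_val G t a X0 = t"
| "gen2_val G t a X1 = a \<otimes>\<^bsub>G\<^esub> t"

lemma (in group) gen2_val_closed [simp]:
  "t \<in> carrier G \<Longrightarrow> a \<in> carrier G \<Longrightarrow> gen2_val G t a x \<in> carrier G"
  by (cases x) auto

lemma (in group) conj_pow_uminus_1:
  assumes "t \<in> carrier G" "a \<in> carrier G"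
  shows "conj_pow (inv t) k a = conj_pow t (- k) a"
  using assms by (simp add: conj_pow_def int_pow_neg int_pow_inv)

text \<open>The two hypotheses say that \<open>w\<close> and the relator of \<open>BS(1, m)\<close> are equivalent relations between
  \<open>t\<close> and \<open>a\<close>, one implication being needed in each of the two groups. The second relator
  \<open>\<theta>(w)\<close> takes care of itself, as a consequence of the first.\<close>

lemma cyclic_group2_iso_BS1:
  fixes e :: bool
  defines "\<epsilon> \<equiv> if e then 1 else - 1 :: int"
  assumes w: "reduced w" "consequence {w} (shift w)"
    and rel: "\<And>t a. t \<in> carrier (cyclic_group2 w) \<Longrightarrow> a \<in> carrier (cyclic_group2 w) \<Longrightarrow>
      word_val (cyclic_group2 w) (gen2_val (cyclic_group2 w) t a) w = \<one>\<^bsub>cyclic_group2 w\<^esub> \<Longrightarrow>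
      group.conj_pow (cyclic_group2 w) t \<epsilon> a = a [^]\<^bsub>cyclic_group2 w\<^esub> m"
    and BS: "\<And>t a. t \<in> carrier (BS1 m) \<Longrightarrow> a \<in> carrier (BS1 m) \<Longrightarrow>
      group.conj_pow (BS1 m) t \<epsilon> a = a [^]\<^bsub>BS1 m\<^esub> m \<Longrightarrow>
      word_val (BS1 m) (gen2_val (BS1 m) t a) w = \<one>\<^bsub>BS1 m\<^esub>"
  shows "cyclic_group2 w \<cong> BS1 m"
proof -
  let ?R = "{w, shift w}" and ?S = "{bs_relator m}"
  have R: "\<And>r. r \<in> ?R \<Longrightarrow> reduced r" using w(1) by auto
  have S: "\<And>s. s \<in> ?S \<Longrightarrow> reduced s" by (simp add: reduced_bs_relator)
  interpret G: group "cyclic_group2 w" unfolding cyclic_group2_def using R by (rule group_presented)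
  interpret B: group "BS1 m" by (rule group_BS1)
  have qG: "pres_gen ?R x \<in> carrier (cyclic_group2 w)" for x
    unfolding cyclic_group2_def using R by (rule pres_gen_closed)
  have qB: "pres_gen ?S x \<in> carrier (BS1 m)" for x
    unfolding BS1_def using S by (rule pres_gen_closed)
  have oneG: "word_val (cyclic_group2 w) (pres_gen ?R) v = \<one>\<^bsub>cyclic_group2 w\<^esub> \<longleftrightarrow> consequence ?R v" for v
    unfolding cyclic_group2_def using R by (rule word_val_pres_gen_one)
  have oneB: "word_val (BS1 m) (pres_gen ?S) v = \<one>\<^bsub>BS1 m\<^esub> \<longleftrightarrow> consequence ?S v" for v
    unfolding BS1_def using S by (rule word_val_pres_gen_one)
  have "consequence ?S (subst (bs_word e) w)"
  proof -
    let ?q = "pres_gen ?S" let ?t = "if e then ?q T else inv\<^bsub>BS1 m\<^esub> ?q T"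
    have t: "?t \<in> carrier (BS1 m)" using qB by simp
    have "consequence ?S (bs_relator m)" by (rule consequence_relator) (simp_all add: reduced_bs_relator)
    then have "B.conj_pow (?q T) 1 (?q A) = ?q A [^]\<^bsub>BS1 m\<^esub> m"
      using B.word_val_bs_relator[of ?q, OF qB] oneB by simp
    then have "B.conj_pow ?t \<epsilon> (?q A) = ?q A [^]\<^bsub>BS1 m\<^esub> m"
      using qB by (simp add: \<epsilon>_def B.conj_pow_uminus_1)
    then have "word_val (BS1 m) (gen2_val (BS1 m) ?t (?q A)) w = \<one>\<^bsub>BS1 m\<^esub>"
      by (rule BS[OF t qB])
    moreover have "word_val (BS1 m) ?q (bs_word e x) = gen2_val (BS1 m) ?t (?q A) x" for x
      using qB by (cases x) (auto simp: letter_val_def)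
    ultimately have "word_val (BS1 m) ?q (subst (bs_word e) w) = \<one>\<^bsub>BS1 m\<^esub>"
      by (simp add: B.word_val_subst[OF qB])
    then show ?thesis using oneB by simp
  qed
  moreover from this have "consequence ?S (subst (bs_word e) (shift w))"
    by (intro consequence_subst[OF _ _ _ w(2)]) (simp_all add: S w(1))
  moreover have "consequence ?R (subst (gen2_word e) (bs_relator m))"
  proof -
    let ?q = "pres_gen ?R"
    let ?a = "?q X1 \<otimes>\<^bsub>cyclic_group2 w\<^esub> inv\<^bsub>cyclic_group2 w\<^esub> ?q X0"
    let ?t = "if e then ?q X0 else inv\<^bsub>cyclic_group2 w\<^esub> ?q X0"
    have "gen2_val (cyclic_group2 w) (?q X0) ?a x = ?q x" for x
      using qG by (cases x) (simp_all add: G.m_assoc)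
    then have "gen2_val (cyclic_group2 w) (?q X0) ?a = ?q" by auto
    moreover have "consequence ?R w" by (rule consequence_relator) (simp_all add: w(1))
    ultimately have "G.conj_pow (?q X0) \<epsilon> ?a = ?a [^]\<^bsub>cyclic_group2 w\<^esub> m"
      using rel[of "?q X0" ?a] qG oneG by simp
    then have c: "G.conj_pow ?t 1 ?a = ?a [^]\<^bsub>cyclic_group2 w\<^esub> m"
      using qG by (simp add: \<epsilon>_def G.conj_pow_uminus_1 split: if_splits)
    let ?\<rho> = "\<lambda>y. word_val (cyclic_group2 w) ?q (gen2_word e y)"
    have \<rho>: "?\<rho> y \<in> carrier (cyclic_group2 w)" for y using qG by simp
    have "?\<rho> T = ?t" "?\<rho> A = ?a" using qG by (auto simp: letter_val_def)
    then have "word_val (cyclic_group2 w) ?\<rho> (bs_relator m) = \<one>\<^bsub>cyclic_group2 w\<^esub>"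
      using G.word_val_bs_relator[of ?\<rho>, OF \<rho>] c by simp
    then have "word_val (cyclic_group2 w) ?q (subst (gen2_word e) (bs_relator m)) = \<one>\<^bsub>cyclic_group2 w\<^esub>"
      by (simp add: G.word_val_subst[OF qG])
    then show ?thesis using oneG by simp
  qed
  moreover have "red (subst (gen2_word e) (bs_word e x)) = [(x, True)]" for x
    by (cases x; cases e) (auto simp: red_def push_def inv_letter_def)
  moreover have "red (subst (bs_word e) (gen2_word e y)) = [(y, True)]" for y
    by (cases y; cases e) (auto simp: red_def push_def inv_letter_def)
  ultimately show ?thesis
    unfolding cyclic_group2_def BS1_def
    by (intro presented_group_iso[where f = "bs_word e" and g = "gen2_word e"]) (auto simp: R S)
qed

section \<open>The classification\<close>

lemma (in group) word_val_one_letter: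
  assumes "\<And>y. s y \<in> carrier G" "\<And>y. y \<in> gens w \<Longrightarrow> y \<noteq> x \<Longrightarrow> s y = \<one>"
  shows "word_val G s w = s x [^] esum x w"
  using assms(2)
proof (induction w)
  case (Cons l w)
  have "letter_val G s l = s x [^] (esum x [l])"
    using Cons.prems[of "fst l"] assms(1) by (simp add: letter_val_def int_pow_neg)
  then show ?case using Cons assms(1) int_pow_mult[of "s x" "esum x [l]" "esum x w"] by simp
qed simp

lemma (in group) word_val_two_letters:
  assumes "\<And>y. s y \<in> carrier G" "x \<noteq> z" "gens w \<subseteq> {x, z}" "s z = s x [^] m"
  shows "word_val G s w = s x [^] (esum x w + m * esum z w)"
  using assms(3)
proof (induction w)
  case (Cons l w)
  let ?e = "\<lambda>w. esum x w + m * esum z w"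
  have "letter_val G s l = s x [^] ?e [l]"
    using Cons.prems assms by (auto simp: letter_val_def int_pow_neg)
  moreover have "word_val G s w = s x [^] ?e w" using Cons by simp
  ultimately have "word_val G s (l # w) = s x [^] ?e [l] \<otimes> s x [^] ?e w"
    by (simp only: word_val.simps)
  also have "\<dots> = s x [^] (?e [l] + ?e w)" by (rule int_pow_mult[OF assms(1), symmetric])
  also have "?e [l] + ?e w = ?e (l # w)" by (simp add: algebra_simps)
  finally show ?case .
qed simp

text \<open>A relator in at most two letters \<open>x\<close> and \<open>z\<close> that puts \<open>z\<close> into the subgroup generated by the
  other generators, so that \<open>z\<close> becomes a power of \<open>x\<close>. The word \<open>v\<close> that represents \<open>z\<close> may
  contain further generators. The case \<open>x = z\<close> is included and means that \<open>z\<close> becomes trivial,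
  which is the reason for the value 0 in the next definition.\<close>

definition cyclic_relator :: "'x letter list \<Rightarrow> 'x \<Rightarrow> 'x \<Rightarrow> 'x letter list \<Rightarrow> bool" where
  "cyclic_relator r x z v \<longleftrightarrow> cyclically_reduced r \<and> gens r \<subseteq> {x, z} \<and> x \<in> gens r \<and> z \<in> gens r \<and>
    consequence {r} ((z, False) # v) \<and> z \<notin> gens v"

definition cyclic_exponent :: "'x \<Rightarrow> 'x \<Rightarrow> 'x letter list \<Rightarrow> int" where
  "cyclic_exponent x z v = (if x = z then 0 else esum x v)"

text \<open>Further generators in \<open>v\<close> do not occur in the relator and can be sent to 1.\<close>

lemma (in group) cyclic_relator_imp:
  assumes r: "cyclic_relator r x z v" and s: "\<And>y. s y \<in> carrier G" "\<And>y. y \<notin> {x, z} \<Longrightarrow> s y = \<one>" and "word_val G s r = \<one>"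
  shows "s z = s x [^] cyclic_exponent x z v"
proof -
  have rr: "reduced r" and v: "consequence {r} ((z, False) # v)" "z \<notin> gens v"
    using r by (simp_all add: cyclic_relator_def cyclically_reduced_reduced)
  have "word_val G s ((z, False) # v) = \<one>"
    by (rule consequence_word_val[OF s(1) _ _ v(1)]) (use assms(4) rr in simp_all)
  then have "inv (s z) \<otimes> word_val G s v = \<one>" by (simp add: letter_val_def)
  then have "inv (word_val G s v) = inv (s z)"
    using s(1) by (intro inv_equality) simp_all
  then have "s z = word_val G s v"
    using s(1) by (metis inv_inv word_val_closed)
  moreover have "word_val G s v = s x [^] cyclic_exponent x z v"
  proof (cases "x = z")
    case True
    have "word_val G s v = \<one>"
    proof (rule word_val_trivial)
      fix y assume "y \<in> gens v"
      then have "y \<notin> {x, z}" using v(2) True by blast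
      then show "s y = \<one>" by (rule s(2))
    qed
    then show ?thesis by (simp add: cyclic_exponent_def True)
  next
    case False
    have "word_val G s v = s x [^] esum x v"
    proof (rule word_val_one_letter[OF s(1)])
      fix y assume "y \<in> gens v" "y \<noteq> x"
      then have "y \<notin> {x, z}" using v(2) by blast
      then show "s y = \<one>" by (rule s(2))
    qed
    then show ?thesis by (simp add: cyclic_exponent_def False)
  qed
  ultimately show ?thesis by simp
qed

text \<open>By \<open>z = x\<^sup>m\<close> the relator is a power of \<open>x\<close>, trivial in the group that it defines. The
  exponent is zero because \<open>x\<close> has infinite order by the Freiheitssatz.\<close>

lemma cyclic_relator_esum:
  fixes r :: "'x :: countable letter list"
  assumes cr: "cyclic_relator r x z v" and "x \<noteq> z"
  shows "esum x r + cyclic_exponent x z v * esum z r = 0"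
proof -
  let ?m = "cyclic_exponent x z v"
  let ?k = "esum x r + ?m * esum z r"
  have r: "cyclically_reduced r" "gens r \<subseteq> {x, z}" "x \<in> gens r" "z \<in> gens r"
    using cr by (simp_all add: cyclic_relator_def)
  let ?Q = "presented_group UNIV {r}"
  have red: "\<And>s. s \<in> {r} \<Longrightarrow> reduced s" using r by (simp add: cyclically_reduced_reduced)
  interpret Q: group ?Q using red by (rule group_presented)
  have q: "pres_gen {r} y \<in> carrier ?Q" for y using red by (rule pres_gen_closed)
  define s where "s y = (if y \<in> {x, z} then pres_gen {r} y else \<one>\<^bsub>?Q\<^esub>)" for y
  have s: "s y \<in> carrier ?Q" for y using q by (simp add: s_def)
  have "word_val ?Q s r = word_val ?Q (pres_gen {r}) r"
    by (rule word_val_cong) (use r(2) in \<open>auto simp: s_def\<close>)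
  also have "\<dots> = \<one>\<^bsub>?Q\<^esub>"
    using word_val_pres_gen_one[where R = "{r}" and w = r, OF red] consequence_relator[of r "{r}"] red by simp
  finally have one: "word_val ?Q s r = \<one>\<^bsub>?Q\<^esub>" .
  have "s z = s x [^]\<^bsub>?Q\<^esub> ?m"
    by (rule Q.cyclic_relator_imp[OF cr s _ one]) (simp add: s_def)
  then have "word_val ?Q s r = s x [^]\<^bsub>?Q\<^esub> ?k"
    using Q.word_val_two_letters[OF s assms(2) r(2)] by simp
  then have "word_val ?Q (pres_gen {r}) (gen_power x ?k) = \<one>\<^bsub>?Q\<^esub>"
    using one Q.word_val_gen_power[of "pres_gen {r}" x ?k, OF q] by (simp add: s_def)
  then have "consequence {r} (gen_power x ?k)" by (intro consequenceI) (simp_all add: red)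
  moreover have "z \<notin> gens (gen_power x ?k)" using gens_gen_power[of x ?k] assms(2) by blast
  ultimately have "red (gen_power x ?k) = []"
    by (intro freiheitssatz[OF r(1,4)])
  then show ?thesis
    by (simp add: gen_power_def red_reduced reduced_replicate)
qed

lemma (in group) cyclic_relator_iff:
  fixes r :: "'x :: countable letter list"
  assumes cr: "cyclic_relator r x z v" and s: "\<And>y. s y \<in> carrier G" "\<And>y. y \<notin> {x, z} \<Longrightarrow> s y = \<one>"
  shows "word_val G s r = \<one> \<longleftrightarrow> s z = s x [^] cyclic_exponent x z v"
proof
  have r: "gens r \<subseteq> {x, z}" using cr by (simp add: cyclic_relator_def)
  assume eq: "s z = s x [^] cyclic_exponent x z v"
  show "word_val G s r = \<one>"
  proof (cases "x = z")
    case True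
    show ?thesis by (rule word_val_trivial) (use eq r True in \<open>auto simp: cyclic_exponent_def\<close>)
  next
    case False
    then show ?thesis
      using word_val_two_letters[OF s(1) False r eq] cyclic_relator_esum[OF cr False] by simp
  qed
qed (rule cyclic_relator_imp[OF cr s])

primrec bs_val :: "'g \<Rightarrow> 'g \<Rightarrow> bs_gen \<Rightarrow> 'g" where
  "bs_val t a T = t"
| "bs_val t a A = a"

lemma (in group) bs_val_closed [simp]:
  "t \<in> carrier G \<Longrightarrow> a \<in> carrier G \<Longrightarrow> bs_val t a x \<in> carrier G"
  by (cases x) auto

lemma (in group) gen2_val_gen2_word:
  assumes "t \<in> carrier G" "a \<in> carrier G"
  shows "word_val G (gen2_val G t a) (gen2_word True y) = bs_val t a y"
  using assms by (cases y) (simp_all add: letter_val_def m_assoc)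

text \<open>The chain of relators that are equivalent in every group: \<open>w\<close>, its image \<open>r\<close> under the change
  of basis, and the cyclically reduced form \<open>r1\<close> of the rewritten word.\<close>

lemma (in group) gen2_val_rewrite:
  assumes "t \<in> carrier G" "a \<in> carrier G" and r: "conj_words r (subst (bs_word True) w)" "esum T r = 0"
    and r1: "conj_words r1 (hnn_rewrite T 0 r)"
  shows "word_val G (gen2_val G t a) w = \<one> \<longleftrightarrow> word_val G (conj_val (bs_val t a) T) r1 = \<one>"
proof -
  have \<beta>: "\<And>x. bs_val t a x \<in> carrier G" using assms by simp
  have "gen2_val G t a = (\<lambda>x. word_val G (bs_val t a) (bs_word True x))"
  proof
    show "gen2_val G t a x = word_val G (bs_val t a) (bs_word True x)" for x
      using assms by (cases x) (simp_all add: letter_val_def)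
  qed
  then have "word_val G (gen2_val G t a) w = word_val G (bs_val t a) (subst (bs_word True) w)"
    by (simp add: word_val_subst[OF \<beta>])
  then show ?thesis
    using conj_words_word_val[of "bs_val t a", OF \<beta> r(1)]
      word_val_hnn_rewrite[of "bs_val t a", OF \<beta> r(2)]
      conj_words_word_val[of "conj_val (bs_val t a) T", OF conj_val_closed[of "bs_val t a", OF \<beta>] r1]
    by simp
qed

lemma (in group) conj_pow_int_pow:
  "t \<in> carrier G \<Longrightarrow> x \<in> carrier G \<Longrightarrow> conj_pow t k (x [^] (m :: int)) = conj_pow t k x [^] m"
  by (rule hom_int_pow[OF conj_pow_hom]) (simp_all add: is_group)

lemma (in group) conj_pow_inj:
  assumes "t \<in> carrier G" "x \<in> carrier G" "y \<in> carrier G"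
  shows "conj_pow t k x = conj_pow t k y \<longleftrightarrow> x = y"
proof
  assume "conj_pow t k x = conj_pow t k y"
  then have "conj_pow t (- k) (conj_pow t k x) = conj_pow t (- k) (conj_pow t k y)" by simp
  then show "x = y" using assms by (simp add: conj_pow_add)
qed simp

text \<open>The index of \<open>a\<close> is shifted by \<open>\<epsilon> = \<plusminus>1\<close>; the common conjugation by \<open>t\<^sup>p\<close> cancels. If \<open>p' = p\<close>,
  both sides say \<open>a = 1\<close>.\<close>

lemma (in group) ascending_relator:
  fixes r :: "(bs_gen \<times> int) letter list"
  assumes t: "t \<in> carrier G" "a \<in> carrier G" and r: "cyclic_relator r (A, p) (A, p') v"
    and \<epsilon>: "p' = p \<or> p' = p + \<epsilon>"
  shows "word_val G (conj_val (bs_val t a) T) r = \<one> \<longleftrightarrow>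
    conj_pow t \<epsilon> a = a [^] cyclic_exponent (A, p) (A, p') v"
proof -
  let ?m = "cyclic_exponent (A, p) (A, p') v"
  define s where "s y = (if y \<in> {(A, p), (A, p')} then conj_val (bs_val t a) T y else \<one>)" for y
  have s: "s y \<in> carrier G" for y using t by (simp add: s_def)
  have "word_val G (conj_val (bs_val t a) T) r = word_val G s r"
    by (rule word_val_cong) (use r in \<open>auto simp: s_def cyclic_relator_def\<close>)
  also have "word_val G s r = \<one> \<longleftrightarrow> s (A, p') = s (A, p) [^] ?m"
    by (rule cyclic_relator_iff[OF r s]) (simp add: s_def)
  also have "s (A, p') = s (A, p) [^] ?m \<longleftrightarrow> conj_pow t p' a = conj_pow t p (a [^] ?m)"
    using t by (simp add: s_def conj_val_def conj_pow_int_pow)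
  also have "\<dots> \<longleftrightarrow> conj_pow t \<epsilon> a = a [^] ?m"
  proof (cases "p' = p")
    case True
    then show ?thesis using t by (simp add: cyclic_exponent_def conj_pow_eq_one)
  next
    case False
    then have "conj_pow t p' a = conj_pow t p (conj_pow t \<epsilon> a)"
      using \<epsilon> t by (simp add: conj_pow_add)
    then show ?thesis using t by (simp add: conj_pow_inj)
  qed
  finally show ?thesis .
qed

text \<open>Here \<open>S\<close> and its shift are as in \<open>one_relator_rewritten_hnn\<close>. Besides letters \<open>(A, i)\<close> they
  contain the letters \<open>(T, i)\<close>, which never occur in a rewritten word and which are harmless
  because \<open>cyclic_relator\<close> tolerates them.\<close>

lemma cyclic_group2_alternative:
  assumes w: "cyclically_reduced w" "w \<noteq> []"
    and shift: "consequence {w} (shift w)" and esum: "esum X0 w + esum X1 w = 0"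
  shows "has_nonabelian_free_subgroup (cyclic_group2 w) \<or> (\<exists>m. cyclic_group2 w \<cong> BS1 m)"
proof -
  have rw: "reduced w" using w(1) by (rule cyclically_reduced_reduced)
  obtain r where r: "cyclically_reduced r" "conj_words r (subst (bs_word True) w)"
    using ex_cyclic_reduction by blast
  have "esum T (subst (bs_word True) w) = esum X0 w + esum X1 w"
  proof (induction w)
    case (Cons l w)
    then show ?case by (cases l; cases "fst l") (auto simp: inv_letter_def)
  qed simp
  then have rT: "esum T r = 0" using esum_conj_words[OF r(2), of T] esum by simp
  obtain r1 where r1: "cyclically_reduced r1" "conj_words r1 (hnn_rewrite T 0 r)"
    using ex_cyclic_reduction by blast
  have not_T: "fst y = A" if "y \<in> gens r1" for y
    using gens_cyclically_reduced[OF r1] gens_hnn_rewrite[of y T 0 r] that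
    by (cases "fst y") auto
  have "r1 \<noteq> []"
  proof
    assume "r1 = []"
    then have "conj_words (hnn_rewrite T 0 r) []" using r1(2) conj_words_sym by blast
    then have "red (hnn_rewrite T 0 r) = []" by (auto simp: conj_words_def red_eq_Nil_self)
    then have "red r = []" by (rule red_eq_Nil_if_rewrite[OF rT])
    then have "conj_words (subst (bs_word True) w) []"
      using r conj_words_sym by (auto simp: red_reduced cyclically_reduced_reduced)
    then have "red (subst (bs_word True) w) = []" by (auto simp: conj_words_def red_eq_Nil_self)
    then have "red (subst (gen2_word True) (subst (bs_word True) w)) = []"
      using red_subst_cong[of "subst (bs_word True) w" "[]" "gen2_word True"] by simp
    moreover have "red (subst (gen2_word True) (bs_word True x)) = [(x, True)]" for x
      by (cases x) (auto simp: red_def push_def inv_letter_def)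
    ultimately show False using w(2) rw by (simp add: subst_subst red_subst_id red_reduced)
  qed
  then obtain i where "(A, i) \<in> gens r1"
    using not_T[of "fst (hd r1)"] by (cases r1) (auto, metis prod.collapse)
  from index_range[OF this] obtain \<mu> \<nu> where ends: "(A, \<mu>) \<in> gens r1" "(A, \<nu>) \<in> gens r1"
    "\<forall>i. (A, i) \<in> gens r1 \<longrightarrow> \<mu> \<le> i \<and> i \<le> \<nu>"
    by (elim exE conjE)
  have mag: "magnus_property r1" unfolding magnus_property_def using freiheitssatz[OF r1(1)] by blast
  define S :: "(bs_gen \<times> int) set" where "S = {(b, i). b \<noteq> A \<or> \<mu> \<le> i \<and> i < \<nu>}"
  define sh :: "bs_gen \<times> int \<Rightarrow> bs_gen \<times> int" where "sh = (\<lambda>(b, i). (b, i + 1))"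
  from one_relator_rewritten_hnn[OF rT r1 mag ends, folded S_def sh_def]
  obtain \<rho> :: "bs_gen \<Rightarrow> (bs_gen \<times> int) letter list set \<times> nat \<Rightarrow> (bs_gen \<times> int) letter list set \<times> nat"
    where \<rho>: "\<forall>x. bij (\<rho> x)" "word_val perms \<rho> r = id"
      and cons: "\<forall>w. gens w \<subseteq> {(b, i). b \<noteq> T \<and> (b = A \<longrightarrow> \<mu> \<le> i \<and> i \<le> \<nu>)} \<longrightarrow>
        (word_val perms (\<lambda>y. group.conj_val perms \<rho> T y) w = id \<longleftrightarrow> consequence {r1} w)"
      and pp: "((\<forall>w. gens w \<subseteq> S \<longrightarrow> \<not> consequence {r1} (((A, \<nu>), False) # w)) \<longrightarrow>
     (\<forall>w. gens w \<subseteq> S \<longrightarrow> \<not> consequence {r1} (((A, \<mu>), False) # map (map_prod sh id) w)) \<longrightarrow>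
     (\<forall>w :: bool letter list. reduced w \<longrightarrow> w \<noteq> [] \<longrightarrow>
       word_val perms (\<lambda>b. if b then \<rho> T else group.conj_val perms \<rho> T (A, \<mu>) \<circ> \<rho> T \<circ> group.conj_val perms \<rho> T (A, \<nu>)) w \<noteq> id))"
    by (elim exE conjE)
  interpret P: group "perms :: ('w \<Rightarrow> 'w) monoid" by (rule group_perms)
  have \<rho>': "\<And>x. \<rho> x \<in> carrier perms" using \<rho> by simp
  let ?\<rho> = "gen2_val perms (\<rho> T) (\<rho> A)"
  have g\<rho>: "?\<rho> x \<in> carrier perms" for x by (rule P.gen2_val_closed[OF \<rho>' \<rho>'])
  have bs_val_\<rho>: "bs_val (\<rho> T) (\<rho> A) = \<rho>"
  proof
    show "bs_val (\<rho> T) (\<rho> A) x = \<rho> x" for x by (cases x) simp_all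
  qed
  have "word_val perms (P.conj_val \<rho> T) r1 = \<one>\<^bsub>perms\<^esub>"
    using \<rho>(2) P.word_val_hnn_rewrite[of \<rho>, OF \<rho>' rT]
      P.conj_words_word_val[of "P.conj_val \<rho> T", OF P.conj_val_closed[of \<rho>, OF \<rho>'] r1(2)] by simp
  then have w_one: "word_val perms ?\<rho> w = \<one>\<^bsub>perms\<^esub>"
    using P.gen2_val_rewrite[OF \<rho>' \<rho>' r(2) rT r1(2)] by (simp add: bs_val_\<rho>)
  have "word_val perms ?\<rho> (shift w) = \<one>\<^bsub>perms\<^esub>"
    by (rule P.consequence_word_val[OF g\<rho> _ _ shift]) (simp_all add: rw w_one)
  then have kill: "word_val perms ?\<rho> s = \<one>\<^bsub>perms\<^esub>" if "s \<in> {w, shift w}" for s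
    using that w_one by auto
  have free_subgroup: "has_nonabelian_free_subgroup (cyclic_group2 w)"
    if free: "\<And>v. reduced v \<Longrightarrow> v \<noteq> [] \<Longrightarrow> word_val perms (\<lambda>b. word_val perms \<rho> (u b)) v \<noteq> id"
    for u :: "bool \<Rightarrow> bs_gen letter list"
    unfolding cyclic_group2_def
  proof (rule nonabelian_free_subgroup_via_image[OF _ P.is_group g\<rho> kill])
    have gen: "word_val perms ?\<rho> (gen2_word True y) = \<rho> y" for y
      using P.gen2_val_gen2_word[OF \<rho>' \<rho>', of T A y] by (simp only: bs_val_\<rho>)
    have "word_val perms ?\<rho> (subst (gen2_word True) (u b)) = word_val perms \<rho> (u b)" for b
      by (simp add: P.word_val_subst[OF g\<rho>] gen)
    then show "word_val perms (\<lambda>b. word_val perms ?\<rho> (subst (gen2_word True) (u b))) v \<noteq> \<one>\<^bsub>perms\<^esub>"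
      if "reduced v" "v \<noteq> []" for v
      using free[OF that] by simp
  qed (use rw in auto)
  have unrewrite: "word_val perms \<rho> (unrewrite T y) = P.conj_val \<rho> T y" for y
    using P.word_val_unrewrite[of \<rho> T "[(y, True)]", OF \<rho>'] by (simp add: letter_val_def)
  have cyclic: "\<exists>m. cyclic_group2 w \<cong> BS1 m"
    if cr: "cyclic_relator r1 (A, p) (A, p') v" and p: "p' = p \<or> p' = p + (if e then 1 else - 1)" for p p' v e
  proof -
    have "cyclic_group2 w \<cong> BS1 (cyclic_exponent (A, p) (A, p') v)"
    proof (rule cyclic_group2_iso_BS1[OF rw shift, where e = e])
      interpret G: group "cyclic_group2 w" by (rule group_cyclic_group2[OF rw])
      fix t a assume ta: "t \<in> carrier (cyclic_group2 w)" "a \<in> carrier (cyclic_group2 w)"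
        and "word_val (cyclic_group2 w) (gen2_val (cyclic_group2 w) t a) w = \<one>\<^bsub>cyclic_group2 w\<^esub>"
      then show "G.conj_pow t (if e then 1 else - 1) a
          = a [^]\<^bsub>cyclic_group2 w\<^esub> cyclic_exponent (A, p) (A, p') v"
        using G.gen2_val_rewrite[OF ta r(2) rT r1(2)] G.ascending_relator[OF ta cr p] by simp
    next
      let ?B = "BS1 (cyclic_exponent (A, p) (A, p') v)"
      interpret B: group ?B by (rule group_BS1)
      fix t a assume ta: "t \<in> carrier ?B" "a \<in> carrier ?B"
        and "B.conj_pow t (if e then 1 else - 1) a = a [^]\<^bsub>?B\<^esub> cyclic_exponent (A, p) (A, p') v"
      then show "word_val ?B (gen2_val ?B t a) w = \<one>\<^bsub>?B\<^esub>"
        using B.gen2_val_rewrite[OF ta r(2) rT r1(2)] B.ascending_relator[OF ta cr p] by simp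
    qed
    then show ?thesis by blast
  qed
  show ?thesis
  proof (cases "\<nu> \<le> \<mu> + 1")
    case False
    \<comment> \<open>both letters differ from \<open>(A, \<nu>)\<close>, so they are free by the Freiheitssatz\<close>
    let ?i = "\<lambda>b. (A, if b then \<mu> else \<mu> + 1)"
    have "word_val perms (\<lambda>b. word_val perms \<rho> (unrewrite T (?i b))) v \<noteq> id"
      if v: "reduced v" "v \<noteq> []" for v
    proof
      let ?v = "map (map_prod ?i id) v"
      assume "word_val perms (\<lambda>b. word_val perms \<rho> (unrewrite T (?i b))) v = id"
      then have "word_val perms (\<lambda>y. P.conj_val \<rho> T y) ?v = id"
        by (simp add: word_val_map unrewrite o_def)
      moreover have "gens ?v \<subseteq> {(b, i). b \<noteq> T \<and> (b = A \<longrightarrow> \<mu> \<le> i \<and> i \<le> \<nu>)}"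
        using False by auto
      ultimately have "consequence {r1} ?v" using cons by blast
      moreover have "(A, \<nu>) \<notin> gens ?v" using False by (auto split: if_splits)
      ultimately have "red ?v = []"
        using mag ends(2) unfolding magnus_property_def by blast
      then have "red v = []" using red_map_eq_Nil_iff[of ?i v] by (simp add: inj_def)
      then show False using v by (simp add: red_reduced)
    qed
    then show ?thesis using free_subgroup[of "\<lambda>b. unrewrite T (?i b)"] by blast
  next
    case True
    have gens_r1: "gens r1 \<subseteq> {(A, \<mu>), (A, \<nu>)}"
    proof
      fix y assume y: "y \<in> gens r1"
      then obtain i where "y = (A, i)" using not_T by (metis prod.collapse)
      then show "y \<in> {(A, \<mu>), (A, \<nu>)}" using ends(3) y True by auto
    qed
    \<comment> \<open>the HNN extension is ascending in one of the two directions, or ping-pong applies\<close>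
    consider (up) v where "gens v \<subseteq> S" "consequence {r1} (((A, \<nu>), False) # v)"
      | (down) v where "gens v \<subseteq> S" "consequence {r1} (((A, \<mu>), False) # map (map_prod sh id) v)"
      | (free) "\<forall>w. gens w \<subseteq> S \<longrightarrow> \<not> consequence {r1} (((A, \<nu>), False) # w)"
        "\<forall>w. gens w \<subseteq> S \<longrightarrow> \<not> consequence {r1} (((A, \<mu>), False) # map (map_prod sh id) w)"
      by blast
    then show ?thesis
    proof cases
      case up
      have "cyclic_relator r1 (A, \<mu>) (A, \<nu>) v"
        using up r1(1) ends gens_r1 by (auto simp: cyclic_relator_def S_def)
      moreover have "\<nu> = \<mu> \<or> \<nu> = \<mu> + (if True then 1 else - 1)" using True ends by auto
      ultimately show ?thesis using cyclic by blast
    next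
      case down
      have "(A, \<mu>) \<notin> sh ` S" by (auto simp: S_def sh_def)
      moreover have "gens (map (map_prod sh id) v) = sh ` gens v" by (simp add: image_image)
      ultimately have "(A, \<mu>) \<notin> gens (map (map_prod sh id) v)" using down(1) by blast
      then have "cyclic_relator r1 (A, \<nu>) (A, \<mu>) (map (map_prod sh id) v)"
        unfolding cyclic_relator_def using down(2) r1(1) ends gens_r1 by blast
      moreover have "\<mu> = \<nu> \<or> \<mu> = \<nu> + (if False then 1 else - 1)" using True ends by auto
      ultimately show ?thesis using cyclic by blast
    next
      case free
      let ?u = "\<lambda>b. if b then [(T, True)] else unrewrite T (A, \<mu>) @ [(T, True)] @ unrewrite T (A, \<nu>)"
      have "word_val perms \<rho> (?u b) = (if b then \<rho> T else P.conj_val \<rho> T (A, \<mu>) \<circ> \<rho> T \<circ> P.conj_val \<rho> T (A, \<nu>))" for b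
        by (simp add: P.word_val_append[of \<rho>, OF \<rho>'] unrewrite letter_val_def o_assoc)
      moreover have "word_val perms (\<lambda>b. if b then \<rho> T
          else P.conj_val \<rho> T (A, \<mu>) \<circ> \<rho> T \<circ> P.conj_val \<rho> T (A, \<nu>)) v \<noteq> id"
        if "reduced v" "v \<noteq> []" for v :: "bool letter list"
        using pp free that by blast
      ultimately show ?thesis using free_subgroup[of ?u] by presburger
    qed
  qed
qed

section \<open>Every Baumslag--Solitar group occurs\<close>

text \<open>Both parts of the word are equal to the inverse of their shift, which makes the presentation
  non-orientable. With \<open>t = x\<^sub>0\<close> and \<open>a = x\<^sub>1x\<^sub>0\<inverse>\<close> the head is \<open>tat\<inverse>a\<inverse>\<close> for \<open>m > 0\<close> and \<open>a(tat\<inverse>)\<close> for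
  \<open>m < 0\<close>, and the tail is \<open>a\<inverse>\<close> or \<open>a\<close>. So \<open>\<bar>m\<bar> - 1\<close> copies of the tail complete the relation
  \<open>tat\<inverse> = a\<^sup>m\<close>. For \<open>m = 0\<close> the head \<open>a\<inverse>\<close> is all that is needed, and the truncated exponent of
  the tail is 0.\<close>

definition bs_head :: "int \<Rightarrow> gen2 letter list" where
  "bs_head m = (if m = 0 then [(X0, True), (X1, False)]
    else if m > 0 then [(X0, True), (X1, True), (X0, False), (X1, False)]
    else [(X1, True), (X1, True), (X0, False), (X0, False)])"

definition bs_tail :: "int \<Rightarrow> gen2 letter list" where
  "bs_tail m = (if m \<ge> 0 then [(X0, True), (X1, False)] else [(X1, True), (X0, False)])"

definition bs_cyclic_word :: "int \<Rightarrow> gen2 letter list" where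
  "bs_cyclic_word m = bs_head m @ word_power (nat (\<bar>m\<bar> - 1)) (bs_tail m)"

lemma word_power_commute: "word_power n w @ w = w @ word_power n w"
  by (induction n) simp_all

lemma inv_word_word_power: "inv_word (word_power n w) = word_power n (inv_word w)"
  by (induction n) (simp_all add: word_power_commute)

lemma shift_append: "shift (u @ v) = shift u @ shift v"
  by (simp add: shift_def)

lemma shift_word_power: "shift (word_power n w) = word_power n (shift w)"
  by (induction n) (simp_all add: shift_append, simp add: shift_def)

lemma bs_cyclic_word_non_orientable: "\<not> orientable (bs_cyclic_word m)"
proof -
  have "inv_word (shift (bs_head m)) = bs_head m" "inv_word (shift (bs_tail m)) = bs_tail m"
    by (simp_all add: bs_head_def bs_tail_def shift_def inv_letter_def)
  then have "inv_word (shift (bs_cyclic_word m))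
      = word_power (nat (\<bar>m\<bar> - 1)) (bs_tail m) @ bs_head m"
    by (simp add: bs_cyclic_word_def shift_append shift_word_power inv_word_word_power)
  then have "bs_cyclic_word m
      = rotate (length (word_power (nat (\<bar>m\<bar> - 1)) (bs_tail m))) (inv_word (shift (bs_cyclic_word m)))"
    by (simp only: bs_cyclic_word_def rotate_append)
  then show ?thesis unfolding orientable_def cyclic_perm_def by blast
qed

lemma bs_cyclic_word_cyclically_reduced: "cyclically_reduced (bs_cyclic_word m)"
proof -
  let ?p = "word_power (nat (\<bar>m\<bar> - 1)) (bs_tail m)"
  have ne: "bs_head m \<noteq> []" "bs_tail m \<noteq> []" by (simp_all add: bs_head_def bs_tail_def)
  have h: "reduced (bs_head m)" "cyclically_reduced (bs_tail m)"
    "last (bs_head m) = last (bs_tail m)" "hd (bs_tail m) \<noteq> inv_letter (last (bs_head m))"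
    "hd (bs_head m) \<noteq> inv_letter (last (bs_tail m))"
    by (simp_all add: bs_head_def bs_tail_def cyclically_reduced_def reduced_Cons inv_letter_def)
  have "?p \<noteq> [] \<longrightarrow> hd ?p = hd (bs_tail m)"
    using ne by (cases "nat (\<bar>m\<bar> - 1)") auto
  moreover have "?p \<noteq> [] \<longrightarrow> last ?p = last (bs_tail m)"
  proof (cases "nat (\<bar>m\<bar> - 1)")
    case (Suc n)
    then have "?p = word_power n (bs_tail m) @ bs_tail m" by (simp add: word_power_commute)
    then show ?thesis using ne by simp
  qed simp
  moreover have "reduced ?p" using h(2) by (rule reduced_word_power)
  ultimately show ?thesis
    using ne h unfolding bs_cyclic_word_def cyclically_reduced_def reduced_append
    by (cases "?p = []") (simp_all add: last_append)
qed

lemma (in group) word_val_word_power: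
  assumes "\<And>x. \<rho> x \<in> carrier G"
  shows "word_val G \<rho> (word_power n w) = word_val G \<rho> w [^] n"
proof (induction n)
  case (Suc n)
  then show ?case using assms nat_pow_Suc2[of "word_val G \<rho> w" n] by (simp add: word_val_append)
qed simp

lemma (in group) bs_cyclic_word_relation:
  assumes t: "t \<in> carrier G" "a \<in> carrier G"
  shows "word_val G (gen2_val G t a) (bs_cyclic_word m) = \<one> \<longleftrightarrow> conj_pow t 1 a = a [^] m"
proof -
  have g: "gen2_val G t a x \<in> carrier G" for x using t by simp
  let ?b = "conj_pow t 1 a"
  have b: "?b \<in> carrier G" "?b = t \<otimes> (a \<otimes> inv t)" using t by (simp_all add: conj_pow_def m_assoc)
  have cancel: "t \<otimes> (inv t \<otimes> x) = x" "inv t \<otimes> (t \<otimes> x) = x" if "x \<in> carrier G" for x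
    using t that by (simp_all add: m_assoc[symmetric])
  have eq_inv: "x \<otimes> y = \<one> \<longleftrightarrow> x = inv y" if "x \<in> carrier G" "y \<in> carrier G" for x y
    using that inv_equality[of x y] by (auto simp: eq_commute[of "inv y"])
  have word: "word_val G (gen2_val G t a) (bs_cyclic_word m)
      = word_val G (gen2_val G t a) (bs_head m) \<otimes> word_val G (gen2_val G t a) (bs_tail m) [^] nat (\<bar>m\<bar> - 1)"
    unfolding bs_cyclic_word_def using g by (simp add: word_val_append word_val_word_power)
  consider "m = 0" | "m > 0" | "m < 0" by linarith
  then show ?thesis
  proof cases
    case 1
    have "word_val G (gen2_val G t a) (bs_cyclic_word m) = inv a"
      unfolding word using t
      by (simp add: 1 bs_head_def letter_val_def inv_mult_group cancel m_assoc)
    then show ?thesis using t conj_pow_eq_one[OF t, of 1] by (simp add: 1 inv_eq_1_iff)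
  next
    case 2
    then obtain n where n: "m = int (Suc n)" using zero_less_imp_eq_int[of m] gr0_implies_Suc by blast
    have "word_val G (gen2_val G t a) (bs_cyclic_word m) = ?b \<otimes> (inv a \<otimes> inv a [^] n)"
      unfolding word using t
      by (simp add: n b(2) bs_head_def bs_tail_def letter_val_def inv_mult_group cancel m_assoc)
    also have "inv a \<otimes> inv a [^] n = inv (a [^] m)"
      using t unfolding n int_pow_int by (simp add: nat_pow_inv inv_mult_group)
    finally show ?thesis using t b(1) eq_inv[of ?b "inv (a [^] m)"] by simp
  next
    case 3
    then obtain n where n: "m = - int (Suc n)"
      using zero_less_imp_eq_int[of "- m"] gr0_implies_Suc by (metis neg_0_less_iff_less minus_minus)
    have "word_val G (gen2_val G t a) (bs_cyclic_word m) = a \<otimes> (?b \<otimes> a [^] n)"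
      unfolding word using t
      by (simp add: n b(2) bs_head_def bs_tail_def letter_val_def inv_mult_group cancel m_assoc)
    moreover have "a \<otimes> (?b \<otimes> a [^] n) = \<one> \<longleftrightarrow> ?b \<otimes> a [^] n \<otimes> a = \<one>"
      using t b(1) inv_comm[of a "?b \<otimes> a [^] n"] inv_comm[of "?b \<otimes> a [^] n" a] by auto
    moreover have "?b \<otimes> a [^] n \<otimes> a = ?b \<otimes> a [^] Suc n"
      using t b(1) by (simp add: m_assoc)
    moreover have "inv (a [^] Suc n) = a [^] m"
      unfolding n by (rule int_pow_neg_int[OF t(2), symmetric])
    ultimately show ?thesis using t b(1) eq_inv[of ?b "a [^] Suc n"] by simp
  qed
qed

lemma bs_cyclic_word_iso: "cyclic_group2 (bs_cyclic_word m) \<cong> BS1 m"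
proof -
  let ?w = "bs_cyclic_word m"
  have w: "cyclically_reduced ?w" "?w \<noteq> []" "\<not> orientable ?w"
    using bs_cyclic_word_cyclically_reduced bs_cyclic_word_non_orientable
    by (simp_all add: bs_cyclic_word_def bs_head_def)
  have rw: "reduced ?w" using w(1) by (rule cyclically_reduced_reduced)
  show ?thesis
  proof (rule cyclic_group2_iso_BS1[OF rw non_orientable(1)[OF w], where e = True], unfold if_True)
    interpret G: group "cyclic_group2 ?w" by (rule group_cyclic_group2[OF rw])
    fix t a assume "t \<in> carrier (cyclic_group2 ?w)" "a \<in> carrier (cyclic_group2 ?w)"
      "word_val (cyclic_group2 ?w) (gen2_val (cyclic_group2 ?w) t a) ?w = \<one>\<^bsub>cyclic_group2 ?w\<^esub>"
    then show "G.conj_pow t 1 a = a [^]\<^bsub>cyclic_group2 ?w\<^esub> m"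
      by (simp add: G.bs_cyclic_word_relation)
  next
    interpret B: group "BS1 m" by (rule group_BS1)
    fix t a assume "t \<in> carrier (BS1 m)" "a \<in> carrier (BS1 m)" "B.conj_pow t 1 a = a [^]\<^bsub>BS1 m\<^esub> m"
    then show "word_val (BS1 m) (gen2_val (BS1 m) t a) ?w = \<one>\<^bsub>BS1 m\<^esub>"
      by (simp add: B.bs_cyclic_word_relation)
  qed
qed

theorem theorem5:
  shows "(\<forall>w. w \<noteq> [] \<and> cyclically_reduced w \<and> \<not> orientable w \<longrightarrow>
            has_nonabelian_free_subgroup (cyclic_group2 w) \<or> (\<exists>m. cyclic_group2 w \<cong> BS1 m))
       \<and> (\<forall>m. \<exists>w. w \<noteq> [] \<and> cyclically_reduced w \<and> \<not> orientable w \<and> cyclic_group2 w \<cong> BS1 m)"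
proof (intro conjI allI impI)
  fix w :: "gen2 letter list"
  assume w: "w \<noteq> [] \<and> cyclically_reduced w \<and> \<not> orientable w"
  then show "has_nonabelian_free_subgroup (cyclic_group2 w) \<or> (\<exists>m. cyclic_group2 w \<cong> BS1 m)"
    using non_orientable[of w] by (intro cyclic_group2_alternative) simp_all
next
  fix m
  have "bs_cyclic_word m \<noteq> []" by (simp add: bs_cyclic_word_def bs_head_def)
  then show "\<exists>w. w \<noteq> [] \<and> cyclically_reduced w \<and> \<not> orientable w \<and> cyclic_group2 w \<cong> BS1 m"
    using bs_cyclic_word_cyclically_reduced bs_cyclic_word_non_orientable bs_cyclic_word_iso by blast
qed

end
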